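(* Let $k$, $\chi$, $U(\chi)$, $\tau$, $\mathrm{Heis}(\chi)$ be as in the context. For every $\mathbf c\in k^n$ the surjective homomorphism of graded algebras $\overline\varphi:\operatorname{gr}(\overline B_{\mathbf c})\to H_\theta\ltimes U^-$ is an isomorphism; that is, the pair $(\mathrm{Heis}(\chi),\overline B_{\mathbf c})$ always admits an Iwasawa decomposition: the multiplication map $\overline G^+\otimes\overline B_{\mathbf c}\to\mathrm{Heis}(\chi)$ is a linear isomorphism.
   Context: Let $k$ be a field, $\mathbb N=\{0,1,2,\dots\}$, $I=\{1,\dots,n\}$, $\{\alpha_i\}_{i\in I}$ the standard basis of $\mathbb Z^n$. Let $\chi:\mathbb Z^n\times\mathbb Z^n\to k^\times$ be a bicharacter with $q_{ij}:=\chi(\alpha_i,\alpha_j)=q_{ji}$ for all $i,j$. $H=k[K_i^{\pm1}\mid i\in I]$ is the group algebra of $\mathbb Z^n$. $\widetilde U(\chi)$ is the Hopf algebra with generators $E_i,F_i,K_i^{\pm1}$, relations $K_iK_i^{-1}=1=K_i^{-1}K_i$, $K_iK_j=K_jK_i$, $K_iE_j=q_{ij}E_jK_i$, $K_iF_j=q_{ij}^{-1}F_jK_i$, $E_iF_j-F_jE_i=\delta_{ij}(K_i-K_i^{-1})$ and coproduct $\Delta(E_i)=E_i\otimes1+K_i\otimes E_i$, $\Delta(F_i)=F_i\otimes K_i^{-1}+1\otimes F_i$, $\Delta(K_i)=K_i\otimes K_i$. The subalgebras generated by the $E_i$, resp. the $F_i$, are the tensor algebras $T(V^+(\chi))$,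 $T(V^-(\chi))$ on $V^+(\chi)=\mathrm{span}\{E_i\}$, $V^-(\chi)=\mathrm{span}\{F_i\}$. $V^+(\chi)$ is a Yetter–Drinfeld module over $H$ with $K_i\cdot E_j=q_{ij}E_j$, $\delta(E_i)=K_i\otimes E_i$, so $T(V^+(\chi))$ is a $\mathbb Z^n$-graded braided Hopf algebra ($\deg E_i=\alpha_i$). $\omega$ is the algebra automorphism of $\widetilde U(\chi)$ with $\omega(E_i)=F_i$, $\omega(F_i)=E_i$, $\omega(K_i)=K_i^{-1}$. Fix a $\mathbb Z^n$-graded biideal $\mathcal I\subseteq\bigoplus_{m\ge2}T(V^+(\chi))_m$. Put $U(\chi)=\widetilde U(\chi)/(\mathcal I,\omega(\mathcal I))$, $U^+=T(V^+(\chi))/\mathcal I$ (a pre-Nichols algebra of diagonal type), $U^-=T(V^-(\chi))/\omega(\mathcal I)$. Multiplication $U^+\otimes H\otimes U^-\to U(\chi)$ is a linear isomorphism. Let $\tau:I\to I$ be a bijection with $\tau^2=\mathrm{id}$, $q_{\tau(i)\tau(j)}=q_{ij}$, and assume $\tau(\mathcal I)=\mathcal I$ for the automorphism $E_i\mapsto E_{\tau(i)}$. $H_\theta\subset H$ is the subalgebra generated by all $K_iK_{\tau(i)}^{-1}$, and $H_\theta\ltimes U^-$ is the subalgebra of $U(\chi)$ generated by $H_\theta$ and $U^-$ (as a vector space $H_\theta\otimes U^-$). For $\mathbf c=(c_1,\dots,c_n)\in k^n$, $B_{\mathbf c}$ is the subalgebra of $U(\chi)$ generated by $H_\theta$ and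 $B_i=F_i+c_iE_{\tau(i)}K_i^{-1}$, $i\in I$. Heisenberg double: $U(\chi)^{\mathrm{poly}}$ is the subalgebra of $U(\chi)$ generated by $F_i$, $E_iK_i^{-1}$, $K_i^{-1}$, $K_iK_{\tau(i)}^{-1}$ for $i\in I$ (it contains $B_{\mathbf c}$); $\mathrm{Heis}(\chi)$ is its quotient by the two-sided ideal generated by all $K_i^{-1}$, with quotient map $\kappa$. The subalgebras $H_\theta$ and $U^-$ embed in $\mathrm{Heis}(\chi)$ via $\kappa$. $\overline G^+$ is the subalgebra of $\mathrm{Heis}(\chi)$ generated by the $\kappa(E_iK_i^{-1})$; $\overline B_{\mathbf c}=\kappa(B_{\mathbf c})$ and $\overline B_i=\kappa(B_i)$. $\overline B_{\mathbf c}$ is filtered by $\deg(\overline B_i)=1$ and $\deg(h)=0$ for $h\in H_\theta$, and $\overline\varphi:\operatorname{gr}(\overline B_{\mathbf c})\to H_\theta\ltimes U^-$ is the surjective graded algebra homomorphism sending the class of $\overline B_i$ to $F_i$ and $h\in H_\theta$ to $h$. *)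

theory Defs
  imports
    "HOL-Library.Poly_Mapping"
    "HOL-Analysis.Finite_Cartesian_Product"
    "HOL-Algebra.Module"
    "HOL-Algebra.QuotRing"
    "HOL-Algebra.Generated_Rings"
begin

section \<open>Algebras over a field, as records\<close>

text \<open>
  A (noncommutative) algebra over the field \<open>'k\<close> is a ring record with scalar multiplication,
  i.e. a record of type \<open>('k, 'a) module\<close>. The library's \<open>ideal\<close>, \<open>Idl\<close> and \<open>Quot\<close> are
  two-sided and do not assume commutativity; an ideal of a unital algebra is a subspace. When the
  record is used only as a vector space, its multiplication and unit are irrelevant.
\<close>

text \<open>The subalgebra generated by \<open>S\<close> is the subring generated by \<open>S\<close> and the scalars.\<close>

definition gen_subalg :: "('k, 'a, 'm) module_scheme \<Rightarrow> 'a set \<Rightarrow> 'a set" where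
  "gen_subalg A S = generate_ring A (S \<union> range (\<lambda>c. c \<odot>\<^bsub>A\<^esub> \<one>\<^bsub>A\<^esub>))"

definition restrict_carrier ::
    "('k, 'a, 'm) module_scheme \<Rightarrow> 'a set \<Rightarrow> ('k, 'a, 'm) module_scheme" where
  "restrict_carrier A S = A\<lparr>carrier := S\<rparr>"

definition quot_alg :: "('k, 'a, 'm) module_scheme \<Rightarrow> 'a set \<Rightarrow> ('k, 'a set) module" where
  "quot_alg A J =
    \<lparr>carrier = carrier (A Quot J), mult = mult (A Quot J), one = one (A Quot J),
     zero = zero (A Quot J), add = add (A Quot J),
     smult = (\<lambda>c X. \<Union>x\<in>X. J +>\<^bsub>A\<^esub> (c \<odot>\<^bsub>A\<^esub> x))\<rparr>"

inductive_set lin_span :: "('k, 'a, 'm) module_scheme \<Rightarrow> 'a set \<Rightarrow> 'a set"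
  for A (structure) and S where
  zero: "\<zero> \<in> lin_span A S"
| base: "x \<in> S \<Longrightarrow> x \<in> lin_span A S"
| add: "x \<in> lin_span A S \<Longrightarrow> y \<in> lin_span A S \<Longrightarrow> x \<oplus> y \<in> lin_span A S"
| smult: "x \<in> lin_span A S \<Longrightarrow> c \<odot> x \<in> lin_span A S"

definition alg_hom ::
    "('k, 'a, 'm) module_scheme \<Rightarrow> ('k, 'b, 'n) module_scheme \<Rightarrow> ('a \<Rightarrow> 'b) set" where
  "alg_hom A B =
    {f \<in> ring_hom A B. \<forall>c. \<forall>x\<in>carrier A. f (c \<odot>\<^bsub>A\<^esub> x) = c \<odot>\<^bsub>B\<^esub> f x}"

definition linear_iso ::
    "('k, 'a, 'm) module_scheme \<Rightarrow> ('k, 'b, 'n) module_scheme \<Rightarrow> ('a \<Rightarrow> 'b) \<Rightarrow> bool" where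
  "linear_iso A B f \<longleftrightarrow>
     bij_betw f (carrier A) (carrier B) \<and>
     (\<forall>x\<in>carrier A. \<forall>y\<in>carrier A. f (x \<oplus>\<^bsub>A\<^esub> y) = f x \<oplus>\<^bsub>B\<^esub> f y) \<and>
     (\<forall>c. \<forall>x\<in>carrier A. f (c \<odot>\<^bsub>A\<^esub> x) = c \<odot>\<^bsub>B\<^esub> f x)"


section \<open>Tensor products\<close>

definition pm_scale :: "'k \<Rightarrow> ('b \<Rightarrow>\<^sub>0 'k) \<Rightarrow> ('b \<Rightarrow>\<^sub>0 'k::semiring_0)" where
  "pm_scale c f = Poly_Mapping.map ((*) c) f"

text \<open>The vector space with basis \<open>X\<close>.\<close>

definition free_module :: "'b set \<Rightarrow> ('k::field, 'b \<Rightarrow>\<^sub>0 'k) module" where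
  "free_module X =
    \<lparr>carrier = {f. Poly_Mapping.keys f \<subseteq> X}, mult = undefined, one = undefined,
     zero = 0, add = (+), smult = pm_scale\<rparr>"

definition bilinear_relations ::
    "('k::field, 'a, 'm) module_scheme \<Rightarrow> ('k, 'b, 'n) module_scheme \<Rightarrow> ('a \<times> 'b \<Rightarrow>\<^sub>0 'k) set" where
  "bilinear_relations A B =
     {Poly_Mapping.single (a \<oplus>\<^bsub>A\<^esub> a', b) 1
        - Poly_Mapping.single (a, b) 1 - Poly_Mapping.single (a', b) 1
       | a a' b. a \<in> carrier A \<and> a' \<in> carrier A \<and> b \<in> carrier B} \<union>
     {Poly_Mapping.single (a, b \<oplus>\<^bsub>B\<^esub> b') 1
        - Poly_Mapping.single (a, b) 1 - Poly_Mapping.single (a, b') 1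
       | a b b'. a \<in> carrier A \<and> b \<in> carrier B \<and> b' \<in> carrier B} \<union>
     {Poly_Mapping.single (c \<odot>\<^bsub>A\<^esub> a, b) 1 - Poly_Mapping.single (a, b) c
       | c a b. a \<in> carrier A \<and> b \<in> carrier B} \<union>
     {Poly_Mapping.single (a, c \<odot>\<^bsub>B\<^esub> b) 1 - Poly_Mapping.single (a, b) c
       | c a b. a \<in> carrier A \<and> b \<in> carrier B}"

definition tensor ::
    "('k::field, 'a, 'm) module_scheme \<Rightarrow> ('k, 'b, 'n) module_scheme
      \<Rightarrow> ('k, ('a \<times> 'b \<Rightarrow>\<^sub>0 'k) set) module" where
  "tensor A B =
    (let M = free_module (carrier A \<times> carrier B)
     in quot_alg M (lin_span M (bilinear_relations A B)))"

text \<open>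
  The linear map induced on a tensor product of two subspaces of \<open>A\<close> by \<open>a \<otimes> b \<mapsto> a b\<close>. Its value
  on a coset does not depend on the representative, so the image below is a singleton.
\<close>

definition tensor_mult ::
    "('k::field, 'a, 'm) module_scheme \<Rightarrow> ('a \<times> 'a \<Rightarrow>\<^sub>0 'k) set \<Rightarrow> 'a" where
  "tensor_mult A X =
     the_elem ((\<lambda>f. finsum A (\<lambda>p. Poly_Mapping.lookup f p \<odot>\<^bsub>A\<^esub> (fst p \<otimes>\<^bsub>A\<^esub> snd p)) (Poly_Mapping.keys f)) ` X)"


section \<open>Filtrations and associated graded algebras\<close>

text \<open>
  The smallest algebra filtration of the subalgebra generated by \<open>S0\<close> and \<open>S1\<close> in which \<open>S0\<close> has
  degree 0 and \<open>S1\<close> has degree 1.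
\<close>

inductive in_filtration ::
    "('k, 'a, 'm) module_scheme \<Rightarrow> 'a set \<Rightarrow> 'a set \<Rightarrow> nat \<Rightarrow> 'a \<Rightarrow> bool"
  for A (structure) and S0 S1 where
  one: "in_filtration A S0 S1 0 \<one>"
| deg0: "x \<in> S0 \<Longrightarrow> in_filtration A S0 S1 0 x"
| deg1: "x \<in> S1 \<Longrightarrow> in_filtration A S0 S1 1 x"
| mono: "in_filtration A S0 S1 m x \<Longrightarrow> in_filtration A S0 S1 (Suc m) x"
| add: "in_filtration A S0 S1 m x \<Longrightarrow> in_filtration A S0 S1 m y
         \<Longrightarrow> in_filtration A S0 S1 m (x \<oplus> y)"
| smult: "in_filtration A S0 S1 m x \<Longrightarrow> in_filtration A S0 S1 m (a \<odot> x)"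
| mult: "in_filtration A S0 S1 l x \<Longrightarrow> in_filtration A S0 S1 m y
          \<Longrightarrow> in_filtration A S0 S1 (l + m) (x \<otimes> y)"

definition filtration ::
    "('k, 'a, 'm) module_scheme \<Rightarrow> 'a set \<Rightarrow> 'a set \<Rightarrow> nat \<Rightarrow> 'a set" where
  "filtration A S0 S1 m = {x. in_filtration A S0 S1 m x}"

definition fil_below :: "('k, 'a, 'm) module_scheme \<Rightarrow> (nat \<Rightarrow> 'a set) \<Rightarrow> nat \<Rightarrow> 'a set" where
  "fil_below A Fil m = (case m of 0 \<Rightarrow> {\<zero>\<^bsub>A\<^esub>} | Suc l \<Rightarrow> Fil l)"

text \<open>The class in \<open>Fil m / Fil (m - 1)\<close> of \<open>x \<in> Fil m\<close>, as a homogeneous element of the graded algebra.\<close>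

definition gr_class ::
    "('k, 'a, 'm) module_scheme \<Rightarrow> (nat \<Rightarrow> 'a set) \<Rightarrow> nat \<Rightarrow> 'a \<Rightarrow> (nat \<Rightarrow> 'a set)" where
  "gr_class A Fil m x = (\<lambda>l. fil_below A Fil l +>\<^bsub>A\<^esub> (if l = m then x else \<zero>\<^bsub>A\<^esub>))"

text \<open>
  Elements of \<open>\<Oplus>\<^sub>m Fil m / Fil (m - 1)\<close> are finitely supported sequences of cosets;
  the multiplication is computed on arbitrary representatives, as in \<open>rcoset_mult\<close>.
\<close>

definition gr_alg ::
    "('k, 'a, 'm) module_scheme \<Rightarrow> (nat \<Rightarrow> 'a set) \<Rightarrow> ('k, nat \<Rightarrow> 'a set) module" where
  "gr_alg A Fil =
    \<lparr>carrier = {f. (\<forall>m. \<exists>x\<in>Fil m. f m = fil_below A Fil m +>\<^bsub>A\<^esub> x) \<and>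
                   finite {m. f m \<noteq> fil_below A Fil m}},
     mult = (\<lambda>f g m. \<Union>x\<in>{x. \<forall>i. x i \<in> f i}. \<Union>y\<in>{y. \<forall>i. y i \<in> g i}.
               fil_below A Fil m +>\<^bsub>A\<^esub> finsum A (\<lambda>i. x i \<otimes>\<^bsub>A\<^esub> y (m - i)) {..m}),
     one = gr_class A Fil 0 \<one>\<^bsub>A\<^esub>,
     zero = fil_below A Fil,
     add = (\<lambda>f g m. f m <+>\<^bsub>A\<^esub> g m),
     smult = (\<lambda>c f m. \<Union>x\<in>f m. fil_below A Fil m +>\<^bsub>A\<^esub> (c \<odot>\<^bsub>A\<^esub> x))\<rparr>"


section \<open>Free algebras\<close>

datatype 'x fmon = FMon (letters: "'x list")

instantiation fmon :: (type) monoid_add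
begin

definition zero_fmon :: "'a fmon" where "0 = FMon []"

definition plus_fmon :: "'a fmon \<Rightarrow> 'a fmon \<Rightarrow> 'a fmon" where
  "u + v = FMon (letters u @ letters v)"

instance
  by standard (simp_all add: zero_fmon_def plus_fmon_def)

end

text \<open>
  Since the free monoid is written additively, the convolution product of \<open>Poly_Mapping\<close>
  is the product of the free algebra.
\<close>

type_synonym ('x, 'k) free_alg = "'x fmon \<Rightarrow>\<^sub>0 'k"

definition fgen :: "'x \<Rightarrow> ('x, 'k::field) free_alg" where
  "fgen x = Poly_Mapping.single (FMon [x]) 1"

definition free_algebra :: "('k::field, ('x, 'k) free_alg) module" where
  "free_algebra =
    \<lparr>carrier = UNIV, mult = (*), one = 1, zero = 0, add = (+), smult = pm_scale\<rparr>"

text \<open>The algebra homomorphism of free algebras with \<open>x \<mapsto> g x\<close> on generators.\<close>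

definition relabel :: "('x \<Rightarrow> 'y) \<Rightarrow> ('x, 'k::field) free_alg \<Rightarrow> ('y, 'k) free_alg" where
  "relabel g f = (\<Sum>w\<in>Poly_Mapping.keys f. Poly_Mapping.single (map_fmon g w) (Poly_Mapping.lookup f w))"


section \<open>Bicharacters and graded biideals of the tensor algebra\<close>

definition bicharacter :: "(int ^ 'i \<Rightarrow> int ^ 'i \<Rightarrow> 'k::field) \<Rightarrow> bool" where
  "bicharacter chi \<longleftrightarrow>
     (\<forall>a b. chi a b \<noteq> 0) \<and>
     (\<forall>a b c. chi (a + b) c = chi a c * chi b c) \<and>
     (\<forall>a b c. chi a (b + c) = chi a b * chi a c)"

abbreviation alpha :: "'i \<Rightarrow> int ^ 'i::finite" where
  "alpha i \<equiv> axis i 1"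

definition qmat :: "(int ^ 'i \<Rightarrow> int ^ 'i \<Rightarrow> 'k) \<Rightarrow> 'i \<Rightarrow> 'i \<Rightarrow> 'k" where
  "qmat chi i j = chi (alpha i) (alpha j)"

text \<open>
  The tensor algebra of \<open>V\<^sup>+(\<chi>)\<close> is the free algebra on the index set. Its tensor square is
  the space with basis the pairs of words.
\<close>

definition word_deg :: "'i fmon \<Rightarrow> int ^ 'i::finite" where
  "word_deg w = sum_list (map alpha (letters w))"

definition pure_tensor ::
    "('i, 'k::field) free_alg \<Rightarrow> ('i, 'k) free_alg \<Rightarrow> ('i fmon \<times> 'i fmon \<Rightarrow>\<^sub>0 'k)" where
  "pure_tensor f g =
     (\<Sum>u\<in>Poly_Mapping.keys f. \<Sum>v\<in>Poly_Mapping.keys g. Poly_Mapping.single (u, v) (Poly_Mapping.lookup f u * Poly_Mapping.lookup g v))"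

text \<open>
  The coaction is \<open>\<delta>(E\<^sub>i) = K\<^sub>i \<otimes> E\<^sub>i\<close> and the action is \<open>K\<^sub>i \<cdot> E\<^sub>j = q\<^sub>i\<^sub>j E\<^sub>j\<close>, so the braiding of the
  Yetter-Drinfeld module maps \<open>v \<otimes> u\<close> to \<open>\<chi>(deg v, deg u) u \<otimes> v\<close>. The product of the braided
  tensor square is therefore \<open>(u \<otimes> v)(u' \<otimes> v') = \<chi>(deg v, deg u') u u' \<otimes> v v'\<close>.
\<close>

definition braided_mult ::
    "(int ^ 'i \<Rightarrow> int ^ 'i \<Rightarrow> 'k::field) \<Rightarrow> ('i::finite fmon \<times> 'i fmon \<Rightarrow>\<^sub>0 'k)
      \<Rightarrow> ('i fmon \<times> 'i fmon \<Rightarrow>\<^sub>0 'k) \<Rightarrow> ('i fmon \<times> 'i fmon \<Rightarrow>\<^sub>0 'k)" where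
  "braided_mult chi P Q =
     (\<Sum>(u, v)\<in>Poly_Mapping.keys P. \<Sum>(u', v')\<in>Poly_Mapping.keys Q.
        Poly_Mapping.single (u + u', v + v')
          (chi (word_deg v) (word_deg u') * Poly_Mapping.lookup P (u, v) * Poly_Mapping.lookup Q (u', v')))"

text \<open>
  The coproduct is the algebra homomorphism into the braided tensor square for which
  the generators are primitive.
\<close>

primrec coproduct_word ::
    "(int ^ 'i \<Rightarrow> int ^ 'i \<Rightarrow> 'k::field) \<Rightarrow> 'i::finite list \<Rightarrow> ('i fmon \<times> 'i fmon \<Rightarrow>\<^sub>0 'k)" where
  "coproduct_word chi [] = pure_tensor 1 1"
| "coproduct_word chi (i # w) =
     braided_mult chi (pure_tensor (fgen i) 1 + pure_tensor 1 (fgen i)) (coproduct_word chi w)"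

definition coproduct ::
    "(int ^ 'i \<Rightarrow> int ^ 'i \<Rightarrow> 'k::field) \<Rightarrow> ('i::finite, 'k) free_alg
      \<Rightarrow> ('i fmon \<times> 'i fmon \<Rightarrow>\<^sub>0 'k)" where
  "coproduct chi f = (\<Sum>w\<in>Poly_Mapping.keys f. pm_scale (Poly_Mapping.lookup f w) (coproduct_word chi (letters w)))"

definition counit :: "('i, 'k::field) free_alg \<Rightarrow> 'k" where
  "counit f = Poly_Mapping.lookup f 0"

definition biideal :: "(int ^ 'i \<Rightarrow> int ^ 'i \<Rightarrow> 'k::field) \<Rightarrow> ('i::finite, 'k) free_alg set \<Rightarrow> bool" where
  "biideal chi \<I> \<longleftrightarrow>
     ideal \<I> free_algebra \<and>
     (\<forall>f\<in>\<I>. coproduct chi f \<in>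
        lin_span (free_module UNIV) {pure_tensor f g | f g. f \<in> \<I> \<or> g \<in> \<I>}) \<and>
     (\<forall>f\<in>\<I>. counit f = 0)"

definition graded_subspace :: "('i::finite, 'k::field) free_alg set \<Rightarrow> bool" where
  "graded_subspace \<I> \<longleftrightarrow>
     (\<forall>f\<in>\<I>. \<forall>d. (\<Sum>w | w \<in> Poly_Mapping.keys f \<and> word_deg w = d. Poly_Mapping.single w (Poly_Mapping.lookup f w)) \<in> \<I>)"

definition tensor_degree_ge :: "nat \<Rightarrow> ('i, 'k::field) free_alg set" where
  "tensor_degree_ge m = {f. \<forall>w\<in>Poly_Mapping.keys f. m \<le> length (letters w)}"


section \<open>The algebra \<open>U(\<chi>)\<close>\<close>

datatype 'i generator = E 'i | F 'i | K 'i | Kinv 'i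

definition Utilde_relations ::
    "(int ^ 'i \<Rightarrow> int ^ 'i \<Rightarrow> 'k::field) \<Rightarrow> ('i::finite generator, 'k) free_alg set" where
  "Utilde_relations chi =
     {fgen (K i) * fgen (Kinv i) - 1 | i. True} \<union>
     {fgen (Kinv i) * fgen (K i) - 1 | i. True} \<union>
     {fgen (K i) * fgen (K j) - fgen (K j) * fgen (K i) | i j. True} \<union>
     {fgen (K i) * fgen (E j) - pm_scale (qmat chi i j) (fgen (E j) * fgen (K i)) | i j. True} \<union>
     {fgen (K i) * fgen (F j) - pm_scale (inverse (qmat chi i j)) (fgen (F j) * fgen (K i)) | i j. True} \<union>
     {fgen (E i) * fgen (F j) - fgen (F j) * fgen (E i)
        - (if i = j then fgen (K i) - fgen (Kinv i) else 0) | i j. True}"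

definition Utilde_ideal ::
    "(int ^ 'i \<Rightarrow> int ^ 'i \<Rightarrow> 'k::field) \<Rightarrow> ('i::finite generator, 'k) free_alg set" where
  "Utilde_ideal chi = Idl\<^bsub>free_algebra\<^esub> (Utilde_relations chi)"

definition Utilde ::
    "(int ^ 'i \<Rightarrow> int ^ 'i \<Rightarrow> 'k::field) \<Rightarrow> ('k, ('i::finite generator, 'k) free_alg set) module" where
  "Utilde chi = quot_alg free_algebra (Utilde_ideal chi)"

definition Utilde_class ::
    "(int ^ 'i \<Rightarrow> int ^ 'i \<Rightarrow> 'k::field) \<Rightarrow> ('i::finite generator, 'k) free_alg
      \<Rightarrow> ('i generator, 'k) free_alg set" where
  "Utilde_class chi f = Utilde_ideal chi +>\<^bsub>free_algebra\<^esub> f"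

primrec omega_gen :: "'i generator \<Rightarrow> 'i generator" where
  "omega_gen (E i) = F i"
| "omega_gen (F i) = E i"
| "omega_gen (K i) = Kinv i"
| "omega_gen (Kinv i) = K i"

definition omega ::
    "(int ^ 'i \<Rightarrow> int ^ 'i \<Rightarrow> 'k::field) \<Rightarrow> ('i::finite generator, 'k) free_alg set
      \<Rightarrow> ('i generator, 'k) free_alg set" where
  "omega chi X = (\<Union>f\<in>X. Utilde_class chi (relabel omega_gen f))"

text \<open>The image of the ideal \<open>\<I>\<close> of the tensor algebra of \<open>V\<^sup>+(\<chi>)\<close> in \<open>Utilde \<chi>\<close>.\<close>

definition plus_part ::
    "(int ^ 'i \<Rightarrow> int ^ 'i \<Rightarrow> 'k::field) \<Rightarrow> ('i::finite, 'k) free_alg set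
      \<Rightarrow> ('i generator, 'k) free_alg set set" where
  "plus_part chi \<I> = (\<lambda>f. Utilde_class chi (relabel E f)) ` \<I>"

definition U_ideal ::
    "(int ^ 'i \<Rightarrow> int ^ 'i \<Rightarrow> 'k::field) \<Rightarrow> ('i::finite, 'k) free_alg set
      \<Rightarrow> ('i generator, 'k) free_alg set set" where
  "U_ideal chi \<I> = Idl\<^bsub>Utilde chi\<^esub> (plus_part chi \<I> \<union> omega chi ` plus_part chi \<I>)"

type_synonym ('i, 'k) U_elt = "('i generator, 'k) free_alg set set"

definition U_alg ::
    "(int ^ 'i \<Rightarrow> int ^ 'i \<Rightarrow> 'k::field) \<Rightarrow> ('i::finite, 'k) free_alg set
      \<Rightarrow> ('k, ('i, 'k) U_elt) module" where
  "U_alg chi \<I> = quot_alg (Utilde chi) (U_ideal chi \<I>)"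

definition U_gen ::
    "(int ^ 'i \<Rightarrow> int ^ 'i \<Rightarrow> 'k::field) \<Rightarrow> ('i::finite, 'k) free_alg set
      \<Rightarrow> 'i generator \<Rightarrow> ('i, 'k) U_elt" where
  "U_gen chi \<I> x = U_ideal chi \<I> +>\<^bsub>Utilde chi\<^esub> Utilde_class chi (fgen x)"


section \<open>Subalgebras of \<open>U(\<chi>)\<close>\<close>

definition EKinv ::
    "(int ^ 'i \<Rightarrow> int ^ 'i \<Rightarrow> 'k::field) \<Rightarrow> ('i::finite, 'k) free_alg set \<Rightarrow> 'i \<Rightarrow> ('i, 'k) U_elt" where
  "EKinv chi \<I> i = U_gen chi \<I> (E i) \<otimes>\<^bsub>U_alg chi \<I>\<^esub> U_gen chi \<I> (Kinv i)"

definition Ktheta ::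
    "(int ^ 'i \<Rightarrow> int ^ 'i \<Rightarrow> 'k::field) \<Rightarrow> ('i::finite, 'k) free_alg set \<Rightarrow> ('i \<Rightarrow> 'i)
      \<Rightarrow> 'i \<Rightarrow> ('i, 'k) U_elt" where
  "Ktheta chi \<I> \<tau> i = U_gen chi \<I> (K i) \<otimes>\<^bsub>U_alg chi \<I>\<^esub> U_gen chi \<I> (Kinv (\<tau> i))"

definition Htheta ::
    "(int ^ 'i \<Rightarrow> int ^ 'i \<Rightarrow> 'k::field) \<Rightarrow> ('i::finite, 'k) free_alg set \<Rightarrow> ('i \<Rightarrow> 'i)
      \<Rightarrow> ('i, 'k) U_elt set" where
  "Htheta chi \<I> \<tau> = gen_subalg (U_alg chi \<I>) (range (Ktheta chi \<I> \<tau>))"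

definition Uminus ::
    "(int ^ 'i \<Rightarrow> int ^ 'i \<Rightarrow> 'k::field) \<Rightarrow> ('i::finite, 'k) free_alg set \<Rightarrow> ('i, 'k) U_elt set" where
  "Uminus chi \<I> = gen_subalg (U_alg chi \<I>) (range (\<lambda>i. U_gen chi \<I> (F i)))"

definition HU ::
    "(int ^ 'i \<Rightarrow> int ^ 'i \<Rightarrow> 'k::field) \<Rightarrow> ('i::finite, 'k) free_alg set \<Rightarrow> ('i \<Rightarrow> 'i)
      \<Rightarrow> ('k, ('i, 'k) U_elt) module" where
  "HU chi \<I> \<tau> = restrict_carrier (U_alg chi \<I>) (gen_subalg (U_alg chi \<I>) (Htheta chi \<I> \<tau> \<union> Uminus chi \<I>))"

text \<open>The homogeneous components of \<open>HU\<close> for \<open>deg F\<^sub>i = 1\<close> and \<open>deg h = 0\<close>.\<close>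

definition HU_component ::
    "(int ^ 'i \<Rightarrow> int ^ 'i \<Rightarrow> 'k::field) \<Rightarrow> ('i::finite, 'k) free_alg set \<Rightarrow> ('i \<Rightarrow> 'i)
      \<Rightarrow> nat \<Rightarrow> ('i, 'k) U_elt set" where
  "HU_component chi \<I> \<tau> m =
     lin_span (U_alg chi \<I>)
       {h \<otimes>\<^bsub>U_alg chi \<I>\<^esub> foldr (\<lambda>i x. U_gen chi \<I> (F i) \<otimes>\<^bsub>U_alg chi \<I>\<^esub> x) w \<one>\<^bsub>U_alg chi \<I>\<^esub>
         | h w. h \<in> Htheta chi \<I> \<tau> \<and> length w = m}"

definition B_gen ::
    "(int ^ 'i \<Rightarrow> int ^ 'i \<Rightarrow> 'k::field) \<Rightarrow> ('i::finite, 'k) free_alg set \<Rightarrow> ('i \<Rightarrow> 'i)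
      \<Rightarrow> ('i \<Rightarrow> 'k) \<Rightarrow> 'i \<Rightarrow> ('i, 'k) U_elt" where
  "B_gen chi \<I> \<tau> c i =
     U_gen chi \<I> (F i) \<oplus>\<^bsub>U_alg chi \<I>\<^esub>
     c i \<odot>\<^bsub>U_alg chi \<I>\<^esub> (U_gen chi \<I> (E (\<tau> i)) \<otimes>\<^bsub>U_alg chi \<I>\<^esub> U_gen chi \<I> (Kinv i))"

definition B_alg ::
    "(int ^ 'i \<Rightarrow> int ^ 'i \<Rightarrow> 'k::field) \<Rightarrow> ('i::finite, 'k) free_alg set \<Rightarrow> ('i \<Rightarrow> 'i)
      \<Rightarrow> ('i \<Rightarrow> 'k) \<Rightarrow> ('i, 'k) U_elt set" where
  "B_alg chi \<I> \<tau> c = gen_subalg (U_alg chi \<I>) (Htheta chi \<I> \<tau> \<union> range (B_gen chi \<I> \<tau> c))"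


section \<open>The Heisenberg double\<close>

definition Upoly ::
    "(int ^ 'i \<Rightarrow> int ^ 'i \<Rightarrow> 'k::field) \<Rightarrow> ('i::finite, 'k) free_alg set \<Rightarrow> ('i \<Rightarrow> 'i)
      \<Rightarrow> ('k, ('i, 'k) U_elt) module" where
  "Upoly chi \<I> \<tau> =
     restrict_carrier (U_alg chi \<I>)
       (gen_subalg (U_alg chi \<I>)
         (range (\<lambda>i. U_gen chi \<I> (F i)) \<union> range (EKinv chi \<I>) \<union>
          range (\<lambda>i. U_gen chi \<I> (Kinv i)) \<union> range (Ktheta chi \<I> \<tau>)))"

definition Heis_ideal ::
    "(int ^ 'i \<Rightarrow> int ^ 'i \<Rightarrow> 'k::field) \<Rightarrow> ('i::finite, 'k) free_alg set \<Rightarrow> ('i \<Rightarrow> 'i)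
      \<Rightarrow> ('i, 'k) U_elt set" where
  "Heis_ideal chi \<I> \<tau> = Idl\<^bsub>Upoly chi \<I> \<tau>\<^esub> (range (\<lambda>i. U_gen chi \<I> (Kinv i)))"

definition Heis ::
    "(int ^ 'i \<Rightarrow> int ^ 'i \<Rightarrow> 'k::field) \<Rightarrow> ('i::finite, 'k) free_alg set \<Rightarrow> ('i \<Rightarrow> 'i)
      \<Rightarrow> ('k, ('i, 'k) U_elt set) module" where
  "Heis chi \<I> \<tau> = quot_alg (Upoly chi \<I> \<tau>) (Heis_ideal chi \<I> \<tau>)"

definition kappa ::
    "(int ^ 'i \<Rightarrow> int ^ 'i \<Rightarrow> 'k::field) \<Rightarrow> ('i::finite, 'k) free_alg set \<Rightarrow> ('i \<Rightarrow> 'i)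
      \<Rightarrow> ('i, 'k) U_elt \<Rightarrow> ('i, 'k) U_elt set" where
  "kappa chi \<I> \<tau> x = Heis_ideal chi \<I> \<tau> +>\<^bsub>Upoly chi \<I> \<tau>\<^esub> x"

definition Gplus_bar ::
    "(int ^ 'i \<Rightarrow> int ^ 'i \<Rightarrow> 'k::field) \<Rightarrow> ('i::finite, 'k) free_alg set \<Rightarrow> ('i \<Rightarrow> 'i)
      \<Rightarrow> ('i, 'k) U_elt set set" where
  "Gplus_bar chi \<I> \<tau> = gen_subalg (Heis chi \<I> \<tau>) (range (\<lambda>i. kappa chi \<I> \<tau> (EKinv chi \<I> i)))"

definition B_bar ::
    "(int ^ 'i \<Rightarrow> int ^ 'i \<Rightarrow> 'k::field) \<Rightarrow> ('i::finite, 'k) free_alg set \<Rightarrow> ('i \<Rightarrow> 'i)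
      \<Rightarrow> ('i \<Rightarrow> 'k) \<Rightarrow> ('i, 'k) U_elt set set" where
  "B_bar chi \<I> \<tau> c = kappa chi \<I> \<tau> ` B_alg chi \<I> \<tau> c"

definition B_bar_filtration ::
    "(int ^ 'i \<Rightarrow> int ^ 'i \<Rightarrow> 'k::field) \<Rightarrow> ('i::finite, 'k) free_alg set \<Rightarrow> ('i \<Rightarrow> 'i)
      \<Rightarrow> ('i \<Rightarrow> 'k) \<Rightarrow> nat \<Rightarrow> ('i, 'k) U_elt set set" where
  "B_bar_filtration chi \<I> \<tau> c =
     filtration (Heis chi \<I> \<tau>) (kappa chi \<I> \<tau> ` Htheta chi \<I> \<tau>)
       (range (\<lambda>i. kappa chi \<I> \<tau> (B_gen chi \<I> \<tau> c i)))"

definition gr_B_bar ::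
    "(int ^ 'i \<Rightarrow> int ^ 'i \<Rightarrow> 'k::field) \<Rightarrow> ('i::finite, 'k) free_alg set \<Rightarrow> ('i \<Rightarrow> 'i)
      \<Rightarrow> ('i \<Rightarrow> 'k) \<Rightarrow> ('k, nat \<Rightarrow> ('i, 'k) U_elt set set) module" where
  "gr_B_bar chi \<I> \<tau> c =
     gr_alg (restrict_carrier (Heis chi \<I> \<tau>) (B_bar chi \<I> \<tau> c)) (B_bar_filtration chi \<I> \<tau> c)"

definition gr_B_bar_class ::
    "(int ^ 'i \<Rightarrow> int ^ 'i \<Rightarrow> 'k::field) \<Rightarrow> ('i::finite, 'k) free_alg set \<Rightarrow> ('i \<Rightarrow> 'i)
      \<Rightarrow> ('i \<Rightarrow> 'k) \<Rightarrow> nat \<Rightarrow> ('i, 'k) U_elt set \<Rightarrow> (nat \<Rightarrow> ('i, 'k) U_elt set set)" where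
  "gr_B_bar_class chi \<I> \<tau> c =
     gr_class (restrict_carrier (Heis chi \<I> \<tau>) (B_bar chi \<I> \<tau> c)) (B_bar_filtration chi \<I> \<tau> c)"

text \<open>
  The defining properties of the graded algebra homomorphism from \<open>gr_B_bar\<close> to \<open>HU\<close>.
  As \<open>gr_B_bar\<close> is generated in degrees 0 and 1, they determine it on the carrier.
\<close>

definition is_phi_bar ::
    "(int ^ 'i \<Rightarrow> int ^ 'i \<Rightarrow> 'k::field) \<Rightarrow> ('i::finite, 'k) free_alg set \<Rightarrow> ('i \<Rightarrow> 'i)
      \<Rightarrow> ('i \<Rightarrow> 'k) \<Rightarrow> ((nat \<Rightarrow> ('i, 'k) U_elt set set) \<Rightarrow> ('i, 'k) U_elt) \<Rightarrow> bool" where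
  "is_phi_bar chi \<I> \<tau> c \<phi> \<longleftrightarrow>
     \<phi> \<in> alg_hom (gr_B_bar chi \<I> \<tau> c) (HU chi \<I> \<tau>) \<and>
     (\<forall>m. \<forall>x\<in>B_bar_filtration chi \<I> \<tau> c m.
        \<phi> (gr_B_bar_class chi \<I> \<tau> c m x) \<in> HU_component chi \<I> \<tau> m) \<and>
     (\<forall>i. \<phi> (gr_B_bar_class chi \<I> \<tau> c 1 (kappa chi \<I> \<tau> (B_gen chi \<I> \<tau> c i))) = U_gen chi \<I> (F i)) \<and>
     (\<forall>h\<in>Htheta chi \<I> \<tau>. \<phi> (gr_B_bar_class chi \<I> \<tau> c 0 (kappa chi \<I> \<tau> h)) = h)"

definition iwasawa_decomposition ::
    "(int ^ 'i \<Rightarrow> int ^ 'i \<Rightarrow> 'k::field) \<Rightarrow> ('i::finite, 'k) free_alg set \<Rightarrow> ('i \<Rightarrow> 'i)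
      \<Rightarrow> ('i \<Rightarrow> 'k) \<Rightarrow> bool" where
  "iwasawa_decomposition chi \<I> \<tau> c \<longleftrightarrow>
     linear_iso
       (tensor (restrict_carrier (Heis chi \<I> \<tau>) (Gplus_bar chi \<I> \<tau>))
               (restrict_carrier (Heis chi \<I> \<tau>) (B_bar chi \<I> \<tau> c)))
       (Heis chi \<I> \<tau>)
       (tensor_mult (Heis chi \<I> \<tau>))"

end

theory Submission
  imports Defs "HOL-Library.Multiset"
begin

text \<open>
  The algebra \<open>U(\<chi>)\<close> acts on the space with basis the triples \<open>(w, l, v)\<close>, which stand for
  \<open>X\<^sub>w K\<^sub>l F\<^sub>v\<close> with \<open>X\<^sub>i = E\<^sub>i K\<^sub>i\<inverse>\<close>, modulo the subspace \<open>N = \<I> \<otimes> H \<otimes> U\<^sup>- + U\<^sup>+ \<otimes> H \<otimes> \<I>\<close>;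
  applying elements to the basis vector of the unit gives the triangular decomposition. The
  polynomial part respects the filtration by the height of \<open>l\<close> and \<open>K\<^sub>i\<inverse>\<close> lowers it, which gives
  \<open>Heis = G\<^sup>+ \<otimes> H\<^sub>\<theta> \<otimes> U\<^sup>-\<close>.

  With Sweedler notation for the coproduct of the inverse bicharacter put
  \<open>Psi v = \<Sum> Y(v\<^sub>1) F(v\<^sub>2)\<close>, where \<open>Y\<close> is multiplicative with \<open>Y\<^sub>i = B\<^sub>i - F\<^sub>i\<close>. In \<open>Heis\<close> the
  commutator relations have only one term \<open>1\<close> instead of \<open>1 - K\<^sub>i\<^sup>-\<^sup>2\<close>, and coassociativity gives
  \<open>B\<^sub>j Psi(v) = Psi(F\<^sub>j v) - c\<^sub>\<tau>\<^sub>j K\<^sub>j K\<^sub>\<tau>\<^sub>j\<inverse> Psi(\<partial>\<^sub>\<tau>\<^sub>j v)\<close> with a skew derivation \<open>\<partial>\<close>. Hence the elements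
  \<open>h Psi(v)\<close> span the coideal subalgebra. Since \<open>\<I>\<close> is a biideal stable under \<open>\<tau>\<close>, \<open>Psi\<close> kills \<open>\<I>\<close>, and
  \<open>Psi v\<close> is \<open>F\<^sub>v\<close> plus terms with shorter words in the \<open>F\<^sub>i\<close>. So \<open>X\<^sub>w K\<^sub>l F\<^sub>v \<mapsto> X\<^sub>w K\<^sub>l Psi(v)\<close> is a
  unitriangular bijection of \<open>Heis\<close>, which gives the Iwasawa decomposition, and \<open>v \<mapsto> Psi v\<close>
  identifies \<open>H\<^sub>\<theta> \<ltimes> U\<^sup>-\<close> with the associated graded algebra.
\<close>

section \<open>Linear maps on finitely supported functions\<close>

text \<open>What has to be excluded is that a relation among the \<open>F_i\<close>, evaluated on
  the \<open>B_i\<close>, forces a further relation of lower degree; \<open>Psi\<close> supplies the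
  exact lower-order corrections. The inverse bicharacter is dictated by \<open>F_j\<close>, which
  passes \<open>Y_u\<close> with the factor \<open>chi(deg u, alpha j)^-1\<close>: left
  multiplication by \<open>F_j + Y_j\<close> on the products \<open>Y_u F_v\<close> is
  multiplication by a primitive element for that braiding, up to one skew derivation.

  The hypotheses on \<open>\<I>\<close> enter as follows. The coideal property and degree at least 2
  make \<open>\<I>\<close> stable under skew derivations, and these are the commutators of
  \<open>E_i\<close> and \<open>F_j\<close> with words. Both the derivations for \<open>chi\<close>
  and those for its inverse occur; the inverse braiding yields the second kind from the first. The
  grading has two uses. Scalars from reordering depend only on the degree, so a homogeneous relation
  stays a relation when \<open>E_i\<close> or \<open>Y_i\<close> is expressed by \<open>X_i\<close>
  and \<open>K_l\<close>. Moreover \<open>N\<close> becomes stable under projection to a fixed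
  length of \<open>v\<close>, so leading terms can be compared modulo \<open>N\<close>.\<close>

lemma lookup_pm_scale [simp]: "Poly_Mapping.lookup (pm_scale c f) x = c * Poly_Mapping.lookup f x"
  by (auto simp: pm_scale_def map.rep_eq when_def)

interpretation pm: vector_space "pm_scale :: 'k::field \<Rightarrow> ('b \<Rightarrow>\<^sub>0 'k) \<Rightarrow> ('b \<Rightarrow>\<^sub>0 'k)"
  by standard (simp_all add: poly_mapping_eq_iff fun_eq_iff lookup_add algebra_simps)

lemma pm_scale_single: "pm_scale c (Poly_Mapping.single x d) = Poly_Mapping.single x (c * d)"
  by (rule poly_mapping_eqI) (simp add: lookup_single when_def)

abbreviation bv :: "'b \<Rightarrow> 'b \<Rightarrow>\<^sub>0 'k::field" where
  "bv x \<equiv> Poly_Mapping.single x 1"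

lemma single_conv_bv: "Poly_Mapping.single x c = pm_scale c (bv x)"
  by (simp add: pm_scale_single)

lemma pm_scale_conv_mult: "pm_scale c f = Poly_Mapping.single 0 c * f"
  by (simp add: pm_scale_def mult_map_scale_conv_mult)

lemma pm_scale_mult_left: "pm_scale c f * g = pm_scale c (f * g)"
  for f g :: "('x, 'k::field) free_alg"
  by (simp add: pm_scale_conv_mult mult.assoc)

lemma pm_single_sum:
  "f = (\<Sum>w\<in>Poly_Mapping.keys f. pm_scale (Poly_Mapping.lookup f w) (bv w))"
  by (rule poly_mapping_eqI)
    (auto simp: lookup_sum lookup_single when_def in_keys_iff if_distrib[of "\<lambda>x. _ * x"] cong: if_cong)

text \<open>A plain predicate, so that linearity is discharged by simplification in the many
  arguments that compare two linear maps on basis vectors.\<close>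

definition plin :: "(('a \<Rightarrow>\<^sub>0 'k::field) \<Rightarrow> ('b \<Rightarrow>\<^sub>0 'k)) \<Rightarrow> bool" where
  "plin f \<longleftrightarrow> (\<forall>a b. f (a + b) = f a + f b) \<and> (\<forall>c a. f (pm_scale c a) = pm_scale c (f a))"

lemma plin_add: "plin f \<Longrightarrow> f (a + b) = f a + f b"
  and plin_scale: "plin f \<Longrightarrow> f (pm_scale c a) = pm_scale c (f a)"
  by (auto simp: plin_def)

lemma plin_0: "plin f \<Longrightarrow> f 0 = 0"
  by (metis plin_scale pm.scale_zero_left)

lemma plin_minus: "plin f \<Longrightarrow> f (- a) = - f a"
  by (metis plin_scale pm.scale_minus_left pm.scale_one)

lemma plin_diff: "plin f \<Longrightarrow> f (a - b) = f a - f b"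
  using plin_add[of f a "- b"] plin_minus[of f b] by simp

lemma plin_sum: "plin f \<Longrightarrow> f (sum g A) = (\<Sum>x\<in>A. f (g x))"
  by (induction A rule: infinite_finite_induct) (simp_all add: plin_0 plin_add)

text \<open>The case \<open>single\<close> ranges only over the support of \<open>f\<close>; support
  conditions on \<open>f\<close> are available there although the induction runs over arbitrary
  elements.\<close>

lemma pm_induct [case_names zero scale add single]:
  assumes "P 0" "\<And>c f. P f \<Longrightarrow> P (pm_scale c f)" "\<And>f g. P f \<Longrightarrow> P g \<Longrightarrow> P (f + g)"
    and "\<And>x. x \<in> Poly_Mapping.keys f \<Longrightarrow> P (bv x)"
  shows "P f"
proof -
  have "P (\<Sum>w\<in>A. pm_scale (Poly_Mapping.lookup f w) (bv w))" if "A \<subseteq> Poly_Mapping.keys f" for A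
  proof -
    have "finite A" using that by (rule finite_subset) simp
    then show ?thesis using that assms by (induction A rule: finite_induct) auto
  qed
  from this[of "Poly_Mapping.keys f"] show ?thesis by (simp flip: pm_single_sum)
qed

lemma plin_eqI:
  assumes "plin f" "plin g" and "\<And>x. x \<in> Poly_Mapping.keys a \<Longrightarrow> f (bv x) = g (bv x)"
  shows "f a = g a"
  by (induction a rule: pm_induct) (auto simp: plin_0 plin_add plin_scale assms)

lemma plin_ident [intro, simp]: "plin (\<lambda>x. x)"
  and plin_zero_fun [intro, simp]: "plin (\<lambda>x. 0)"
  by (auto simp: plin_def)

lemma plin_pm_scale [intro, simp]: "plin f \<Longrightarrow> plin (\<lambda>a. pm_scale c (f a))"
  by (auto simp: plin_def pm.scale_right_distrib mult.commute)

lemma plin_plus [intro, simp]: "plin f \<Longrightarrow> plin g \<Longrightarrow> plin (\<lambda>a. f a + g a)"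
  and plin_minus_fun [intro, simp]: "plin f \<Longrightarrow> plin g \<Longrightarrow> plin (\<lambda>a. f a - g a)"
  and plin_uminus [intro, simp]: "plin f \<Longrightarrow> plin (\<lambda>a. - f a)"
  by (auto simp: plin_def pm.scale_right_distrib pm.scale_right_diff_distrib)

lemma plin_comp: "plin f \<Longrightarrow> plin g \<Longrightarrow> plin (\<lambda>a. f (g a))"
  by (auto simp: plin_def)

lemma plin_sum_fun [intro, simp]: "(\<And>x. x \<in> A \<Longrightarrow> plin (f x)) \<Longrightarrow> plin (\<lambda>a. \<Sum>x\<in>A. f x a)"
  by (induction A rule: infinite_finite_induct) auto

lemma plin_mult_left [intro, simp]: "plin f \<Longrightarrow> plin (\<lambda>a. h * f a)"
  for f :: "('a \<Rightarrow>\<^sub>0 'k::field) \<Rightarrow> ('x, 'k) free_alg"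
proof -
  assume f: "plin f"
  \<comment> \<open>Scaling is left multiplication by a multiple of the unit, so the claim amounts
    to these multiples being central.\<close>
  have comm: "Poly_Mapping.single 0 c * h = h * Poly_Mapping.single 0 c" for c :: 'k
  proof (induction h rule: pm_induct)
    case (scale d f)
    have "Poly_Mapping.single 0 c * (Poly_Mapping.single 0 d * f)
        = Poly_Mapping.single 0 d * (Poly_Mapping.single 0 c * f)"
      by (simp add: mult.assoc[symmetric] mult_single mult.commute)
    then show ?case using scale by (simp add: pm_scale_conv_mult mult.assoc)
  qed (simp_all add: algebra_simps mult_single)
  then have "h * pm_scale c g = pm_scale c (h * g)" for c and g :: "('x, 'k) free_alg"
    by (simp add: pm_scale_conv_mult mult.assoc[symmetric])
  then show ?thesis using f by (auto simp: plin_def algebra_simps)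
qed

lemma pm_scale_mult_right: "f * pm_scale c g = pm_scale c (f * g)"
  for f g :: "('x, 'k::field) free_alg"
  using plin_mult_left[OF plin_ident, of f] plin_scale by blast

lemma plin_mult_right [intro, simp]: "plin f \<Longrightarrow> plin (\<lambda>a. f a * h)"
  for f :: "('a \<Rightarrow>\<^sub>0 'k::field) \<Rightarrow> ('x, 'k) free_alg"
  by (auto simp: plin_def algebra_simps pm_scale_mult_left)

section \<open>Linear extension of a function on a basis\<close>

definition lext :: "('a \<Rightarrow> ('b \<Rightarrow>\<^sub>0 'k)) \<Rightarrow> ('a \<Rightarrow>\<^sub>0 'k::field) \<Rightarrow> ('b \<Rightarrow>\<^sub>0 'k)" where
  "lext g f = (\<Sum>w\<in>Poly_Mapping.keys f. pm_scale (Poly_Mapping.lookup f w) (g w))"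

lemma lext_superset:
  assumes "finite A" "Poly_Mapping.keys f \<subseteq> A"
  shows "lext g f = (\<Sum>w\<in>A. pm_scale (Poly_Mapping.lookup f w) (g w))"
  unfolding lext_def using assms
  by (intro sum.mono_neutral_left) (auto simp: in_keys_iff)

lemma plin_lext [simp, intro]: "plin (lext g)"
proof -
  have "lext g (a + b) = lext g a + lext g b" for a b
  proof -
    let ?A = "Poly_Mapping.keys a \<union> Poly_Mapping.keys b"
    have "Poly_Mapping.keys (a + b) \<subseteq> ?A" by (rule keys_add)
    then show ?thesis
      by (simp add: lext_superset[of ?A] lookup_add pm.scale_left_distrib sum.distrib)
  qed
  moreover have "lext g (pm_scale c a) = pm_scale c (lext g a)" for c a
  proof -
    have "Poly_Mapping.keys (pm_scale c a) \<subseteq> Poly_Mapping.keys a" by (auto simp: in_keys_iff)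
    then show ?thesis
      by (simp add: lext_superset[of "Poly_Mapping.keys a"] pm.scale_sum_right)
  qed
  ultimately show ?thesis by (auto simp: plin_def)
qed

lemma plin_lext_comp [simp, intro]: "plin f \<Longrightarrow> plin (\<lambda>a. lext g (f a))"
  by (rule plin_comp[OF plin_lext])

lemmas lext_add [simp] = plin_add[OF plin_lext]
  and lext_scale [simp] = plin_scale[OF plin_lext]
  and lext_0 [simp] = plin_0[OF plin_lext]
  and lext_diff [simp] = plin_diff[OF plin_lext]

lemma lext_bv [simp]: "lext g (bv x) = g x"
  by (simp add: lext_def)

lemma plin_eq_lext: "plin f \<Longrightarrow> f a = lext (\<lambda>x. f (bv x)) a"
  using plin_eqI[of f "lext (\<lambda>x. f (bv x))" a] by simp

lemma lext_bv_ident: "lext bv f = f"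
  using plin_eqI[of "lext bv" "\<lambda>x. x" f] by simp

lemma plin_lext_swap: "plin f \<Longrightarrow> f (lext g a) = lext (\<lambda>x. f (g x)) a"
  using plin_eqI[of "\<lambda>a. f (lext g a)" "lext (\<lambda>x. f (g x))" a] plin_comp[of f "lext g"] by simp

lemma lext_cong: "(\<And>x. x \<in> Poly_Mapping.keys f \<Longrightarrow> g x = h x) \<Longrightarrow> lext g f = lext h f"
  by (simp add: lext_def)

lemma lext_fun_add: "lext (\<lambda>x. g x + h x) f = lext g f + lext h f"
  by (simp add: lext_def pm.scale_right_distrib sum.distrib)

lemma lext_fun_scale: "lext (\<lambda>x. pm_scale c (g x)) f = pm_scale c (lext g f)"
  by (simp add: lext_def pm.scale_sum_right mult.commute)

lemma lin_span_free_module: "lin_span (free_module X) S = pm.span S"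
proof
  show "lin_span (free_module X) S \<subseteq> pm.span S"
  proof
    fix x assume "x \<in> lin_span (free_module X) S"
    then show "x \<in> pm.span S"
      by (induction rule: lin_span.induct)
        (auto simp: free_module_def pm.span_zero pm.span_base pm.span_add pm.span_scale)
  qed
  show "pm.span S \<subseteq> lin_span (free_module X) S"
  proof
    fix x assume "x \<in> pm.span S"
    then show "x \<in> lin_span (free_module X) S"
    proof (induction rule: pm.span_induct_alt)
      case base
      show ?case using lin_span.zero[of "free_module X" S] by (simp add: free_module_def)
    next
      case (step c x y)
      then show ?case
        using lin_span.add[OF lin_span.smult[OF lin_span.base] step(2)]
        by (simp add: free_module_def)
    qed
  qed
qed

lemma pm_subspace_vimage: "plin f \<Longrightarrow> pm.subspace Q \<Longrightarrow> pm.subspace {a. f a \<in> Q}"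
  by (auto simp: pm.subspace_def plin_0 plin_add plin_scale)

lemma span_vimage:
  assumes "plin f" "pm.subspace Q" "\<And>a. a \<in> B \<Longrightarrow> f a \<in> Q" "x \<in> pm.span B"
  shows "f x \<in> Q"
  using pm.span_minimal[of B "{a. f a \<in> Q}"] assms pm_subspace_vimage by auto

lemma lext_in_subspace:
  "pm.subspace Q \<Longrightarrow> (\<And>x. x \<in> Poly_Mapping.keys f \<Longrightarrow> g x \<in> Q) \<Longrightarrow> lext g f \<in> Q"
  unfolding lext_def by (intro pm.subspace_sum pm.subspace_scale) auto

section \<open>The braided coproduct and skew derivations\<close>

lemma plin_if [intro, simp]: "plin f \<Longrightarrow> plin g \<Longrightarrow> plin (\<lambda>a. if b then f a else g a)"
  by (cases b) simp_all

lemma plus_FMon [simp]: "FMon u + FMon v = FMon (u @ v)"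
  by (simp add: plus_fmon_def)

lemma FMon_eq_0_iff [simp]: "FMon w = 0 \<longleftrightarrow> w = []" "0 = FMon w \<longleftrightarrow> w = []"
  by (auto simp: zero_fmon_def)

lemma letter_add_neq_0 [simp]: "FMon [i] + w \<noteq> 0" "0 \<noteq> FMon [i] + w"
  by (auto simp: zero_fmon_def plus_fmon_def)

lemma letters_0 [simp]: "letters 0 = []" and letters_add [simp]: "letters (u + v) = letters u @ letters v"
  by (auto simp: zero_fmon_def plus_fmon_def)

lemma FMon_Nil [simp]: "FMon [] = 0"
  by (simp add: zero_fmon_def)

lemma FMon_letters [simp]: "FMon (letters w) = w"
  by (cases w) simp

lemma fmon_induct [case_names 0 Cons]:
  assumes "P 0" "\<And>i w. P w \<Longrightarrow> P (FMon [i] + w)"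
  shows "P w"
proof -
  have "P (FMon u)" for u
  proof (induction u)
    case (Cons i u)
    then show ?case using assms(2)[of "FMon u" i] by simp
  qed (simp add: assms)
  from this[of "letters w"] show ?thesis by simp
qed

lemma word_deg_0 [simp]: "word_deg 0 = 0"
  and word_deg_add [simp]: "word_deg (u + v) = word_deg u + word_deg v"
  and word_deg_letter [simp]: "word_deg (FMon [i]) = alpha i"
  by (auto simp: word_deg_def)

lemma bv_mult: "bv u * bv v = bv (u + v)"
  by (simp add: mult_single)

lemma fgen_bv: "fgen i = bv (FMon [i])"
  by (simp add: fgen_def)

lemma pure_tensor_bv: "pure_tensor (bv u) (bv v) = bv (u, v)"
  by (simp add: pure_tensor_def)

lemma pure_tensor_lext: "pure_tensor f g = lext (\<lambda>u. lext (\<lambda>v. bv (u, v)) g) f"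
  by (simp add: pure_tensor_def lext_def pm.scale_sum_right pm_scale_single)

locale bichar =
  fixes X :: "int ^ 'i::finite \<Rightarrow> int ^ 'i \<Rightarrow> 'k::field"
  assumes bichar: "bicharacter X"
    and qsym: "qmat X i j = qmat X j i"
begin

lemma X_nz [simp]: "X a b \<noteq> 0"
  and X_add_left: "X (a + b) d = X a d * X b d"
  and X_add_right: "X d (a + b) = X d a * X d b"
  using bichar by (auto simp: bicharacter_def)

lemma X_0_left [simp]: "X 0 d = 1"
  using X_add_left[of 0 0 d] X_nz[of 0 d] by simp

lemma X_0_right [simp]: "X d 0 = 1"
  using X_add_right[of d 0 0] X_nz[of d 0] by simp

lemma X_uminus_left: "X (- a) d = inverse (X a d)"
  using X_add_left[of a "- a" d] by (simp add: inverse_unique)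

lemma X_diff_left: "X (a - b) d = X a d * inverse (X b d)"
  using X_add_left[of a "- b" d] by (simp add: X_uminus_left)

lemma X_alpha_sym: "X (alpha i) (alpha j) = X (alpha j) (alpha i)"
  using qsym by (simp add: qmat_def)

lemma X_alpha_word: "X (alpha i) (word_deg v) = X (word_deg v) (alpha i)"
  by (induction v rule: fmon_induct) (simp_all add: X_add_left X_add_right X_alpha_sym)

lemma bichar_inverse: "bichar (\<lambda>a b. inverse (X a b))"
  by standard (use bichar in \<open>auto simp: bicharacter_def qmat_def X_alpha_sym\<close>)

text \<open>Left multiplication by \<open>E_i \<otimes> 1 + 1 \<otimes> E_i\<close> in the braided
  tensor square; the scalar is the braiding of \<open>E_i\<close> with the left factor
  \<open>u\<close>.\<close>

definition primitive_mult :: "'i \<Rightarrow> ('i fmon \<times> 'i fmon \<Rightarrow>\<^sub>0 'k) \<Rightarrow> ('i fmon \<times> 'i fmon \<Rightarrow>\<^sub>0 'k)" where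
  "primitive_mult i = lext (\<lambda>(u, v). bv (FMon [i] + u, v)
     + pm_scale (X (alpha i) (word_deg u)) (bv (u, FMon [i] + v)))"

lemma plin_primitive_mult [simp, intro]: "plin (primitive_mult i)"
  by (simp add: primitive_mult_def)

lemmas plin_primitive_mult_comp [simp, intro] = plin_comp[OF plin_primitive_mult]
  and primitive_mult_linear [simp] = plin_add[OF plin_primitive_mult] plin_scale[OF plin_primitive_mult] plin_0[OF plin_primitive_mult]

lemma primitive_mult_bv [simp]: "primitive_mult i (bv (u, v)) =
    bv (FMon [i] + u, v) + pm_scale (X (alpha i) (word_deg u)) (bv (u, FMon [i] + v))"
  by (simp add: primitive_mult_def)

lemma braided_mult_primitive:
  "braided_mult X (pure_tensor (fgen i) 1 + pure_tensor 1 (fgen i)) P = primitive_mult i P"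
proof -
  let ?Q = "bv (FMon [i], 0) + bv (0, FMon [i]) :: 'i fmon \<times> 'i fmon \<Rightarrow>\<^sub>0 'k"
  have Q: "pure_tensor (fgen i) 1 + pure_tensor 1 (fgen i) = ?Q"
    by (simp add: fgen_bv pure_tensor_bv[where v = 0, simplified] pure_tensor_bv[where u = 0, simplified])
  have keys: "Poly_Mapping.keys ?Q = {(FMon [i], 0), (0, FMon [i])}"
    by (auto simp: in_keys_iff lookup_add lookup_single when_def split: if_splits)
  show ?thesis
    unfolding Q braided_mult_def keys primitive_mult_def lext_def
    by (simp add: lookup_add lookup_single when_def case_prod_unfold pm.scale_right_distrib
        sum.distrib pm_scale_single mult.commute)
qed

lemma coproduct_word_Cons: "coproduct_word X (i # w) = primitive_mult i (coproduct_word X w)"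
  and coproduct_word_Nil: "coproduct_word X [] = bv (0, 0)"
  using braided_mult_primitive pure_tensor_bv[of 0 0] by simp_all

definition cop :: "'i fmon \<Rightarrow> ('i fmon \<times> 'i fmon \<Rightarrow>\<^sub>0 'k)" where
  "cop w = coproduct_word X (letters w)"

lemma cop_0 [simp]: "cop 0 = bv (0, 0)"
  and cop_letter_add [simp]: "cop (FMon [i] + w) = primitive_mult i (cop w)"
  by (auto simp: cop_def coproduct_word_Nil coproduct_word_Cons simp del: coproduct_word.simps)

lemma coproduct_conv_lext: "coproduct X f = lext cop f"
  by (simp add: coproduct_def lext_def cop_def)

section \<open>Skew derivations as components of the coproduct\<close>

primrec dword :: "'i \<Rightarrow> 'i list \<Rightarrow> ('i, 'k) free_alg" where
  "dword j [] = 0"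
| "dword j (i # w) = (if i = j then bv (FMon w) else 0)
     + pm_scale (X (alpha i) (alpha j)) (fgen i * dword j w)"

definition deriv :: "'i \<Rightarrow> 'i fmon \<Rightarrow> ('i, 'k) free_alg" where
  "deriv j w = dword j (letters w)"

lemma deriv_0 [simp]: "deriv j 0 = 0"
  and deriv_letter_add: "deriv j (FMon [i] + w) = (if i = j then bv w else 0)
     + pm_scale (X (alpha i) (alpha j)) (fgen i * deriv j w)"
  by (auto simp: deriv_def)

text \<open>Homogeneity of the skew derivation: it lets scalars that depend on the degree of a word
  be pulled out of sums over \<open>deriv j w\<close>.\<close>

lemma deriv_keys: "u \<in> Poly_Mapping.keys (deriv j w) \<Longrightarrow>
    word_deg w = word_deg u + alpha j \<and> length (letters w) = Suc (length (letters u))"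
proof (induction w arbitrary: u rule: fmon_induct)
  case (Cons i w)
  from Cons.prems consider "i = j" "u = w"
    | "u \<in> Poly_Mapping.keys (fgen i * deriv j w)"
    unfolding deriv_letter_add using keys_add[of "if i = j then bv w else 0"]
    by (force simp: in_keys_iff lookup_add lookup_single when_def split: if_splits)
  then show ?case
  proof cases
    case 2
    then obtain u' where "u = FMon [i] + u'" "u' \<in> Poly_Mapping.keys (deriv j w)"
      using keys_mult[of "fgen i" "deriv j w"] by (auto simp: fgen_def)
    with Cons.IH[of u'] show ?thesis by simp
  qed auto
qed auto

definition left_part :: "'i fmon \<Rightarrow> ('i fmon \<times> 'i fmon \<Rightarrow>\<^sub>0 'k) \<Rightarrow> ('i, 'k) free_alg" where
  "left_part w = lext (\<lambda>(u, v). if u = w then bv v else 0)"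

lemma plin_left_part [simp, intro]: "plin (left_part w)"
  by (simp add: left_part_def)

lemmas plin_left_part_comp [simp, intro] = plin_comp[OF plin_left_part]
  and left_part_linear [simp] = plin_add[OF plin_left_part] plin_scale[OF plin_left_part] plin_0[OF plin_left_part]

lemma left_part_bv: "left_part w (bv (u, v)) = (if u = w then bv v else 0)"
  by (simp add: left_part_def)

lemma left_part_counit: "left_part 0 (cop w) = bv w"
proof (induction w rule: fmon_induct)
  case (Cons i w)
  have "left_part 0 (primitive_mult i P) = fgen i * left_part 0 P" for P
    by (rule plin_eqI) (auto simp: left_part_bv fgen_bv bv_mult)
  with Cons show ?case by (simp add: fgen_bv bv_mult)
qed (simp add: left_part_bv)

lemma letter_add_eq_letter_iff: "FMon [i] + u = FMon [j] \<longleftrightarrow> i = j \<and> u = 0"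
  by (cases u) auto

text \<open>In the coproduct of \<open>E_i w\<close> the left factor \<open>E_j\<close> arises
  either from the new letter and old left factor 1, or from an old left factor \<open>E_j\<close>
  past which \<open>E_i\<close> is braided. This is the recursion of \<open>dword\<close>.\<close>

lemma left_part_letter: "left_part (FMon [j]) (cop w) = deriv j w"
proof (induction w rule: fmon_induct)
  case (Cons i w)
  have "left_part (FMon [j]) (primitive_mult i P) = (if i = j then left_part 0 P else 0)
     + pm_scale (X (alpha i) (alpha j)) (fgen i * left_part (FMon [j]) P)" for P
  proof (rule plin_eqI[where a = P and f = "\<lambda>P. left_part (FMon [j]) (primitive_mult i P)"], goal_cases)
    case (3 x)
    obtain u v where x: "x = (u, v)" by (cases x)
    show ?case
      unfolding x primitive_mult_bv left_part_linear left_part_bv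
      by (cases "u = FMon [j]"; cases "u = 0")
         (simp_all add: letter_add_eq_letter_iff fgen_bv bv_mult)
  qed simp_all
  with Cons show ?case by (simp add: deriv_letter_add left_part_counit)
qed (simp add: left_part_bv)

definition deriv_left :: "'i \<Rightarrow> ('i fmon \<times> 'i fmon \<Rightarrow>\<^sub>0 'k) \<Rightarrow> ('i fmon \<times> 'i fmon \<Rightarrow>\<^sub>0 'k)" where
  "deriv_left j = lext (\<lambda>(u, v). lext (\<lambda>u'. bv (u', v)) (deriv j u))"

lemma plin_deriv_left [simp, intro]: "plin (deriv_left j)"
  by (simp add: deriv_left_def)

lemmas plin_deriv_left_comp [simp, intro] = plin_comp[OF plin_deriv_left]
  and deriv_left_linear [simp] = plin_add[OF plin_deriv_left] plin_scale[OF plin_deriv_left] plin_0[OF plin_deriv_left]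

lemma deriv_left_bv: "deriv_left j (bv (u, v)) = lext (\<lambda>u'. bv (u', v)) (deriv j u)"
  by (simp add: deriv_left_def)

lemma lext_fgen_mult: "lext h (fgen i * f) = lext (\<lambda>u. h (FMon [i] + u)) f"
  by (rule plin_eqI) (auto simp: fgen_bv bv_mult)

lemma deriv_left_primitive: "deriv_left j (primitive_mult i P) = (if i = j then P else 0)
    + pm_scale (X (alpha i) (alpha j)) (primitive_mult i (deriv_left j P))"
proof (rule plin_eqI[where a = P and f = "\<lambda>P. deriv_left j (primitive_mult i P)"], goal_cases)
  case (3 x)
  obtain u v where x: "x = (u, v)" by (cases x)
  have "lext (\<lambda>u'. bv (u', FMon [i] + v)) (pm_scale (X (alpha i) (word_deg u)) (deriv j u))
      = pm_scale (X (alpha i) (alpha j))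
         (lext (\<lambda>u'. pm_scale (X (alpha i) (word_deg u')) (bv (u', FMon [i] + v))) (deriv j u))"
    unfolding lext_scale lext_fun_scale[symmetric]
    by (rule lext_cong) (auto dest: deriv_keys simp: X_add_right mult.commute)
  then show ?case
    by (simp add: x deriv_left_bv deriv_letter_add lext_fgen_mult
        plin_lext_swap[of "primitive_mult i"] lext_fun_add pm.scale_right_distrib)
qed auto

text \<open>This is coassociativity, read off at the letter \<open>j\<close> in the first of three
  tensor factors. The induction works because both sides obey the same twisted Leibniz rule.\<close>

lemma deriv_left_cop: "deriv_left j (cop w) = lext cop (deriv j w)"
proof (induction w rule: fmon_induct)
  case (Cons i w)
  have "lext cop (fgen i * f) = primitive_mult i (lext cop f)" for f
    by (rule plin_eqI) (auto simp: fgen_bv bv_mult)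
  then show ?case by (simp add: deriv_left_primitive Cons deriv_letter_add)
qed (simp add: deriv_left_bv)

end

section \<open>Coideals and graded ideals\<close>

definition coideal :: "('i, 'k::field) free_alg set \<Rightarrow> ('i fmon \<times> 'i fmon \<Rightarrow>\<^sub>0 'k) set" where
  "coideal \<I> = pm.span {pure_tensor f g | f g. f \<in> \<I> \<or> g \<in> \<I>}"

lemma pure_tensor_lext_swap: "pure_tensor f g = lext (\<lambda>v. lext (\<lambda>u. bv (u, v)) f) g"
  unfolding pure_tensor_lext
  by (rule plin_eqI[where a = f and f = "lext (\<lambda>u. lext (\<lambda>v. bv (u, v)) g)"])
    (simp_all add: plin_eq_lext[symmetric] plin_def lext_fun_add lext_fun_scale)

text \<open>By bilinearity the factor outside \<open>\<I>\<close> may be taken to be a single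
  word.\<close>

lemma coideal_subset:
  fixes \<I> :: "('i, 'k::field) free_alg set"
  assumes "pm.subspace Q"
    and "\<And>f v. f \<in> \<I> \<Longrightarrow> lext (\<lambda>u. bv (u, v)) f \<in> Q"
    and "\<And>g u. g \<in> \<I> \<Longrightarrow> lext (\<lambda>v. bv (u, v)) g \<in> Q"
  shows "coideal \<I> \<subseteq> Q"
  unfolding coideal_def
proof (rule pm.span_minimal)
  show "{pure_tensor f g | f g. f \<in> \<I> \<or> g \<in> \<I>} \<subseteq> Q"
  proof clarify
    fix f g :: "('i, 'k) free_alg" assume "f \<in> \<I> \<or> g \<in> \<I>"
    then show "pure_tensor f g \<in> Q"
    proof
      assume "f \<in> \<I>"
      then show ?thesis
        unfolding pure_tensor_lext_swap by (intro lext_in_subspace assms)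
    next
      assume "g \<in> \<I>"
      then show ?thesis
        unfolding pure_tensor_lext by (intro lext_in_subspace assms)
    qed
  qed
qed fact

lemma pure_tensor_in_coideal: "f \<in> \<I> \<or> g \<in> \<I> \<Longrightarrow> pure_tensor f g \<in> coideal \<I>"
  unfolding coideal_def by (rule pm.span_base) auto

lemma coideal_left: "f \<in> \<I> \<Longrightarrow> lext (\<lambda>u. bv (u, v)) f \<in> coideal \<I>"
  using pure_tensor_in_coideal[of f \<I> "bv v"] by (simp add: pure_tensor_lext_swap)

lemma coideal_right: "g \<in> \<I> \<Longrightarrow> lext (\<lambda>v. bv (u, v)) g \<in> coideal \<I>"
  using pure_tensor_in_coideal[of "bv u" \<I> g] by (simp add: pure_tensor_lext)

text \<open>Take the part of the coproduct with left factor \<open>E_j\<close>. Tensors whose left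
  factor is in \<open>\<I>\<close> contribute nothing, since \<open>\<I>\<close> contains no words
  of length one; the others contribute elements of \<open>\<I>\<close>.\<close>

lemma (in bichar) deriv_closed:
  assumes "pm.subspace \<I>" "\<I> \<subseteq> tensor_degree_ge 2" "lext cop f \<in> coideal \<I>"
  shows "lext (deriv j) f \<in> \<I>"
proof -
  have "coideal \<I> \<subseteq> {P. left_part (FMon [j]) P \<in> \<I>}"
  proof (rule coideal_subset)
    show "pm.subspace {P. left_part (FMon [j]) P \<in> \<I>}"
      using pm_subspace_vimage assms plin_left_part by blast
    fix f and v :: "'i fmon" assume f: "f \<in> \<I>"
    have "lext (\<lambda>u. if u = FMon [j] then bv v else 0) f = lext (\<lambda>u. 0) f"
      using f assms(2) by (intro lext_cong) (fastforce simp: tensor_degree_ge_def)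
    also have "\<dots> = 0" by (simp add: lext_def)
    finally show "lext (\<lambda>u. bv (u, v)) f \<in> {P. left_part (FMon [j]) P \<in> \<I>}"
      using assms(1) by (simp add: plin_lext_swap[of "left_part (FMon [j])"] left_part_bv pm.subspace_0)
  next
    fix g and u :: "'i fmon" assume g: "g \<in> \<I>"
    have "left_part (FMon [j]) (lext (\<lambda>v. bv (u, v)) g) = (if u = FMon [j] then g else 0)"
      by (simp add: plin_lext_swap[of "left_part (FMon [j])"] left_part_bv lext_bv_ident)
        (simp add: lext_def)
    then show "lext (\<lambda>v. bv (u, v)) g \<in> {P. left_part (FMon [j]) P \<in> \<I>}"
      using g assms(1) by (simp add: pm.subspace_0)
  qed
  then have "left_part (FMon [j]) (lext cop f) \<in> \<I>" using assms(3) by blast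
  then show ?thesis by (simp add: plin_lext_swap[of "left_part (FMon [j])"] left_part_letter)
qed

text \<open>One family of diagonal operators covers both the action of the \<open>K_i\<close> by
  characters and, for indicator functions \<open>g\<close>, the projections to homogeneous
  components.\<close>

definition degscale :: "(int ^ 'i \<Rightarrow> 'k) \<Rightarrow> ('i::finite, 'k::field) free_alg \<Rightarrow> ('i, 'k) free_alg" where
  "degscale g = lext (\<lambda>w. pm_scale (g (word_deg w)) (bv w))"

lemma degscale_closed:
  assumes "pm.subspace \<I>" "graded_subspace \<I>" "f \<in> \<I>"
  shows "degscale g f \<in> \<I>"
proof -
  let ?f = "\<lambda>d. \<Sum>w | w \<in> Poly_Mapping.keys f \<and> word_deg w = d. Poly_Mapping.single w (Poly_Mapping.lookup f w)"
  have "degscale g f = (\<Sum>d\<in>word_deg ` Poly_Mapping.keys f. pm_scale (g d) (?f d))"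
  proof -
    have "(\<Sum>d\<in>word_deg ` Poly_Mapping.keys f. pm_scale (g d) (?f d))
      = (\<Sum>d\<in>word_deg ` Poly_Mapping.keys f. \<Sum>w | w \<in> Poly_Mapping.keys f \<and> word_deg w = d.
           pm_scale (Poly_Mapping.lookup f w) (pm_scale (g (word_deg w)) (bv w)))"
      by (intro sum.cong refl) (simp add: pm.scale_sum_right pm_scale_single mult.commute)
    also have "\<dots> = degscale g f"
      unfolding degscale_def lext_def by (rule sum.group) auto
    finally show ?thesis ..
  qed
  moreover have "?f d \<in> \<I>" for d using assms by (simp add: graded_subspace_def)
  ultimately show ?thesis
    using assms(1) by (simp add: pm.subspace_sum pm.subspace_scale)
qed

locale pre_nichols = bichar chi
  for chi :: "int ^ 'i::finite \<Rightarrow> int ^ 'i \<Rightarrow> 'k::field" +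
  fixes \<I> :: "('i, 'k) free_alg set"
  assumes biideal: "biideal chi \<I>"
    and graded: "graded_subspace \<I>"
    and degree_ge_2: "\<I> \<subseteq> tensor_degree_ge 2"
begin

abbreviation ichi :: "int ^ 'i \<Rightarrow> int ^ 'i \<Rightarrow> 'k" where
  "ichi \<equiv> \<lambda>a b. inverse (chi a b)"

sublocale dual: bichar ichi
  by (rule bichar_inverse)

lemma ideal_I: "ideal \<I> free_algebra"
  using biideal by (simp add: biideal_def)

lemma I_mult_left: "f \<in> \<I> \<Longrightarrow> g * f \<in> \<I>"
  and I_mult_right: "f \<in> \<I> \<Longrightarrow> f * g \<in> \<I>"
  using ideal.I_l_closed[OF ideal_I, of f g] ideal.I_r_closed[OF ideal_I, of f g]
  by (auto simp: free_algebra_def)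

lemma subspace_I: "pm.subspace \<I>"
  using additive_subgroup.a_closed[OF ideal.axioms(1)[OF ideal_I]]
    additive_subgroup.zero_closed[OF ideal.axioms(1)[OF ideal_I]] I_mult_left
  by (auto simp: pm.subspace_def free_algebra_def pm_scale_conv_mult)

lemma degscale_I: "f \<in> \<I> \<Longrightarrow> degscale g f \<in> \<I>"
  using degscale_closed subspace_I graded by blast

lemma cop_I: "f \<in> \<I> \<Longrightarrow> lext cop f \<in> coideal \<I>"
  using biideal by (simp add: biideal_def coproduct_conv_lext lin_span_free_module coideal_def)

text \<open>The inverse braiding turns the coproduct for \<open>chi\<close> into the one for the inverse bicharacter.\<close>

definition flip :: "('i fmon \<times> 'i fmon \<Rightarrow>\<^sub>0 'k) \<Rightarrow> ('i fmon \<times> 'i fmon \<Rightarrow>\<^sub>0 'k)" where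
  "flip = lext (\<lambda>(u, v). pm_scale (inverse (chi (word_deg u) (word_deg v))) (bv (v, u)))"

lemma plin_flip [simp, intro]: "plin flip"
  by (simp add: flip_def)

lemmas plin_flip_comp [simp, intro] = plin_comp[OF plin_flip]
  and flip_linear [simp] = plin_add[OF plin_flip] plin_scale[OF plin_flip] plin_0[OF plin_flip]

lemma flip_bv [simp]: "flip (bv (u, v)) = pm_scale (inverse (chi (word_deg u) (word_deg v))) (bv (v, u))"
  by (simp add: flip_def)

text \<open>The flip exchanges the two summands of \<open>primitive_mult\<close>; their scalars
  match because \<open>q\<close> is symmetric, in the form \<open>X_alpha_word\<close>.\<close>

lemma dual_cop_conv_flip: "dual.cop w = flip (cop w)"
proof (induction w rule: fmon_induct)
  case (Cons i w)
  have "dual.primitive_mult i (flip P) = flip (primitive_mult i P)" for P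
  proof (rule plin_eqI[where a = P and f = "\<lambda>P. dual.primitive_mult i (flip P)"], goal_cases)
    case (3 x)
    obtain u v where x: "x = (u, v)" by (cases x)
    show ?case
      unfolding x flip_bv primitive_mult_bv dual.primitive_mult_bv flip_linear dual.primitive_mult_linear
      by (simp add: X_add_left X_add_right pm.scale_right_distrib X_alpha_word add.commute
          mult.commute field_simps)
  qed simp_all
  then show ?case by (simp add: Cons)
qed simp

text \<open>When one factor is a fixed word, the scalar of the flip depends only on the degree of
  the other factor and is absorbed by the graded ideal through \<open>degscale\<close>.\<close>

lemma flip_coideal:
  assumes "P \<in> coideal \<I>"
  shows "flip P \<in> coideal \<I>"
proof -
  have sub: "pm.subspace (coideal \<I>)" by (simp add: coideal_def)
  have "coideal \<I> \<subseteq> {P. flip P \<in> coideal \<I>}"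
  proof (rule coideal_subset)
    show "pm.subspace {P. flip P \<in> coideal \<I>}" using pm_subspace_vimage plin_flip sub by blast
    fix f v assume "f \<in> \<I>"
    then have "lext (\<lambda>u. bv (v, u)) (degscale (\<lambda>d. inverse (chi d (word_deg v))) f) \<in> coideal \<I>"
      by (intro coideal_right degscale_I)
    then show "lext (\<lambda>u. bv (u, v)) f \<in> {P. flip P \<in> coideal \<I>}"
      by (simp add: plin_lext_swap[OF plin_flip] degscale_def plin_lext_swap[OF plin_lext])
  next
    fix g u assume "g \<in> \<I>"
    then have "lext (\<lambda>v. bv (v, u)) (degscale (\<lambda>d. inverse (chi (word_deg u) d)) g) \<in> coideal \<I>"
      by (intro coideal_left degscale_I)
    then show "lext (\<lambda>v. bv (u, v)) g \<in> {P. flip P \<in> coideal \<I>}"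
      by (simp add: plin_lext_swap[OF plin_flip] degscale_def plin_lext_swap[OF plin_lext])
  qed
  with assms show ?thesis by blast
qed

lemma dual_cop_I: "f \<in> \<I> \<Longrightarrow> lext dual.cop f \<in> coideal \<I>"
  using flip_coideal[OF cop_I, of f]
  by (simp add: plin_lext_swap[OF plin_flip] flip: dual_cop_conv_flip)

lemma deriv_I: "f \<in> \<I> \<Longrightarrow> lext (deriv j) f \<in> \<I>"
  and dual_deriv_I: "f \<in> \<I> \<Longrightarrow> lext (dual.deriv j) f \<in> \<I>"
  using deriv_closed dual.deriv_closed subspace_I degree_ge_2 cop_I dual_cop_I by blast+

end

section \<open>The action on \<open>U\<^sup>+ \<otimes> H \<otimes> U\<^sup>-\<close>\<close>

text \<open>A factor \<open>z i\<close> for each letter and \<open>x i j\<close> for each pair of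
  letters in order of position: the scalar that appears when the torus parts of a product of
  q-commuting factors are collected on one side.\<close>

primrec word_scalar :: "('i \<Rightarrow> 'i \<Rightarrow> 'k::field) \<Rightarrow> ('i \<Rightarrow> 'k) \<Rightarrow> 'i list \<Rightarrow> 'k" where
  "word_scalar x z [] = 1"
| "word_scalar x z (i # w) = z i * prod_list (map (x i) w) * word_scalar x z w"

lemma prod_list_mset_cong: "mset u = mset v \<Longrightarrow> prod_list (map g u) = prod_list (map g v)"
  for g :: "'a \<Rightarrow> 'k::comm_monoid_mult"
  by (metis mset_map prod_mset_prod_list)

lemma word_scalar_insert:
  assumes "\<And>i j. x i j = x j i"
  shows "word_scalar x z (u @ i # v) = z i * prod_list (map (x i) (u @ v)) * word_scalar x z (u @ v)"
proof (induction u)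
  case (Cons a u)
  then show ?case using assms[of a i] by (simp add: mult_ac)
qed simp

lemma word_scalar_mset_cong:
  assumes "\<And>i j. x i j = x j i" "mset u = mset v"
  shows "word_scalar x z u = word_scalar x z v"
  using assms(2)
proof (induction u arbitrary: v)
  case (Cons i u)
  then have "i \<in> set v" by (metis list.set_intros(1) set_mset_mset)
  then obtain v1 v2 where v: "v = v1 @ i # v2" by (meson split_list)
  with Cons.prems have m: "mset u = mset (v1 @ v2)" by simp
  show ?case
    unfolding v word_scalar_insert[of x, OF assms(1)]
    using Cons.IH[OF m] prod_list_mset_cong[OF m, of "x i"] by simp
qed simp

lemma word_deg_nth: "word_deg (FMon u) $ i = int (count (mset u) i)"
  by (induction u) (simp_all add: word_deg_def axis_def)

lemma word_deg_eq_imp_mset: "word_deg u = word_deg v \<Longrightarrow> mset (letters u) = mset (letters v)"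
  by (rule multiset_eqI) (metis FMon_letters of_nat_eq_iff word_deg_nth)

lemma length_word_deg: "int (length (letters u)) = (\<Sum>i\<in>UNIV. word_deg u $ i)"
  by (induction u rule: fmon_induct) (simp_all add: sum.distrib axis_def)

text \<open>For symmetric \<open>x\<close> any word of degree \<open>d\<close> gives the same value.
  A \<open>d\<close> that is not the degree of a word gives an unspecified value.\<close>

definition word_scalar_deg :: "('i \<Rightarrow> 'i \<Rightarrow> 'k::field) \<Rightarrow> ('i \<Rightarrow> 'k) \<Rightarrow> int ^ 'i::finite \<Rightarrow> 'k" where
  "word_scalar_deg x z d = word_scalar x z (letters (SOME w. word_deg w = d))"

lemma word_scalar_deg:
  assumes "\<And>i j. x i j = x j i"
  shows "word_scalar x z (letters w) = word_scalar_deg x z (word_deg w)"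
proof -
  have "word_deg (SOME u. word_deg u = word_deg w) = word_deg w" by (rule someI[of _ w]) simp
  then show ?thesis
    unfolding word_scalar_deg_def using word_scalar_mset_cong[of x, OF assms] word_deg_eq_imp_mset by metis
qed

type_synonym 'i pbw = "'i fmon \<times> (int ^ 'i) \<times> 'i fmon"

definition wpart :: "int ^ 'i \<Rightarrow> 'i fmon \<Rightarrow> ('i::finite, 'k::field) free_alg \<Rightarrow> 'i pbw \<Rightarrow>\<^sub>0 'k" where
  "wpart l v = lext (\<lambda>w. bv (w, l, v))"

definition vpart :: "'i fmon \<Rightarrow> int ^ 'i \<Rightarrow> ('i::finite, 'k::field) free_alg \<Rightarrow> 'i pbw \<Rightarrow>\<^sub>0 'k" where
  "vpart w l = lext (\<lambda>v. bv (w, l, v))"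

lemma plin_wpart [simp, intro]: "plin (wpart l v)" and plin_vpart [simp, intro]: "plin (vpart w l)"
  by (simp_all add: wpart_def vpart_def)

lemmas plin_wpart_comp [simp, intro] = plin_comp[OF plin_wpart]
  and wpart_linear [simp] = plin_add[OF plin_wpart] plin_scale[OF plin_wpart] plin_0[OF plin_wpart]
lemmas plin_vpart_comp [simp, intro] = plin_comp[OF plin_vpart]
  and vpart_linear [simp] = plin_add[OF plin_vpart] plin_scale[OF plin_vpart] plin_0[OF plin_vpart]

lemma wpart_bv [simp]: "wpart l v (bv w) = bv (w, l, v)"
  and vpart_bv [simp]: "vpart w l (bv v) = bv (w, l, v)"
  by (simp_all add: wpart_def vpart_def)

definition XX :: "'i \<Rightarrow> ('i::finite pbw \<Rightarrow>\<^sub>0 'k::field) \<Rightarrow> ('i pbw \<Rightarrow>\<^sub>0 'k)" where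
  "XX i = lext (\<lambda>(w, l, v). bv (FMon [i] + w, l, v))"

lemma plin_XX [simp, intro]: "plin (XX i)"
  by (simp add: XX_def)

lemmas plin_XX_comp [simp, intro] = plin_comp[OF plin_XX]
  and XX_linear [simp] = plin_add[OF plin_XX] plin_scale[OF plin_XX] plin_0[OF plin_XX] plin_diff[OF plin_XX] plin_minus[OF plin_XX]

lemma XX_bv [simp]: "XX i (bv (w, l, v)) = bv (FMon [i] + w, l, v)"
  by (simp add: XX_def)

lemma XX_wpart: "XX i (wpart l v f) = wpart l v (fgen i * f)"
  by (rule plin_eqI[where a = f and f = "\<lambda>f. XX i (wpart l v f)"]) (simp_all add: fgen_bv bv_mult)

context pre_nichols
begin

text \<open>Serves to treat scalars depending on the degree as constants: an element of the graded
  ideal is the sum of its components, which are again in the ideal.\<close>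

lemma homogeneous_I:
  assumes "plin \<Phi>" "pm.subspace Q" "f \<in> \<I>"
    and "\<And>f d. f \<in> \<I> \<Longrightarrow> (\<And>w. w \<in> Poly_Mapping.keys f \<Longrightarrow> word_deg w = d) \<Longrightarrow> \<Phi> f \<in> Q"
  shows "\<Phi> f \<in> Q"
proof -
  let ?D = "word_deg ` Poly_Mapping.keys f"
  let ?f = "\<lambda>d. degscale (\<lambda>e. if e = d then 1 else 0) f"
  have "f = (\<Sum>d\<in>?D. ?f d)"
  proof -
    have "(\<Sum>d\<in>?D. ?f d) = (\<Sum>w\<in>Poly_Mapping.keys f. \<Sum>d\<in>?D. pm_scale (Poly_Mapping.lookup f w)
        (pm_scale (if word_deg w = d then 1 else 0) (bv w)))"
      unfolding degscale_def lext_def by (rule sum.swap)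
    also have "\<dots> = (\<Sum>w\<in>Poly_Mapping.keys f. pm_scale (Poly_Mapping.lookup f w) (bv w))"
      by (rule sum.cong) (auto simp: if_distrib[of "\<lambda>x. pm_scale x _"] if_distrib[of "pm_scale _"] cong: if_cong)
    also have "\<dots> = f" by (rule pm_single_sum[symmetric])
    finally show ?thesis ..
  qed
  then have "\<Phi> f = (\<Sum>d\<in>?D. \<Phi> (?f d))" using plin_sum[OF assms(1)] by metis
  moreover have "\<Phi> (?f d) \<in> Q" for d
  proof (rule assms(4))
    show "?f d \<in> \<I>" by (rule degscale_I[OF assms(3)])
    fix w assume w: "w \<in> Poly_Mapping.keys (?f d)"
    show "word_deg w = d"
    proof (rule ccontr)
      assume "word_deg w \<noteq> d"
      then have "Poly_Mapping.lookup (?f d) w = 0"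
        unfolding degscale_def lext_def by (auto simp: lookup_sum lookup_single when_def intro!: sum.neutral)
      with w show False by (simp add: in_keys_iff)
    qed
  qed
  ultimately show ?thesis using assms(2) by (simp add: pm.subspace_sum)
qed

text \<open>From \<open>K_m X_w = chi m (word_deg w) X_w K_m\<close>.\<close>

definition KK :: "int ^ 'i \<Rightarrow> ('i pbw \<Rightarrow>\<^sub>0 'k) \<Rightarrow> ('i pbw \<Rightarrow>\<^sub>0 'k)" where
  "KK m = lext (\<lambda>(w, l, v). pm_scale (chi m (word_deg w)) (bv (w, l + m, v)))"

lemma plin_KK [simp, intro]: "plin (KK m)"
  by (simp add: KK_def)

lemmas plin_KK_comp [simp, intro] = plin_comp[OF plin_KK]
  and KK_linear [simp] = plin_add[OF plin_KK] plin_scale[OF plin_KK] plin_0[OF plin_KK] plin_diff[OF plin_KK] plin_minus[OF plin_KK]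

lemma KK_bv [simp]: "KK m (bv (w, l, v)) = pm_scale (chi m (word_deg w)) (bv (w, l + m, v))"
  by (simp add: KK_def)

lemma KK_wpart: "KK m (wpart l v f) = wpart (l + m) v (degscale (chi m) f)"
  by (rule plin_eqI[where a = f and f = "\<lambda>f. KK m (wpart l v f)"]) (simp_all add: degscale_def)

lemma KK_wpart_homogeneous:
  assumes "\<And>u. u \<in> Poly_Mapping.keys f \<Longrightarrow> word_deg w = word_deg u + d"
  shows "KK m (wpart l v f) = pm_scale (chi m (word_deg w) * inverse (chi m d)) (wpart (l + m) v f)"
  by (rule plin_eqI[where a = f and f = "\<lambda>f. KK m (wpart l v f)"])
    (simp_all add: assms X_add_right)

definition minus_twice :: "'i \<Rightarrow> int ^ 'i" where
  "minus_twice j = - alpha j - alpha j"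

lemma chi_minus_twice: "chi (minus_twice j) d = inverse (chi (alpha j) d) * inverse (chi (alpha j) d)"
  using X_add_left[of "- alpha j" "- alpha j"] by (simp add: minus_twice_def X_uminus_left)

lemma alpha_minus_twice: "alpha j + minus_twice j = - alpha j" "minus_twice j + alpha j = - alpha j"
  by (simp_all add: minus_twice_def)

text \<open>For \<open>t = 1\<close> this is the action of \<open>F\<^sub>j\<close> on \<open>U\<^sup>+ \<otimes> H \<otimes> U\<^sup>-\<close> in terms of the generators
  \<open>E\<^sub>i K\<^sub>i\<inverse>\<close> of the first factor, for \<open>t = 0\<close> its degeneration to the Heisenberg double.\<close>

definition FF :: "'k \<Rightarrow> 'i \<Rightarrow> ('i pbw \<Rightarrow>\<^sub>0 'k) \<Rightarrow> ('i pbw \<Rightarrow>\<^sub>0 'k)" where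
  "FF t j = lext (\<lambda>(w, l, v).
     pm_scale (inverse (chi (word_deg w) (alpha j)) * chi l (alpha j)) (bv (w, l, FMon [j] + v))
     - wpart l v (dual.deriv j w)
     + pm_scale t (KK (minus_twice j) (wpart l v (deriv j w))))"

lemma plin_FF [simp, intro]: "plin (FF t j)"
  by (simp add: FF_def)

lemmas plin_FF_comp [simp, intro] = plin_comp[OF plin_FF]
  and FF_linear [simp] = plin_add[OF plin_FF] plin_scale[OF plin_FF] plin_0[OF plin_FF] plin_diff[OF plin_FF] plin_minus[OF plin_FF]

lemma FF_bv: "FF t j (bv (w, l, v)) =
     pm_scale (inverse (chi (word_deg w) (alpha j)) * chi l (alpha j)) (bv (w, l, FMon [j] + v))
     - wpart l v (dual.deriv j w)
     + pm_scale t (KK (minus_twice j) (wpart l v (deriv j w)))"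
  by (simp add: FF_def)

lemma KK_KK: "KK m (KK n a) = KK (m + n) a"
  by (rule plin_eqI[where a = a and f = "\<lambda>a. KK m (KK n a)"])
    (auto simp: X_add_left mult.commute algebra_simps)

lemma KK_0 [simp]: "KK 0 a = a"
  by (rule plin_eqI[where a = a and f = "KK 0"]) auto

lemma KK_XX: "KK m (XX i a) = pm_scale (chi m (alpha i)) (XX i (KK m a))"
  by (rule plin_eqI[where a = a and f = "\<lambda>a. KK m (XX i a)"]) (auto simp: X_add_right)

lemma KK_FF: "KK m (FF t j a) = pm_scale (inverse (chi m (alpha j))) (FF t j (KK m a))"
proof (rule plin_eqI[where a = a and f = "\<lambda>a. KK m (FF t j a)"], goal_cases)
  case (3 x)
  obtain w l v where x: "x = (w, l, v)" by (cases x)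
  have d: "KK m (wpart l' v (deriv j w)) = pm_scale (chi m (word_deg w) * inverse (chi m (alpha j)))
        (wpart (l' + m) v (deriv j w))"
    and d': "KK m (wpart l' v (dual.deriv j w)) = pm_scale (chi m (word_deg w) * inverse (chi m (alpha j)))
        (wpart (l' + m) v (dual.deriv j w))" for l'
    by (rule KK_wpart_homogeneous, use deriv_keys dual.deriv_keys in blast)+
  have c: "KK m (KK n a) = KK n (KK m a)" for n a
    by (simp add: KK_KK add.commute)
  show ?case
    unfolding x FF_bv KK_linear KK_bv FF_linear c[of "minus_twice j"] d d'
    by (simp add: X_add_left pm.scale_right_distrib pm.scale_right_diff_distrib mult_ac)
qed simp_all

text \<open>The rule from which \<open>FF\<close> originates. Iterated along a word, the term 1
  yields the derivation for the inverse bicharacter; for \<open>K_j^-2\<close>, moving it to the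
  front past \<open>X_i\<close> contributes \<open>q_ij^2\<close>, which turns
  \<open>q_ij^-1\<close> into \<open>q_ij\<close> and so yields the derivation for
  \<open>chi\<close>.\<close>

lemma FF_XX: "FF t j (XX i a) = pm_scale (inverse (chi (alpha i) (alpha j))) (XX i (FF t j a))
    - (if i = j then a - pm_scale t (KK (minus_twice j) a) else 0)"
proof (rule plin_eqI[where a = a and f = "\<lambda>a. FF t j (XX i a)"], goal_cases)
  case (3 x)
  obtain w l v where x: "x = (w, l, v)" by (cases x)
  have k: "KK (minus_twice j) (XX i b) = pm_scale
    (inverse (chi (alpha i) (alpha j)) * inverse (chi (alpha i) (alpha j))) (XX i (KK (minus_twice j) b))" for b
    by (simp add: KK_XX chi_minus_twice X_alpha_sym[of j i])
  show ?case
    unfolding x XX_bv FF_bv deriv_letter_add dual.deriv_letter_add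
    by (simp add: XX_wpart[symmetric] k X_add_left pm.scale_right_distrib
        pm.scale_right_diff_distrib mult_ac)
qed simp_all

section \<open>The operators \<open>E_i\<close> and the subspace \<open>N\<close>\<close>

definition EE :: "'i \<Rightarrow> ('i pbw \<Rightarrow>\<^sub>0 'k) \<Rightarrow> ('i pbw \<Rightarrow>\<^sub>0 'k)" where
  "EE i a = XX i (KK (alpha i) a)"

lemma plin_EE [simp, intro]: "plin (EE i)"
  by (simp add: EE_def[abs_def])

lemmas plin_EE_comp [simp, intro] = plin_comp[OF plin_EE]
  and EE_linear [simp] = plin_add[OF plin_EE] plin_scale[OF plin_EE] plin_0[OF plin_EE] plin_diff[OF plin_EE] plin_minus[OF plin_EE]

lemma KK_EE: "KK m (EE i a) = pm_scale (chi m (alpha i)) (EE i (KK m a))"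
  by (simp add: EE_def KK_XX KK_KK add.commute)

lemma FF_KK: "FF t j (KK m a) = pm_scale (chi m (alpha j)) (KK m (FF t j a))"
  by (simp add: KK_FF)

lemma EE_FF: "EE i (FF 1 j a) = FF 1 j (EE i a) + (if i = j then KK (alpha i) a - KK (- alpha i) a else 0)"
  by (simp add: EE_def FF_XX FF_KK KK_KK alpha_minus_twice)

definition FW :: "'i fmon \<Rightarrow> ('i pbw \<Rightarrow>\<^sub>0 'k) \<Rightarrow> ('i pbw \<Rightarrow>\<^sub>0 'k)" where
  "FW u a = foldr (FF 1) (letters u) a"

lemma FW_0 [simp]: "FW 0 a = a" and FW_Cons [simp]: "FW (FMon [j] + u) a = FF 1 j (FW u a)"
  by (simp_all add: FW_def)

lemma plin_FW [simp, intro]: "plin (FW u)"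
  by (induction u rule: fmon_induct) (simp_all add: FW_def[abs_def])

lemmas plin_FW_comp [simp, intro] = plin_comp[OF plin_FW]

definition Fact :: "('i, 'k) free_alg \<Rightarrow> ('i pbw \<Rightarrow>\<^sub>0 'k) \<Rightarrow> ('i pbw \<Rightarrow>\<^sub>0 'k)" where
  "Fact g a = lext (\<lambda>u. FW u a) g"

lemma plin_Fact1: "plin (\<lambda>g. Fact g a)"
  by (simp add: Fact_def)

lemma Fact_linear [simp]: "Fact (g + h) a = Fact g a + Fact h a" "Fact (pm_scale c g) a = pm_scale c (Fact g a)"
  "Fact 0 a = 0" "Fact (bv u) a = FW u a"
  by (simp_all add: Fact_def)

lemma Fact_fgen: "Fact (fgen j * g) a = FF 1 j (Fact g a)"
  by (rule plin_eqI[where a = g and f = "\<lambda>g. Fact (fgen j * g) a"]) (simp_all add: Fact_def fgen_bv bv_mult)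

lemma plin_Fact2 [simp, intro]: "plin (Fact g)"
  unfolding Fact_def[abs_def] lext_def by simp

lemmas Fact_linear2 [simp] = plin_add[OF plin_Fact2] plin_scale[OF plin_Fact2] plin_0[OF plin_Fact2]

text \<open>Each letter \<open>F_i\<close> of the word releases \<open>K_i - K_i^-1\<close>. Moved
  to the left through the preceding letters, the two terms pick up mutually inverse scalars, hence
  the two derivations.\<close>

lemma EE_FW: "EE i (FW u a) = FW u (EE i a) + KK (alpha i) (Fact (deriv i u) a)
    - KK (- alpha i) (Fact (dual.deriv i u) a)"
proof (induction u rule: fmon_induct)
  case (Cons j u)
  then show ?case
    by (auto simp: EE_FF deriv_letter_add dual.deriv_letter_add Fact_fgen FF_KK X_uminus_left X_alpha_sym[of i])
qed (simp add: Fact_def)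

lemma EE_Fact: "EE i (Fact g a) = Fact g (EE i a) + KK (alpha i) (Fact (lext (deriv i) g) a)
    - KK (- alpha i) (Fact (lext (dual.deriv i) g) a)"
proof (rule plin_eqI[where a = g and f = "\<lambda>g. EE i (Fact g a)"], goal_cases)
  case (3 u)
  show ?case by (simp add: EE_FW)
qed (simp_all add: Fact_def)

definition N :: "('i pbw \<Rightarrow>\<^sub>0 'k) set" where
  "N = pm.span ({wpart l v f | l v f. f \<in> \<I>} \<union> {vpart w l g | w l g. g \<in> \<I>})"

lemma subspace_N [simp]: "pm.subspace N"
  by (simp add: N_def)

lemmas N_add = pm.subspace_add[OF subspace_N] and N_scale = pm.subspace_scale[OF subspace_N]
  and N_0 [simp] = pm.subspace_0[OF subspace_N] and N_diff = pm.subspace_diff[OF subspace_N]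

lemma wpart_N: "f \<in> \<I> \<Longrightarrow> wpart l v f \<in> N" and vpart_N: "g \<in> \<I> \<Longrightarrow> vpart w l g \<in> N"
  by (auto simp: N_def intro!: pm.span_base)

lemma N_closed:
  assumes "plin \<Phi>" "pm.subspace Q" "a \<in> N"
    and "\<And>l v f. f \<in> \<I> \<Longrightarrow> \<Phi> (wpart l v f) \<in> Q" "\<And>w l g. g \<in> \<I> \<Longrightarrow> \<Phi> (vpart w l g) \<in> Q"
  shows "\<Phi> a \<in> Q"
  by (rule span_vimage[OF assms(1,2) _ assms(3)[unfolded N_def]]) (use assms(4,5) in auto)

lemma XX_N: "a \<in> N \<Longrightarrow> XX i a \<in> N"
proof (erule N_closed[OF plin_XX subspace_N])
  show "XX i (wpart l v f) \<in> N" if "f \<in> \<I>" for l v f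
    by (simp add: XX_wpart wpart_N I_mult_left that)
  show "XX i (vpart w l g) \<in> N" if "g \<in> \<I>" for w l g
    using vpart_N[OF that, of "FMon [i] + w" l] by (simp add: vpart_def plin_lext_swap[OF plin_XX])
qed

lemma KK_N: "a \<in> N \<Longrightarrow> KK m a \<in> N"
proof (erule N_closed[OF plin_KK subspace_N])
  show "KK m (wpart l v f) \<in> N" if "f \<in> \<I>" for l v f
    by (simp add: KK_wpart wpart_N degscale_I that)
  show "KK m (vpart w l g) \<in> N" if "g \<in> \<I>" for w l g
    using N_scale[OF vpart_N[OF that, of w "l + m"], of "chi m (word_deg w)"]
    by (simp add: vpart_def plin_lext_swap[OF plin_KK] lext_fun_scale)
qed

lemma wpart_vpart_N:
  assumes "g \<in> \<I>"
  shows "lext (\<lambda>v. wpart l v f) g \<in> N"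
proof -
  have "lext (\<lambda>v. wpart l v f) g = lext (\<lambda>w. vpart w l g) f"
  proof (rule plin_eqI[where a = g and f = "lext (\<lambda>v. wpart l v f)"], goal_cases)
    case 2
    show ?case by (simp add: plin_def lext_fun_add lext_fun_scale)
  qed (simp_all add: wpart_def)
  also have "\<dots> \<in> N" by (intro lext_in_subspace subspace_N vpart_N assms)
  finally show ?thesis .
qed

text \<open>On a relation in the first factor \<open>F_j\<close> acts by diagonal scaling and the
  two derivations, all of which preserve \<open>\<I>\<close>; on one in the third factor by left
  multiplication, while the derivations touch only \<open>w\<close>.\<close>

lemma FF_N: "a \<in> N \<Longrightarrow> FF t j a \<in> N"
proof (erule N_closed[OF plin_FF subspace_N])
  show "FF t j (wpart l v f) \<in> N" if f: "f \<in> \<I>" for l v f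
  proof -
    have "FF t j (wpart l v f) =
        wpart l (FMon [j] + v) (degscale (\<lambda>d. inverse (chi d (alpha j)) * chi l (alpha j)) f)
        - wpart l v (lext (dual.deriv j) f)
        + pm_scale t (KK (minus_twice j) (wpart l v (lext (deriv j) f)))"
      by (rule plin_eqI[where a = f and f = "\<lambda>f. FF t j (wpart l v f)"]) (simp_all add: FF_bv degscale_def)
    then show ?thesis
      by (simp add: N_add N_diff N_scale KK_N wpart_N f degscale_I deriv_I dual_deriv_I)
  qed
  show "FF t j (vpart w l g) \<in> N" if g: "g \<in> \<I>" for w l g
  proof -
    have "FF t j (vpart w l g) =
        pm_scale (inverse (chi (word_deg w) (alpha j)) * chi l (alpha j)) (vpart w l (fgen j * g))
        - lext (\<lambda>v. wpart l v (dual.deriv j w)) g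
        + pm_scale t (KK (minus_twice j) (lext (\<lambda>v. wpart l v (deriv j w)) g))"
      by (rule plin_eqI[where a = g and f = "\<lambda>g. FF t j (vpart w l g)"])
        (simp_all add: FF_bv fgen_bv bv_mult)
    then show ?thesis
      by (simp add: N_add N_diff N_scale KK_N vpart_N I_mult_left g wpart_vpart_N)
  qed
qed

lemma EE_N: "a \<in> N \<Longrightarrow> EE i a \<in> N"
  by (simp add: EE_def XX_N KK_N)

lemma FW_highest: "FW u (bv (0, l, v)) = pm_scale (chi l (word_deg u)) (bv (0, l, u + v))"
  by (induction u rule: fmon_induct) (simp_all add: FF_bv X_add_right add.assoc mult.commute)

text \<open>For \<open>w = 0\<close> the element \<open>g\<close> acts on the third factor by
  twisted left multiplication. A letter of \<open>w\<close> is created by some \<open>E_i\<close>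
  and pulled through \<open>g\<close> with \<open>EE_Fact\<close>; the correction terms are skew
  derivatives of \<open>g\<close>, again in \<open>\<I>\<close>, which is why \<open>g\<close> is
  generalised in the induction.\<close>

lemma Fact_I_N:
  assumes "g \<in> \<I>"
  shows "Fact g a \<in> N"
proof -
  have basis: "Fact g (bv (w, l, v)) \<in> N" if "g \<in> \<I>" for g w l v
    using that
  proof (induction w arbitrary: g l v rule: fmon_induct)
    case 0
    have "Fact g (bv (0, l, v)) = vpart 0 l (degscale (chi l) g * bv v)"
      by (rule plin_eqI[where a = g and f = "\<lambda>g. Fact g (bv (0, l, v))"])
        (simp_all add: plin_Fact1 FW_highest degscale_def bv_mult pm_scale_mult_left)
    then show ?case by (simp add: vpart_N I_mult_right degscale_I 0)
  next
    case (Cons i w)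
    \<comment> \<open>Since \<open>E_i = X_i K_i\<close>, the factor \<open>K_i^-1\<close>
      compensates the shift made by \<open>E_i\<close>.\<close>
    define b where "b = (KK (- alpha i) (bv (w, l, v)) :: 'i pbw \<Rightarrow>\<^sub>0 'k)"
    have e: "bv (FMon [i] + w, l, v) = EE i b"
      by (simp add: EE_def b_def X_uminus_left)
    have IH: "Fact h b \<in> N" if "h \<in> \<I>" for h
      using N_scale[OF Cons.IH[OF that, of "l + - alpha i" v]] by (simp add: b_def)
    have "Fact g (EE i b) = EE i (Fact g b) - KK (alpha i) (Fact (lext (deriv i) g) b)
        + KK (- alpha i) (Fact (lext (dual.deriv i) g) b)"
      by (simp add: EE_Fact)
    then show ?case
      unfolding e by (simp add: N_add N_diff KK_N EE_N IH deriv_I dual_deriv_I Cons.prems)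
  qed
  show ?thesis
  proof (induction a rule: pm_induct)
    case (single x) then show ?case using basis[OF assms] by (cases x) auto
  qed (auto intro: N_add N_scale)
qed

definition EW :: "'i fmon \<Rightarrow> ('i pbw \<Rightarrow>\<^sub>0 'k) \<Rightarrow> ('i pbw \<Rightarrow>\<^sub>0 'k)" where
  "EW u a = foldr EE (letters u) a"

lemma EW_0 [simp]: "EW 0 a = a" and EW_Cons [simp]: "EW (FMon [j] + u) a = EE j (EW u a)"
  by (simp_all add: EW_def)

lemma plin_EW [simp, intro]: "plin (EW u)"
  by (induction u rule: fmon_induct) (simp_all add: EW_def[abs_def])

lemma chi_alpha_word_prod: "chi (alpha i) (word_deg u) = prod_list (map (qmat chi i) (letters u))"
  by (induction u rule: fmon_induct) (simp_all add: X_add_right qmat_def)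

text \<open>The factor relating \<open>E\<^sub>u\<close> to the product of the \<open>E\<^sub>i K\<^sub>i\<inverse>\<close> along \<open>u\<close>.\<close>

definition escal :: "int ^ 'i \<Rightarrow> 'k" where
  "escal = word_scalar_deg (qmat chi) (\<lambda>_. 1)"

lemma escal: "word_scalar (qmat chi) (\<lambda>_. 1) (letters u) = escal (word_deg u)"
  unfolding escal_def by (rule word_scalar_deg) (rule qsym)

lemma escal_0 [simp]: "escal 0 = 1"
  using escal[of 0] by simp

lemma escal_Cons: "escal (word_deg (FMon [i] + u)) = chi (alpha i) (word_deg u) * escal (word_deg u)"
  by (simp add: escal[symmetric] chi_alpha_word_prod del: word_deg_add)

lemma escal_nz: "escal (word_deg u) \<noteq> 0"
  by (induction u rule: fmon_induct) (simp, metis escal_Cons X_nz mult_eq_0_iff)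

lemma EW_bv: "EW u (bv (w, l, v)) =
    pm_scale (escal (word_deg u) * chi (word_deg u) (word_deg w)) (bv (u + w, l + word_deg u, v))"
proof (induction u rule: fmon_induct)
  case (Cons i u)
  have "EW (FMon [i] + u) (bv (w, l, v)) = pm_scale (chi (alpha i) (word_deg u) * escal (word_deg u)
      * chi (word_deg (FMon [i] + u)) (word_deg w)) (bv (FMon [i] + u + w, l + word_deg (FMon [i] + u), v))"
    by (simp add: Cons EE_def X_add_left X_add_right mult_ac add_ac)
  then show ?case unfolding escal_Cons .
qed simp

text \<open>On a homogeneous relation the scalar in \<open>EW_bv\<close> is the same for all words,
  so the relation acts as a multiple of left multiplication by itself in the first factor.\<close>

lemma EW_I_N:
  assumes "f \<in> \<I>"
  shows "lext (\<lambda>u. EW u a) f \<in> N"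
proof -
  have basis: "lext (\<lambda>u. EW u (bv (w, l, v))) f \<in> N" for w l v
  proof (rule homogeneous_I[OF plin_lext subspace_N assms])
    fix f d assume f: "f \<in> \<I>" and d: "\<And>u. u \<in> Poly_Mapping.keys f \<Longrightarrow> word_deg u = d"
    have "lext (\<lambda>u. EW u (bv (w, l, v))) f = pm_scale (escal d * chi d (word_deg w)) (wpart (l + d) v (f * bv w))"
      by (rule plin_eqI[where a = f and f = "lext (\<lambda>u. EW u (bv (w, l, v)))"])
        (simp_all add: EW_bv d bv_mult)
    then show "lext (\<lambda>u. EW u (bv (w, l, v))) f \<in> N" by (simp add: N_scale wpart_N I_mult_right f)
  qed
  show ?thesis
  proof (induction a rule: pm_induct)
    case zero then show ?case by (simp add: plin_0[OF plin_EW]) (simp add: lext_def)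
  next
    case (single x) then show ?case using basis by (cases x) auto
  qed (simp_all add: plin_add[OF plin_EW] plin_scale[OF plin_EW] lext_fun_add lext_fun_scale N_add N_scale)
qed

end

section \<open>Algebras presented by free algebras\<close>

text \<open>
  The records of interest are nested quotients and subalgebras. All computations are carried out in
  a subalgebra \<open>P\<close> of a free algebra, on representatives modulo the kernel of \<open>p\<close>.
\<close>

locale presented_algebra =
  fixes A :: "('k::field, 'a) module" (structure)
    and P :: "('x, 'k) free_alg set"
    and p :: "('x, 'k) free_alg \<Rightarrow> 'a"
  assumes carrier_eq: "carrier A = p ` P"
    and P_one [simp, intro]: "1 \<in> P"
    and P_add [simp, intro]: "f \<in> P \<Longrightarrow> g \<in> P \<Longrightarrow> f + g \<in> P"
    and P_mult [simp, intro]: "f \<in> P \<Longrightarrow> g \<in> P \<Longrightarrow> f * g \<in> P"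
    and P_scale [simp, intro]: "f \<in> P \<Longrightarrow> pm_scale c f \<in> P"
    and p_one: "p 1 = \<one>"
    and p_zero: "p 0 = \<zero>"
    and p_add: "f \<in> P \<Longrightarrow> g \<in> P \<Longrightarrow> p (f + g) = p f \<oplus> p g"
    and p_mult: "f \<in> P \<Longrightarrow> g \<in> P \<Longrightarrow> p (f * g) = p f \<otimes> p g"
    and p_scale: "f \<in> P \<Longrightarrow> p (pm_scale c f) = c \<odot> p f"
begin

lemma P_zero [simp, intro]: "0 \<in> P"
  using P_scale[OF P_one, of 0] by simp

lemma P_uminus [simp, intro]: "f \<in> P \<Longrightarrow> - f \<in> P"
  using P_scale[of f "-1"] by simp

lemma P_diff [simp, intro]: "f \<in> P \<Longrightarrow> g \<in> P \<Longrightarrow> f - g \<in> P"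
  using P_add[of f "- g"] by simp

lemma P_subspace: "pm.subspace P"
  by (simp add: pm.subspace_def)

lemma P_sum [intro]: "(\<And>x. x \<in> S \<Longrightarrow> f x \<in> P) \<Longrightarrow> sum f S \<in> P"
  by (rule pm.subspace_sum[OF P_subspace])

lemma p_closed [simp, intro]: "f \<in> P \<Longrightarrow> p f \<in> carrier A"
  by (simp add: carrier_eq)

lemma p_cases: "x \<in> carrier A \<Longrightarrow> (\<And>f. f \<in> P \<Longrightarrow> x = p f \<Longrightarrow> thesis) \<Longrightarrow> thesis"
  by (auto simp: carrier_eq)

lemma ring_A: "ring A"
proof (rule ringI)
  show "abelian_group A"
  proof (rule abelian_groupI, goal_cases)
    case (6 x)
    then obtain f where f: "f \<in> P" "x = p f" by (rule p_cases)
    then have "p (- f) \<oplus> x = \<zero>" using p_add[of "- f" f] p_zero by simp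
    then show ?case using f by blast
  qed (auto simp: carrier_eq p_zero[symmetric] p_add[symmetric] add_ac intro!: imageI)
  show "monoid A"
    by (rule monoidI) (auto simp: carrier_eq p_one[symmetric] p_mult[symmetric] mult.assoc intro!: imageI)
qed (auto simp: carrier_eq p_add[symmetric] p_mult[symmetric] algebra_simps)

end

sublocale presented_algebra \<subseteq> ring A
  by (rule ring_A)

context presented_algebra
begin

lemma p_uminus: "f \<in> P \<Longrightarrow> p (- f) = \<ominus> p f"
  using p_add[of "- f" f] by (intro minus_equality[symmetric]) (auto simp: p_zero)

lemma p_diff: "f \<in> P \<Longrightarrow> g \<in> P \<Longrightarrow> p (f - g) = p f \<ominus> p g"
  using p_add[of f "- g"] by (simp add: p_uminus a_minus_def)

lemma p_eq_iff: "f \<in> P \<Longrightarrow> g \<in> P \<Longrightarrow> p f = p g \<longleftrightarrow> p (f - g) = \<zero>"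
  by (simp add: p_diff)

lemma p_add_cong: "f \<in> P \<Longrightarrow> g \<in> P \<Longrightarrow> f' \<in> P \<Longrightarrow> g' \<in> P \<Longrightarrow> p f = p f' \<Longrightarrow> p g = p g' \<Longrightarrow> p (f + g) = p (f' + g')"
  and p_diff_cong: "f \<in> P \<Longrightarrow> g \<in> P \<Longrightarrow> f' \<in> P \<Longrightarrow> g' \<in> P \<Longrightarrow> p f = p f' \<Longrightarrow> p g = p g' \<Longrightarrow> p (f - g) = p (f' - g')"
  and p_mult_cong: "f \<in> P \<Longrightarrow> g \<in> P \<Longrightarrow> f' \<in> P \<Longrightarrow> g' \<in> P \<Longrightarrow> p f = p f' \<Longrightarrow> p g = p g' \<Longrightarrow> p (f * g) = p (f' * g')"
  and p_scale_cong: "f \<in> P \<Longrightarrow> f' \<in> P \<Longrightarrow> p f = p f' \<Longrightarrow> p (pm_scale c f) = p (pm_scale c f')"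
  by (simp_all add: p_add p_diff p_mult p_scale)

lemma p_sum_cong:
  "(\<And>x. x \<in> S \<Longrightarrow> f x \<in> P \<and> g x \<in> P \<and> p (f x) = p (g x)) \<Longrightarrow> p (sum f S) = p (sum g S)"
proof (induction S rule: infinite_finite_induct)
  case (insert x S)
  then show ?case by (simp, intro p_add_cong P_sum) auto
qed auto

lemma p_lext_cong:
  assumes "\<And>x. x \<in> Poly_Mapping.keys a \<Longrightarrow> f x \<in> P \<and> g x \<in> P \<and> p (f x) = p (g x)"
  shows "p (lext f a) = p (lext g a)"
  unfolding lext_def by (rule p_sum_cong) (use assms in \<open>auto intro: p_scale_cong\<close>)

lemma P_lext [intro]: "(\<And>x. x \<in> Poly_Mapping.keys a \<Longrightarrow> f x \<in> P) \<Longrightarrow> lext f a \<in> P"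
  by (rule lext_in_subspace[OF P_subspace])

lemma finsum_p:
  "finite S \<Longrightarrow> (\<And>x. x \<in> S \<Longrightarrow> f x \<in> P) \<Longrightarrow> finsum A (\<lambda>x. p (f x)) S = p (sum f S)"
proof (induction S rule: finite_induct)
  case (insert x S)
  then show ?case by (simp add: finsum_insert Pi_iff p_add P_sum)
qed (simp add: p_zero)

lemma smult_conv_mult: "x \<in> carrier A \<Longrightarrow> c \<odot> x = (c \<odot> \<one>) \<otimes> x"
  by (elim p_cases) (simp add: p_one[symmetric] p_scale[symmetric] p_mult[symmetric] pm_scale_mult_left)

lemma smult_closed [simp, intro]: "x \<in> carrier A \<Longrightarrow> c \<odot> x \<in> carrier A"
  by (elim p_cases) (simp add: p_scale[symmetric])

end

section \<open>Subalgebras, quotients and ideals on representatives\<close>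

inductive_set subalg :: "('x, 'k::field) free_alg set \<Rightarrow> ('x, 'k) free_alg set" for G where
  one: "1 \<in> subalg G"
| gen: "g \<in> G \<Longrightarrow> g \<in> subalg G"
| add: "f \<in> subalg G \<Longrightarrow> g \<in> subalg G \<Longrightarrow> f + g \<in> subalg G"
| mult: "f \<in> subalg G \<Longrightarrow> g \<in> subalg G \<Longrightarrow> f * g \<in> subalg G"
| scale: "f \<in> subalg G \<Longrightarrow> pm_scale c f \<in> subalg G"

lemma subalg_mono: "G \<subseteq> subalg H \<Longrightarrow> subalg G \<subseteq> subalg H"
proof
  fix f assume "G \<subseteq> subalg H" "f \<in> subalg G"
  from this(2,1) show "f \<in> subalg H" by induction (auto intro: subalg.intros)
qed

lemma pm_subspace_subalg: "pm.subspace (subalg G)"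
  using subalg.scale[OF subalg.one, of 0] by (auto simp: pm.subspace_def intro: subalg.intros)

context presented_algebra
begin

lemma subalg_P: "G \<subseteq> P \<Longrightarrow> subalg G \<subseteq> P"
proof
  fix f assume "f \<in> subalg G" "G \<subseteq> P"
  then show "f \<in> P" by induction auto
qed

lemma gen_subalg_image:
  assumes G: "G \<subseteq> P"
  shows "gen_subalg A (p ` G) = p ` subalg G"
proof
  show "gen_subalg A (p ` G) \<subseteq> p ` subalg G"
  proof
    fix x assume "x \<in> gen_subalg A (p ` G)"
    then show "x \<in> p ` subalg G"
      unfolding gen_subalg_def
    proof (induction rule: generate_ring.induct)
      case one
      show ?case using p_one subalg.one by (metis image_eqI)
    next
      case (incl h)
      then show ?case
        by (auto simp: p_one[symmetric] p_scale[symmetric] intro: subalg.intros imageI)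
    next
      case (a_inv h)
      then obtain f where f: "f \<in> subalg G" "h = p f" by auto
      with subalg_P[OF G] have "\<ominus> h = p (pm_scale (- 1) f)" by (auto simp: p_uminus)
      with subalg.scale[OF f(1)] show ?case by blast
    next
      case (eng_add h1 h2)
      then obtain f g where fg: "f \<in> subalg G" "h1 = p f" "g \<in> subalg G" "h2 = p g" by auto
      then have "f \<in> P" "g \<in> P" using subalg_P[OF G] by auto
      with fg show ?case
        by (intro image_eqI[of _ _ "f + g"]) (auto simp: p_add intro: subalg.intros)
    next
      case (eng_mult h1 h2)
      then obtain f g where fg: "f \<in> subalg G" "h1 = p f" "g \<in> subalg G" "h2 = p g" by auto
      then have "f \<in> P" "g \<in> P" using subalg_P[OF G] by auto
      with fg show ?case
        by (intro image_eqI[of _ _ "f * g"]) (auto simp: p_mult intro: subalg.intros)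
    qed
  qed
  have "p f \<in> gen_subalg A (p ` G)" if "f \<in> subalg G" for f
    using that
  proof induction
    case one
    then show ?case by (simp add: p_one gen_subalg_def generate_ring.one)
  next
    case (gen g)
    then show ?case by (auto simp: gen_subalg_def intro: generate_ring.incl)
  next
    case (add f g)
    then have "f \<in> P" "g \<in> P" using subalg_P[OF G] by auto
    with add show ?case
      by (auto simp: gen_subalg_def p_add intro: generate_ring.eng_add)
  next
    case (mult f g)
    then have "f \<in> P" "g \<in> P" using subalg_P[OF G] by auto
    with mult show ?case
      by (auto simp: gen_subalg_def p_mult intro: generate_ring.eng_mult)
  next
    case (scale f c)
    have "p (pm_scale c f) = (c \<odot> \<one>) \<otimes> p f"
      using scale(1) subalg_P[OF G] p_scale[of f c] smult_conv_mult[of "p f" c] by auto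
    moreover have "c \<odot> \<one> \<in> gen_subalg A (p ` G)"
      unfolding gen_subalg_def by (rule generate_ring.incl) auto
    ultimately show ?case
      using scale(2) by (simp add: gen_subalg_def generate_ring.eng_mult)
  qed
  then show "p ` subalg G \<subseteq> gen_subalg A (p ` G)" by auto
qed

lemma presented_restrict:
  assumes G: "G \<subseteq> P"
  shows "presented_algebra (restrict_carrier A (p ` subalg G)) (subalg G) p"
  using subalg_P[OF G]
  by (unfold_locales)
    (auto simp: restrict_carrier_def p_one p_zero p_scale intro: subalg.intros p_add p_mult)

lemma presented_quot:
  assumes J: "ideal J A"
  shows "presented_algebra (quot_alg A J) P (\<lambda>f. J +> p f)"
proof -
  interpret J: ideal J A by fact
  \<comment> \<open>Scalar multiplication in \<open>quot_alg\<close> is a union over the coset; it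
    is a single coset because \<open>J\<close> absorbs multiplication by \<open>c\<close> times the
    unit.\<close>
  have smult: "(\<Union>x\<in>J +> p f. J +> (c \<odot> x)) = J +> (c \<odot> p f)" if f: "f \<in> P" for c f
  proof -
    have "J +> (c \<odot> x) = J +> (c \<odot> p f)" if x: "x \<in> J +> p f" for x
    proof -
      have xc: "x \<in> carrier A" using x f J.a_elemrcos_carrier by blast
      have "J +> p f = J +> x" using x f by (simp add: J.a_repr_independence')
      then have "p f \<ominus> x \<in> J" using quotient_eq_iff_same_a_r_cos[OF J] f xc by simp
      then have "(c \<odot> \<one>) \<otimes> (p f \<ominus> x) \<in> J" by (simp add: J.I_l_closed)
      moreover have "(c \<odot> \<one>) \<otimes> (p f \<ominus> x) = (c \<odot> p f) \<ominus> (c \<odot> x)"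
        using f xc smult_conv_mult[of x c] smult_conv_mult[of "p f" c]
        by (simp add: a_minus_def r_distr r_minus)
      ultimately show ?thesis using quotient_eq_iff_same_a_r_cos[OF J, of "c \<odot> p f" "c \<odot> x"] f xc by simp
    qed
    moreover have "p f \<in> J +> p f" using f by (simp add: J.a_rcos_self)
    ultimately show ?thesis by blast
  qed
  have zero: "J +> p 0 = J" using J.zero_closed by (simp add: p_zero J.a_rcos_const)
  show ?thesis
  proof (unfold_locales, goal_cases)
    case 1
    have "carrier (quot_alg A J) = (\<lambda>x. J +> x) ` carrier A"
      by (auto simp: quot_alg_def FactRing_simps)
    then show ?case by (simp add: carrier_eq image_image)
  next
    case 7
    show ?case using zero by (simp add: quot_alg_def FactRing_def)
  next
    case (8 f g)
    then show ?case by (simp add: quot_alg_def FactRing_def J.a_rcos_sum p_add)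
  next
    case (9 f g)
    then show ?case by (simp add: quot_alg_def FactRing_def J.rcoset_mult_add p_mult)
  next
    case (10 f c)
    then show ?case by (simp add: quot_alg_def smult p_scale)
  qed (auto simp: quot_alg_def FactRing_def p_one)
qed

lemma quot_eq_iff:
  assumes "ideal J A" "f \<in> P" "g \<in> P"
  shows "J +> p f = J +> p g \<longleftrightarrow> p (f - g) \<in> J"
  using quotient_eq_iff_same_a_r_cos[OF assms(1), of "p f" "p g"] assms by (simp add: p_diff)

text \<open>The images of the representatives satisfying \<open>Q\<close> form an ideal containing
  \<open>S\<close>; \<open>resp\<close> then carries \<open>Q\<close> to the given
  representative.\<close>

lemma Idl_induct:
  assumes f: "f \<in> P" "p f \<in> Idl S" and S: "S \<subseteq> carrier A"
    and resp: "\<And>f g. f \<in> P \<Longrightarrow> g \<in> P \<Longrightarrow> p f = p g \<Longrightarrow> Q f \<Longrightarrow> Q g"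
    and Q0: "Q 0" and Qadd: "\<And>f g. f \<in> P \<Longrightarrow> g \<in> P \<Longrightarrow> Q f \<Longrightarrow> Q g \<Longrightarrow> Q (f + g)"
    and Ql: "\<And>f g. f \<in> P \<Longrightarrow> g \<in> P \<Longrightarrow> Q f \<Longrightarrow> Q (g * f)"
    and Qr: "\<And>f g. f \<in> P \<Longrightarrow> g \<in> P \<Longrightarrow> Q f \<Longrightarrow> Q (f * g)"
    and QS: "\<And>s. s \<in> S \<Longrightarrow> \<exists>f\<in>P. p f = s \<and> Q f"
  shows "Q f"
proof -
  let ?J = "p ` {f \<in> P. Q f}"
  have "ideal ?J A"
  proof (rule idealI)
    show "ring A" by (rule ring_A)
    show "subgroup ?J (add_monoid A)"
    proof (rule subgroup.intro, goal_cases)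
      case 1 show ?case by auto
    next
      case (2 x y) then show ?case
        by (auto simp: p_add[symmetric] intro!: imageI Qadd)
    next
      case 3 show ?case using Q0 p_zero by (metis (mono_tags, lifting) P_zero image_eqI mem_Collect_eq monoid.select_convs(2))
    next
      case (4 x)
      then obtain f where f: "f \<in> P" "Q f" "x = p f" by auto
      have "Q (- f)" using Ql[OF f(1) P_scale[OF P_one, of "-1"] f(2)] by simp
      then show ?case using f by (auto simp: a_inv_def[symmetric] p_uminus[symmetric] intro!: imageI)
    qed
  next
    fix a x assume "a \<in> ?J" "x \<in> carrier A"
    then obtain f g where fg: "f \<in> P" "Q f" "a = p f" "g \<in> P" "x = p g" by (auto simp: carrier_eq)
    have "x \<otimes> a = p (g * f)" "a \<otimes> x = p (f * g)" using fg by (simp_all add: p_mult)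
    then show "x \<otimes> a \<in> ?J" "a \<otimes> x \<in> ?J" using fg Ql Qr by auto
  qed
  moreover have "S \<subseteq> ?J" using QS by fastforce
  ultimately have "Idl S \<subseteq> ?J" by (rule genideal_minimal)
  with f obtain g where "g \<in> P" "Q g" "p g = p f" by auto
  with resp f show ?thesis by blast
qed

end

section \<open>Triangular decomposition\<close>

text \<open>With \<open>h\<close> inverse to \<open>g\<close>, multiply the relation by
  \<open>h\<close> on both sides.\<close>

lemma (in presented_algebra) commute_inverse:
  assumes P: "f \<in> P" "g \<in> P" "h \<in> P"
    and fg: "p (f * g) = p (pm_scale c (g * f))" and inv: "p (g * h) = p 1" "p (h * g) = p 1"
  shows "p (h * f) = p (pm_scale c (f * h))"
proof -
  have "p (h * f) = p (h * f * (g * h))"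
    using p_mult_cong[of "h * f" 1 "h * f" "g * h"] P inv by simp
  also have "\<dots> = p (h * (f * g) * h)" by (simp add: mult.assoc)
  also have "\<dots> = p (h * pm_scale c (g * f) * h)"
    by (intro p_mult_cong fg refl) (use P in auto)
  also have "\<dots> = p (pm_scale c ((h * g) * (f * h)))"
    by (simp add: pm_scale_mult_left pm_scale_mult_right mult.assoc)
  also have "\<dots> = p (pm_scale c (1 * (f * h)))"
    by (intro p_mult_cong p_scale_cong inv refl) (use P in auto)
  finally show ?thesis by simp
qed

interpretation fa: presented_algebra free_algebra UNIV "\<lambda>f. f"
  by unfold_locales (auto simp: free_algebra_def)

lemma relabel_conv_lext: "relabel g f = lext (\<lambda>w. bv (map_fmon g w)) f"
  by (simp add: relabel_def lext_def pm_scale_single)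

lemma plin_relabel [simp, intro]: "plin (relabel g)"
  unfolding relabel_conv_lext[abs_def] by simp

lemmas plin_relabel_comp [simp, intro] = plin_comp[OF plin_relabel]
  and relabel_linear [simp] = plin_add[OF plin_relabel] plin_scale[OF plin_relabel] plin_0[OF plin_relabel]
    plin_diff[OF plin_relabel]

lemma map_fmon_add [simp]: "map_fmon g (u + v) = map_fmon g u + map_fmon g v"
  by (cases u; cases v) simp

lemma map_fmon_0 [simp]: "map_fmon g 0 = 0"
  by (simp add: zero_fmon_def del: FMon_Nil)

lemma relabel_bv [simp]: "relabel g (bv w) = bv (map_fmon g w)"
  by (simp add: relabel_conv_lext)

lemma relabel_fgen [simp]: "relabel g (fgen i) = fgen (g i)"
  by (simp add: fgen_bv)

lemma relabel_1 [simp]: "relabel g 1 = 1"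
  using relabel_bv[of g 0] by simp

lemma relabel_mult [simp]: "relabel g (a * b) = relabel g a * relabel g b"
proof (rule plin_eqI[where a = a and f = "\<lambda>a. relabel g (a * b)"], goal_cases)
  case (3 u)
  show ?case
    by (rule plin_eqI[where a = b and f = "\<lambda>b. relabel g (bv u * b)"]) (simp_all add: bv_mult)
qed simp_all

lemma relabel_relabel: "relabel g (relabel h f) = relabel (\<lambda>x. g (h x)) f"
  by (rule plin_eqI[where a = f and f = "\<lambda>f. relabel g (relabel h f)"])
    (simp_all add: fmon.map_comp comp_def)

context pre_nichols
begin

lemma ideal_Utilde_ideal: "ideal (Utilde_ideal chi) free_algebra"
  unfolding Utilde_ideal_def by (rule fa.genideal_ideal) (simp add: free_algebra_def)

lemma Utilde_class_eq: "Utilde_class chi = (\<lambda>f. Utilde_ideal chi +>\<^bsub>free_algebra\<^esub> f)"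
  by (simp add: Utilde_class_def[abs_def])

sublocale Ut: presented_algebra "Utilde chi" UNIV "Utilde_class chi"
  unfolding Utilde_def Utilde_class_eq by (rule fa.presented_quot[OF ideal_Utilde_ideal])

lemma Utilde_class_eq_iff: "Utilde_class chi f = Utilde_class chi g \<longleftrightarrow> f - g \<in> Utilde_ideal chi"
  using fa.quot_eq_iff[OF ideal_Utilde_ideal, of f g] by (simp add: Utilde_class_def)

lemma Utilde_relations_in_ideal: "f \<in> Utilde_relations chi \<Longrightarrow> f \<in> Utilde_ideal chi"
  unfolding Utilde_ideal_def using fa.genideal_self[of "Utilde_relations chi"]
  by (auto simp: free_algebra_def)

lemma Ut_K_Kinv: "Utilde_class chi (fgen (K i) * fgen (Kinv i)) = Utilde_class chi 1"
  and Ut_Kinv_K: "Utilde_class chi (fgen (Kinv i) * fgen (K i)) = Utilde_class chi 1"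
  and Ut_K_K: "Utilde_class chi (fgen (K i) * fgen (K j)) = Utilde_class chi (fgen (K j) * fgen (K i))"
  and Ut_K_E: "Utilde_class chi (fgen (K i) * fgen (E j))
    = Utilde_class chi (pm_scale (qmat chi i j) (fgen (E j) * fgen (K i)))"
  and Ut_K_F: "Utilde_class chi (fgen (K i) * fgen (F j))
    = Utilde_class chi (pm_scale (inverse (qmat chi i j)) (fgen (F j) * fgen (K i)))"
  and Ut_E_F: "Utilde_class chi (fgen (E i) * fgen (F j)) = Utilde_class chi (fgen (F j) * fgen (E i)
    + (if i = j then fgen (K i) - fgen (Kinv i) else 0))"
  unfolding Utilde_class_eq_iff diff_diff_eq[symmetric]
  by (rule Utilde_relations_in_ideal, unfold Utilde_relations_def, blast)+

lemma Ut_move_scale: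
  assumes "Utilde_class chi f = Utilde_class chi (pm_scale c g)" "c \<noteq> 0"
  shows "Utilde_class chi g = Utilde_class chi (pm_scale (inverse c) f)"
  using Ut.p_scale_cong[OF _ _ assms(1), of "inverse c"] assms(2) by simp

lemma qmat_nz: "qmat chi i j \<noteq> 0"
  by (simp add: qmat_def)

lemma Ut_Kinv_E: "Utilde_class chi (fgen (Kinv i) * fgen (E j))
    = Utilde_class chi (pm_scale (inverse (qmat chi i j)) (fgen (E j) * fgen (Kinv i)))"
  by (rule Ut.commute_inverse[OF _ _ _ Ut_move_scale[OF Ut_K_E qmat_nz] Ut_K_Kinv Ut_Kinv_K]) auto

lemma Ut_Kinv_F: "Utilde_class chi (fgen (Kinv i) * fgen (F j))
    = Utilde_class chi (pm_scale (qmat chi i j) (fgen (F j) * fgen (Kinv i)))"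
  using Ut.commute_inverse[OF _ _ _ Ut_move_scale[OF Ut_K_F[of i j]] Ut_K_Kinv Ut_Kinv_K]
  by (simp add: qmat_nz)

lemma Ut_Kinv_K_commute: "Utilde_class chi (fgen (Kinv i) * fgen (K j)) = Utilde_class chi (fgen (K j) * fgen (Kinv i))"
  using Ut.commute_inverse[of "fgen (K j)" "fgen (K i)" "fgen (Kinv i)" 1] Ut_K_K[of j i] Ut_K_Kinv Ut_Kinv_K
  by simp

lemma Ut_Kinv_Kinv: "Utilde_class chi (fgen (Kinv i) * fgen (Kinv j)) = Utilde_class chi (fgen (Kinv j) * fgen (Kinv i))"
  using Ut.commute_inverse[of "fgen (Kinv j)" "fgen (K i)" "fgen (Kinv i)" 1]
    Ut_Kinv_K_commute[of j i] Ut_K_Kinv Ut_Kinv_K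
  by simp

text \<open>Needed because \<open>omega\<close> is a union over all representatives of a class: only
  with this is its value a single class.\<close>

lemma relabel_omega_ideal:
  assumes "f \<in> Utilde_ideal chi"
  shows "relabel omega_gen f \<in> Utilde_ideal chi"
proof -
  interpret J: ideal "Utilde_ideal chi" free_algebra by (rule ideal_Utilde_ideal)
  have J0: "0 \<in> Utilde_ideal chi" using J.zero_closed by (simp add: free_algebra_def)
  have Jadd: "a + b \<in> Utilde_ideal chi" if "a \<in> Utilde_ideal chi" "b \<in> Utilde_ideal chi" for a b
    using J.a_closed[OF that] by (simp add: free_algebra_def)
  have Jl: "b * a \<in> Utilde_ideal chi" and Jr: "a * b \<in> Utilde_ideal chi" if "a \<in> Utilde_ideal chi" for a b
    using J.I_l_closed[OF that, of b] J.I_r_closed[OF that, of b] by (auto simp: free_algebra_def)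
  have rel: "relabel omega_gen s \<in> Utilde_ideal chi" if "s \<in> Utilde_relations chi" for s
  proof -
    from that consider
        i where "s = fgen (K i) * fgen (Kinv i) - 1" | i where "s = fgen (Kinv i) * fgen (K i) - 1"
      | i j where "s = fgen (K i) * fgen (K j) - fgen (K j) * fgen (K i)"
      | i j where "s = fgen (K i) * fgen (E j) - pm_scale (qmat chi i j) (fgen (E j) * fgen (K i))"
      | i j where "s = fgen (K i) * fgen (F j) - pm_scale (inverse (qmat chi i j)) (fgen (F j) * fgen (K i))"
      | i j where "s = fgen (E i) * fgen (F j) - fgen (F j) * fgen (E i)
        - (if i = j then fgen (K i) - fgen (Kinv i) else 0)"
      unfolding Utilde_relations_def by blast
    then show ?thesis
    proof cases
      case 1 then show ?thesis using Ut_Kinv_K by (simp add: Utilde_class_eq_iff)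
    next
      case 2 then show ?thesis using Ut_K_Kinv by (simp add: Utilde_class_eq_iff)
    next
      case 3 then show ?thesis using Ut_Kinv_Kinv by (simp add: Utilde_class_eq_iff)
    next
      case 4 then show ?thesis using Ut_Kinv_F by (simp add: Utilde_class_eq_iff)
    next
      case 5 then show ?thesis using Ut_Kinv_E by (simp add: Utilde_class_eq_iff)
    next
      case (6 i j)
      \<comment> \<open>The image is the negative of the same relation for the pair
        \<open>(j, i)\<close>.\<close>
      have "relabel omega_gen s = fgen (F i) * fgen (E j) + (if j = i then fgen (K j) - fgen (Kinv j) else 0)
        - fgen (E j) * fgen (F i)"
        unfolding 6 by (simp add: algebra_simps)
      then show ?thesis using Ut_E_F[of j i, symmetric] by (simp add: Utilde_class_eq_iff)
    qed
  qed
  show ?thesis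
  proof (rule fa.Idl_induct[of f "Utilde_relations chi"])
    show "f \<in> Idl\<^bsub>free_algebra\<^esub> (Utilde_relations chi)" using assms by (simp add: Utilde_ideal_def)
  qed (use rel in \<open>auto simp: free_algebra_def J0 Jadd Jl Jr\<close>)
qed

lemma omega_Utilde_class: "omega chi (Utilde_class chi f) = Utilde_class chi (relabel omega_gen f)"
proof -
  have "Utilde_class chi (relabel omega_gen g) = Utilde_class chi (relabel omega_gen f)"
    if "g \<in> Utilde_class chi f" for g
  proof -
    from that have "g - f \<in> Utilde_ideal chi"
      by (auto simp: Utilde_class_def a_r_coset_def' free_algebra_def)
    from relabel_omega_ideal[OF this] show ?thesis by (simp add: Utilde_class_eq_iff)
  qed
  moreover have "f \<in> Utilde_class chi f"
    using additive_subgroup.zero_closed[OF ideal.axioms(1)[OF ideal_Utilde_ideal]]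
    by (force simp: Utilde_class_def a_r_coset_def' free_algebra_def)
  ultimately show ?thesis unfolding omega_def by blast
qed

definition pi :: "('i generator, 'k) free_alg \<Rightarrow> ('i, 'k) U_elt" where
  "pi f = U_ideal chi \<I> +>\<^bsub>Utilde chi\<^esub> Utilde_class chi f"

lemma U_gens: "plus_part chi \<I> \<union> omega chi ` plus_part chi \<I>
    = Utilde_class chi ` (relabel E ` \<I> \<union> relabel F ` \<I>)"
  by (simp add: plus_part_def image_Un image_image omega_Utilde_class relabel_relabel)

lemma ideal_U_ideal: "ideal (U_ideal chi \<I>) (Utilde chi)"
  unfolding U_ideal_def U_gens by (rule Ut.genideal_ideal) auto

sublocale U: presented_algebra "U_alg chi \<I>" UNIV pi
  unfolding U_alg_def pi_def[abs_def] by (rule Ut.presented_quot[OF ideal_U_ideal])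

lemma U_gen_eq: "U_gen chi \<I> x = pi (fgen x)"
  by (simp add: U_gen_def pi_def)

lemma pi_eq_iff: "pi f = pi g \<longleftrightarrow> Utilde_class chi (f - g) \<in> U_ideal chi \<I>"
  using Ut.quot_eq_iff[OF ideal_U_ideal, of f g] by (simp add: pi_def)

lemma pi_cong: "Utilde_class chi f = Utilde_class chi g \<Longrightarrow> pi f = pi g"
  by (simp add: pi_def)

lemma pi_I:
  assumes "f \<in> \<I>"
  shows "pi (relabel E f) = pi 0" "pi (relabel F f) = pi 0"
proof -
  have "Utilde_class chi ` (relabel E ` \<I> \<union> relabel F ` \<I>) \<subseteq> U_ideal chi \<I>"
    unfolding U_ideal_def U_gens by (rule Ut.genideal_self) auto
  with assms show "pi (relabel E f) = pi 0" "pi (relabel F f) = pi 0" by (auto simp: pi_eq_iff)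
qed

lemmas pi_K_Kinv = pi_cong[OF Ut_K_Kinv] and pi_Kinv_K = pi_cong[OF Ut_Kinv_K]
  and pi_K_K = pi_cong[OF Ut_K_K] and pi_K_E = pi_cong[OF Ut_K_E] and pi_K_F = pi_cong[OF Ut_K_F]
  and pi_Kinv_E = pi_cong[OF Ut_Kinv_E] and pi_Kinv_F = pi_cong[OF Ut_Kinv_F]
  and pi_Kinv_K_commute = pi_cong[OF Ut_Kinv_K_commute] and pi_Kinv_Kinv = pi_cong[OF Ut_Kinv_Kinv]
  and pi_E_F = pi_cong[OF Ut_E_F]

section \<open>The representation of the free algebra\<close>

primrec gact :: "'i generator \<Rightarrow> ('i pbw \<Rightarrow>\<^sub>0 'k) \<Rightarrow> ('i pbw \<Rightarrow>\<^sub>0 'k)" where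
  "gact (E i) = EE i"
| "gact (F i) = FF 1 i"
| "gact (K i) = KK (alpha i)"
| "gact (Kinv i) = KK (- alpha i)"

lemma plin_gact [simp, intro]: "plin (gact x)"
  by (cases x) auto

lemma gact_N: "a \<in> N \<Longrightarrow> gact x a \<in> N"
  by (cases x) (auto simp: EE_N FF_N KK_N)

definition wact :: "'i generator fmon \<Rightarrow> ('i pbw \<Rightarrow>\<^sub>0 'k) \<Rightarrow> ('i pbw \<Rightarrow>\<^sub>0 'k)" where
  "wact u a = foldr gact (letters u) a"

lemma wact_0 [simp]: "wact 0 a = a" and wact_add [simp]: "wact (u + v) a = wact u (wact v a)"
  and wact_letter [simp]: "wact (FMon [x]) a = gact x a"
  by (simp_all add: wact_def)

lemma plin_wact [simp, intro]: "plin (wact u)"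
  by (induction u rule: fmon_induct) (simp_all add: plin_comp plin_gact wact_def[abs_def])

lemmas plin_wact_comp [simp, intro] = plin_comp[OF plin_wact]

lemma wact_N: "a \<in> N \<Longrightarrow> wact u a \<in> N"
  by (induction u rule: fmon_induct) (auto simp: gact_N)

definition rho :: "('i generator, 'k) free_alg \<Rightarrow> ('i pbw \<Rightarrow>\<^sub>0 'k) \<Rightarrow> ('i pbw \<Rightarrow>\<^sub>0 'k)" where
  "rho f a = lext (\<lambda>u. wact u a) f"

lemma plin_rho1: "plin (\<lambda>f. rho f a)"
  by (simp add: rho_def)

lemma plin_rho [simp, intro]: "plin (rho f)"
  unfolding rho_def[abs_def] lext_def by simp

lemmas rho_linear [simp] = plin_add[OF plin_rho1] plin_scale[OF plin_rho1] plin_0[OF plin_rho1] plin_diff[OF plin_rho1]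
lemmas rho_linear2 [simp] = plin_add[OF plin_rho] plin_scale[OF plin_rho] plin_0[OF plin_rho] plin_diff[OF plin_rho]
  and plin_rho_comp [simp, intro] = plin_comp[OF plin_rho]

lemma rho_bv [simp]: "rho (bv u) a = wact u a"
  by (simp add: rho_def)

lemma rho_fgen [simp]: "rho (fgen x) a = gact x a"
  by (simp add: fgen_bv)

lemma rho_1 [simp]: "rho 1 a = a"
  using rho_bv[of 0] by simp

lemma rho_mult [simp]: "rho (f * g) a = rho f (rho g a)"
proof (rule plin_eqI[where a = f and f = "\<lambda>f. rho (f * g) a"], goal_cases)
  case (3 u)
  show ?case
    by (rule plin_eqI[where a = g and f = "\<lambda>g. rho (bv u * g) a"])
      (simp_all add: bv_mult rho_def)
qed (auto simp: rho_def)

lemma rho_N: "a \<in> N \<Longrightarrow> rho f a \<in> N"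
  unfolding rho_def by (intro lext_in_subspace subspace_N wact_N)

lemma wact_E: "wact (map_fmon E u) a = EW u a"
  by (induction u rule: fmon_induct) simp_all

lemma wact_F: "wact (map_fmon F u) a = FW u a"
  by (induction u rule: fmon_induct) simp_all

lemma rho_relabel_E: "rho (relabel E f) a = lext (\<lambda>u. EW u a) f"
  by (rule plin_eqI[where a = f and f = "\<lambda>f. rho (relabel E f) a"])
    (simp_all add: plin_comp[OF plin_rho1] wact_E)

lemma rho_relabel_F: "rho (relabel F f) a = Fact f a"
  by (rule plin_eqI[where a = f and f = "\<lambda>f. rho (relabel F f) a"])
    (simp_all add: plin_comp[OF plin_rho1] wact_F plin_Fact1)

text \<open>The operators satisfy the relations of the algebra before division by
  \<open>\<I>\<close> exactly, not merely modulo \<open>N\<close>.\<close>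

lemma rho_Utilde_ideal:
  assumes "f \<in> Utilde_ideal chi"
  shows "rho f a = 0"
proof -
  have rel: "rho s a = 0" if "s \<in> Utilde_relations chi" for s a
    using that unfolding Utilde_relations_def
    by (auto simp: KK_KK EE_FF KK_EE KK_FF add.commute qmat_def)
  have "\<forall>a. rho f a = 0"
  proof (rule fa.Idl_induct[of f "Utilde_relations chi"])
    show "f \<in> Idl\<^bsub>free_algebra\<^esub> (Utilde_relations chi)" using assms by (simp add: Utilde_ideal_def)
  qed (use rel in \<open>auto simp: free_algebra_def\<close>)
  then show ?thesis by blast
qed

text \<open>The relations from \<open>\<I>\<close> and its image under \<open>omega\<close> map
  everything into \<open>N\<close>, and \<open>N\<close> is stable under all generators.\<close>

lemma rho_pi:
  assumes "pi f = pi g"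
  shows "rho f a - rho g a \<in> N"
proof -
  have "\<forall>a. rho (f - g) a \<in> N"
  proof (rule Ut.Idl_induct[of "f - g" "Utilde_class chi ` (relabel E ` \<I> \<union> relabel F ` \<I>)"])
    show "Utilde_class chi (f - g) \<in> Idl\<^bsub>Utilde chi\<^esub> (Utilde_class chi ` (relabel E ` \<I> \<union> relabel F ` \<I>))"
      using assms unfolding pi_eq_iff U_ideal_def U_gens .
  next
    fix f g assume fg: "Utilde_class chi f = Utilde_class chi g" and f: "\<forall>a. rho f a \<in> N"
    have "rho f a = rho g a" for a
      using rho_Utilde_ideal[of "f - g" a] fg by (simp add: Utilde_class_eq_iff)
    then show "\<forall>a. rho g a \<in> N" using f by simp
  next
    fix s assume "s \<in> Utilde_class chi ` (relabel E ` \<I> \<union> relabel F ` \<I>)"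
    then show "\<exists>f\<in>UNIV. Utilde_class chi f = s \<and> (\<forall>a. rho f a \<in> N)"
      using EW_I_N Fact_I_N by (auto simp: rho_relabel_E rho_relabel_F)
  qed (auto simp: N_add rho_N)
  then show ?thesis by simp
qed

end

lemma (in presented_algebra) p_plin_eqI:
  assumes "plin f" "plin g"
    and "\<And>x. x \<in> Poly_Mapping.keys a \<Longrightarrow> f (bv x) \<in> P \<and> g (bv x) \<in> P \<and> p (f (bv x)) = p (g (bv x))"
  shows "p (f a) = p (g a)"
  using p_lext_cong[of a "\<lambda>x. f (bv x)" "\<lambda>x. g (bv x)"] assms
  by (simp add: plin_eq_lext[symmetric])

lemma alpha_expansion: "l = (\<Sum>i\<in>UNIV. l $ i *s alpha i)" for l :: "int ^ 'i::finite"
  by (simp add: vec_eq_iff axis_def if_distrib[of "(*) _"] cong: if_cong)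

context pre_nichols
begin

lemma pi_mult_cong: "pi f = pi f' \<Longrightarrow> pi g = pi g' \<Longrightarrow> pi (f * g) = pi (f' * g')"
  and pi_add_cong: "pi f = pi f' \<Longrightarrow> pi g = pi g' \<Longrightarrow> pi (f + g) = pi (f' + g')"
  and pi_diff_cong: "pi f = pi f' \<Longrightarrow> pi g = pi g' \<Longrightarrow> pi (f - g) = pi (f' - g')"
  and pi_scale_cong: "pi f = pi f' \<Longrightarrow> pi (pm_scale c f) = pi (pm_scale c f')"
  by (rule U.p_mult_cong U.p_add_cong U.p_diff_cong U.p_scale_cong, simp_all)+

lemma pi_plin_eqI:
  assumes "plin f" "plin g" "\<And>x. x \<in> Poly_Mapping.keys a \<Longrightarrow> pi (f (bv x)) = pi (g (bv x))"
  shows "pi (f a) = pi (g a)"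
  by (rule U.p_plin_eqI) (use assms in auto)

lemma subspace_pi_zero: "plin \<Phi> \<Longrightarrow> pm.subspace {a. pi (\<Phi> a) = pi 0}"
  using pi_add_cong[of _ 0 _ 0] pi_scale_cong[of _ 0] by (auto simp: pm.subspace_def plin_0 plin_add plin_scale)

section \<open>Monomials in the invertible generators\<close>

primrec kdeg :: "'i generator \<Rightarrow> int ^ 'i" where
  "kdeg (E i) = 0" | "kdeg (F i) = 0" | "kdeg (K i) = alpha i" | "kdeg (Kinv i) = - alpha i"

primrec kneg :: "'i generator \<Rightarrow> 'i generator" where
  "kneg (E i) = E i" | "kneg (F i) = F i" | "kneg (K i) = Kinv i" | "kneg (Kinv i) = K i"

definition kgens :: "'i generator set" where "kgens = range K \<union> range Kinv"

definition kdegs :: "'i generator list \<Rightarrow> int ^ 'i" where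
  "kdegs u = sum_list (map kdeg u)"

lemma kdegs_simps [simp]: "kdegs [] = 0" "kdegs (x # u) = kdeg x + kdegs u" "kdegs (u @ v) = kdegs u + kdegs v"
  by (simp_all add: kdegs_def)

abbreviation kmon :: "'i generator list \<Rightarrow> ('i generator, 'k) free_alg" where
  "kmon u \<equiv> bv (FMon u)"

lemma kmon_Cons: "kmon (x # u) = fgen x * kmon u" and kmon_append: "kmon (u @ v) = kmon u * kmon v"
  by (simp_all add: fgen_bv bv_mult)

lemma pi_kgen_commute:
  assumes "x \<in> kgens" "y \<in> kgens"
  shows "pi (fgen x * fgen y) = pi (fgen y * fgen x)"
  using assms pi_K_K pi_Kinv_K_commute pi_Kinv_K_commute[symmetric] pi_Kinv_Kinv unfolding kgens_def by auto

lemma pi_kgen_kneg: "x \<in> kgens \<Longrightarrow> pi (fgen x * fgen (kneg x)) = pi 1"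
  using pi_K_Kinv pi_Kinv_K unfolding kgens_def by auto

lemma pi_kgen_E: "x \<in> kgens \<Longrightarrow> pi (fgen x * fgen (E j)) = pi (pm_scale (chi (kdeg x) (alpha j)) (fgen (E j) * fgen x))"
  using pi_K_E pi_Kinv_E unfolding kgens_def by (auto simp: qmat_def X_uminus_left)

lemma pi_kgen_F: "x \<in> kgens \<Longrightarrow> pi (fgen x * fgen (F j)) = pi (pm_scale (inverse (chi (kdeg x) (alpha j))) (fgen (F j) * fgen x))"
  using pi_K_F pi_Kinv_F unfolding kgens_def by (auto simp: qmat_def X_uminus_left)

lemma kmon_qcommute:
  assumes "set u \<subseteq> kgens" and c: "\<And>x. c x \<noteq> 0"
    and gen: "\<And>x. x \<in> kgens \<Longrightarrow> pi (fgen x * f) = pi (pm_scale (c x) (f * fgen x))"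
  shows "pi (kmon u * f) = pi (pm_scale (prod_list (map c u)) (f * kmon u))"
  using assms(1)
proof (induction u)
  case (Cons x u)
  have "pi (kmon (x # u) * f) = pi (fgen x * (kmon u * f))"
    by (simp only: kmon_Cons mult.assoc)
  also have "\<dots> = pi (fgen x * pm_scale (prod_list (map c u)) (f * kmon u))"
    using Cons by (intro pi_mult_cong) auto
  also have "\<dots> = pi (pm_scale (prod_list (map c u)) ((fgen x * f) * kmon u))"
    by (simp add: pm_scale_mult_right mult.assoc)
  also have "\<dots> = pi (pm_scale (prod_list (map c u)) (pm_scale (c x) (f * fgen x) * kmon u))"
    using Cons.prems by (intro pi_scale_cong pi_mult_cong gen) auto
  also have "\<dots> = pi (pm_scale (prod_list (map c (x # u))) (f * kmon (x # u)))"
    by (simp only: kmon_Cons pm_scale_mult_left mult.assoc pm.scale_scale) (simp add: mult.commute)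
  finally show ?case .
qed simp

lemma chi_kdegs: "chi (kdegs u) d = prod_list (map (\<lambda>x. chi (kdeg x) d) u)"
  by (induction u) (simp_all add: X_add_left)

lemma pi_kmon_E: "set u \<subseteq> kgens \<Longrightarrow> pi (kmon u * fgen (E j)) = pi (pm_scale (chi (kdegs u) (alpha j)) (fgen (E j) * kmon u))"
  unfolding chi_kdegs by (rule kmon_qcommute) (auto simp: pi_kgen_E)

lemma pi_kmon_F: "set u \<subseteq> kgens \<Longrightarrow> pi (kmon u * fgen (F j)) = pi (pm_scale (inverse (chi (kdegs u) (alpha j))) (fgen (F j) * kmon u))"
proof -
  assume u: "set u \<subseteq> kgens"
  have "inverse (prod_list (map (\<lambda>x. chi (kdeg x) (alpha j)) u)) = prod_list (map (\<lambda>x. inverse (chi (kdeg x) (alpha j))) u)"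
    by (induction u) (simp_all add: mult.commute)
  then show ?thesis
    unfolding chi_kdegs using kmon_qcommute[OF u, of "\<lambda>x. inverse (chi (kdeg x) (alpha j))"] by (simp add: pi_kgen_F)
qed

lemma pi_kmon_kgen: "set u \<subseteq> kgens \<Longrightarrow> x \<in> kgens \<Longrightarrow> pi (kmon u * fgen x) = pi (fgen x * kmon u)"
proof -
  assume u: "set u \<subseteq> kgens" and x: "x \<in> kgens"
  have "prod_list (map (\<lambda>x. 1 :: 'k) u) = 1" by (induction u) auto
  then show ?thesis using kmon_qcommute[OF u, of "\<lambda>_. 1" "fgen x"] pi_kgen_commute[OF _ x] by simp
qed

text \<open>Without the inverse letter the coordinate of \<open>kdegs u\<close> at its index could
  not have the sign that the hypothesis prescribes.\<close>

lemma kneg_mem: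
  assumes "set u \<subseteq> kgens" "x \<in> kgens" "kdegs u = - kdeg x"
  shows "kneg x \<in> set u"
proof (rule ccontr)
  assume nx: "kneg x \<notin> set u"
  from assms(2) consider i where "x = K i" | i where "x = Kinv i" by (auto simp: kgens_def)
  then show False
  proof cases
    case (1 i)
    have "0 \<le> kdegs u $ i"
      using assms(1) nx 1 by (induction u) (auto simp: kgens_def axis_def split: if_splits)
    then show False using assms(3) 1 by (simp add: axis_def)
  next
    case (2 i)
    have "kdegs u $ i \<le> 0"
      using assms(1) nx 2 by (induction u) (auto simp: kgens_def axis_def split: if_splits)
    then show False using assms(3) 2 by (simp add: axis_def)
  qed
qed

text \<open>In degree 0 the inverse of the first letter occurs further on; the letters commute, so
  the pair cancels and the length drops by two.\<close>

lemma pi_kmon_degree_0: "set u \<subseteq> kgens \<Longrightarrow> kdegs u = 0 \<Longrightarrow> pi (kmon u) = pi 1"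
proof (induction "length u" arbitrary: u rule: less_induct)
  case less
  show ?case
  proof (cases u)
    case (Cons x u')
    with less.prems have x: "x \<in> kgens" "set u' \<subseteq> kgens" "kdegs u' = - kdeg x"
      by (auto simp: eq_neg_iff_add_eq_0 add.commute)
    from kneg_mem[OF x(2,1,3)] obtain r s where u': "u' = r @ kneg x # s" by (meson split_list)
    have k: "kdeg (kneg x) = - kdeg x" using x(1) by (auto simp: kgens_def)
    have "pi (kmon u) = pi ((fgen x * kmon r) * (fgen (kneg x) * kmon s))"
      by (simp only: Cons u' kmon_Cons kmon_append mult.assoc)
    also have "\<dots> = pi ((kmon r * fgen x) * (fgen (kneg x) * kmon s))"
      using x u' by (intro pi_mult_cong pi_kmon_kgen[symmetric]) auto
    also have "\<dots> = pi (kmon r * ((fgen x * fgen (kneg x)) * kmon s))"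
      by (simp only: mult.assoc)
    also have "\<dots> = pi (kmon r * (1 * kmon s))"
      by (intro pi_mult_cong pi_kgen_kneg x refl)
    also have "\<dots> = pi (kmon (r @ s))" by (simp only: kmon_append) simp
    also have "\<dots> = pi 1"
      using x k by (intro less.hyps) (auto simp: Cons u' algebra_simps)
    finally show ?thesis .
  qed simp
qed

lemma pi_kmon_cong:
  assumes "set u \<subseteq> kgens" "set v \<subseteq> kgens" "kdegs u = kdegs v"
  shows "pi (kmon u) = pi (kmon v)"
proof -
  let ?w = "map kneg v"
  have w: "set ?w \<subseteq> kgens" "kdegs ?w = - kdegs v"
    using assms(2) by (induction v) (auto simp: kgens_def)
  have "pi (kmon u) = pi (kmon u * 1)" by simp
  also have "\<dots> = pi (kmon u * kmon (?w @ v))"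
    by (intro pi_mult_cong pi_kmon_degree_0[symmetric]) (use assms w in auto)
  also have "\<dots> = pi (kmon (u @ ?w) * kmon v)"
    by (simp only: kmon_append mult.assoc)
  also have "\<dots> = pi (1 * kmon v)"
    by (intro pi_mult_cong pi_kmon_degree_0) (use assms w in auto)
  finally show ?thesis by simp
qed

lemma kdegs_surj: "\<exists>u. set u \<subseteq> kgens \<and> kdegs u = l"
proof -
  let ?R = "{l. \<exists>u. set u \<subseteq> kgens \<and> kdegs u = l}"
  have add: "a + b \<in> ?R" if "a \<in> ?R" "b \<in> ?R" for a b
  proof -
    from that obtain u v where "set u \<subseteq> kgens" "kdegs u = a" "set v \<subseteq> kgens" "kdegs v = b" by auto
    then show ?thesis by (intro CollectI exI[of _ "u @ v"]) auto
  qed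
  have zero: "0 \<in> ?R" by (auto intro: exI[of _ "[]"])
  have gen: "alpha i \<in> ?R" "- alpha i \<in> ?R" for i
    by (auto simp: kgens_def intro: exI[of _ "[K i]"] exI[of _ "[Kinv i]"])
  have n: "z *s alpha i \<in> ?R" for z :: int and i
  proof (induction z rule: int_induct[of _ 0])
    case (step1 z)
    then show ?case using add[OF _ gen(1)[of i], of "z *s alpha i"] by (simp add: vector_sadd_rdistrib)
  next
    case (step2 z)
    have "(z - 1) *s alpha i = z *s alpha i + - alpha i"
      by (simp add: vec_eq_iff algebra_simps)
    then show ?case using add[OF step2(2) gen(2)[of i]] by simp
  qed (use zero in simp)
  have "(\<Sum>i\<in>A. l $ i *s alpha i) \<in> ?R" for A
  proof (induction A rule: infinite_finite_induct)
    case (insert i A)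
    then show ?case unfolding sum.insert[OF insert.hyps] by (intro add n)
  qed (use zero in simp_all)
  from this[of UNIV] show ?thesis by (simp add: alpha_expansion[symmetric])
qed

definition klist :: "int ^ 'i \<Rightarrow> 'i generator list" where
  "klist l = (SOME u. set u \<subseteq> kgens \<and> kdegs u = l)"

lemma klist: "set (klist l) \<subseteq> kgens" "kdegs (klist l) = l"
  using someI_ex[OF kdegs_surj[of l]] by (auto simp: klist_def)

text \<open>An arbitrary monomial representing \<open>K_l\<close>; it is additive in
  \<open>l\<close> only after \<open>pi\<close> is applied.\<close>

definition kk :: "int ^ 'i \<Rightarrow> ('i generator, 'k) free_alg" where
  "kk l = kmon (klist l)"

lemma pi_kk: "set u \<subseteq> kgens \<Longrightarrow> kdegs u = l \<Longrightarrow> pi (kk l) = pi (kmon u)"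
  unfolding kk_def using klist by (intro pi_kmon_cong) auto

lemma pi_kk_0: "pi (kk 0) = pi 1"
  using pi_kk[of "[]" 0] by simp

lemma pi_kk_add: "pi (kk l * kk m) = pi (kk (l + m))"
  using pi_kk[of "klist l @ klist m" "l + m"] klist[of l] klist[of m] by (simp add: kk_def bv_mult)

lemma pi_kk_K: "pi (kk (alpha i)) = pi (fgen (K i))" and pi_kk_Kinv: "pi (kk (- alpha i)) = pi (fgen (Kinv i))"
  by (rule trans[OF pi_kk[of "[_]"]]; simp add: kgens_def fgen_bv)+

lemma pi_kk_E: "pi (kk l * fgen (E j)) = pi (pm_scale (chi l (alpha j)) (fgen (E j) * kk l))"
  and pi_kk_F: "pi (kk l * fgen (F j)) = pi (pm_scale (inverse (chi l (alpha j))) (fgen (F j) * kk l))"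
  and pi_kk_kgen: "x \<in> kgens \<Longrightarrow> pi (kk l * fgen x) = pi (fgen x * kk l)"
  using pi_kmon_E[of "klist l" j] pi_kmon_F[of "klist l" j] pi_kmon_kgen[of "klist l" x] klist[of l]
  by (auto simp: kk_def)

section \<open>Left multiplication on PBW monomials\<close>

definition xgen :: "'i \<Rightarrow> ('i generator, 'k) free_alg" where
  "xgen i = fgen (E i) * fgen (Kinv i)"

definition xword :: "'i fmon \<Rightarrow> ('i generator, 'k) free_alg" where
  "xword w = foldr (\<lambda>i f. xgen i * f) (letters w) 1"

lemma xword_0 [simp]: "xword 0 = 1" and xword_letter_add [simp]: "xword (FMon [i] + w) = xgen i * xword w"
  by (simp_all add: xword_def)

lemma xword_add: "xword (u + v) = xword u * xword v"
  by (induction u rule: fmon_induct) (simp_all add: add.assoc mult.assoc)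

lemma pi_kk_xgen: "pi (kk l * xgen i) = pi (pm_scale (chi l (alpha i)) (xgen i * kk l))"
proof -
  have "pi (kk l * xgen i) = pi ((kk l * fgen (E i)) * fgen (Kinv i))"
    by (simp add: xgen_def mult.assoc)
  also have "\<dots> = pi (pm_scale (chi l (alpha i)) (fgen (E i) * kk l) * fgen (Kinv i))"
    by (intro pi_mult_cong pi_kk_E refl)
  also have "\<dots> = pi (pm_scale (chi l (alpha i)) (fgen (E i) * (kk l * fgen (Kinv i))))"
    by (simp add: pm_scale_mult_left mult.assoc)
  also have "\<dots> = pi (pm_scale (chi l (alpha i)) (fgen (E i) * (fgen (Kinv i) * kk l)))"
    by (intro pi_scale_cong pi_mult_cong pi_kk_kgen refl) (auto simp: kgens_def)
  finally show ?thesis by (simp add: xgen_def mult.assoc)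
qed

lemma pi_kk_xword: "pi (kk l * xword w) = pi (pm_scale (chi l (word_deg w)) (xword w * kk l))"
proof (induction w rule: fmon_induct)
  case (Cons i w)
  have "pi (kk l * xword (FMon [i] + w)) = pi ((kk l * xgen i) * xword w)" by (simp add: mult.assoc)
  also have "\<dots> = pi (pm_scale (chi l (alpha i)) (xgen i * kk l) * xword w)"
    by (intro pi_mult_cong pi_kk_xgen refl)
  also have "\<dots> = pi (pm_scale (chi l (alpha i)) (xgen i * (kk l * xword w)))"
    by (simp add: pm_scale_mult_left mult.assoc)
  also have "\<dots> = pi (pm_scale (chi l (alpha i)) (xgen i * pm_scale (chi l (word_deg w)) (xword w * kk l)))"
    by (intro pi_scale_cong pi_mult_cong Cons refl)
  finally show ?case by (simp add: pm_scale_mult_right mult.assoc X_add_right)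
qed simp

text \<open>Multiply the commutation relation of \<open>E_i\<close> and \<open>F_j\<close> by
  \<open>K_i^-1\<close> on the right: \<open>K_i - K_i^-1\<close> becomes
  \<open>1 - K_i^-2\<close>.\<close>

lemma pi_F_xgen: "pi (fgen (F j) * xgen i) = pi (pm_scale (inverse (chi (alpha i) (alpha j))) (xgen i * fgen (F j))
    - (if i = j then 1 - kk (minus_twice j) else 0))"
proof -
  let ?d = "if i = j then fgen (K i) - fgen (Kinv i) else 0 :: ('i generator, 'k) free_alg"
  have "pi (fgen (F j) * fgen (E i)) = pi (fgen (E i) * fgen (F j) - ?d)"
    using pi_diff_cong[OF pi_E_F[of i j] refl, of ?d] by simp
  then have "pi (fgen (F j) * xgen i) = pi ((fgen (E i) * fgen (F j) - ?d) * fgen (Kinv i))"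
    unfolding xgen_def mult.assoc[symmetric] by (intro pi_mult_cong refl)
  also have "\<dots> = pi (fgen (E i) * (fgen (F j) * fgen (Kinv i)) - ?d * fgen (Kinv i))"
    by (simp add: algebra_simps)
  also have "\<dots> = pi (fgen (E i) * pm_scale (inverse (chi (alpha i) (alpha j))) (fgen (Kinv i) * fgen (F j))
      - (if i = j then 1 - kk (minus_twice j) else 0))"
  proof (intro pi_diff_cong pi_mult_cong refl)
    have "pi (pm_scale (inverse (qmat chi i j)) (fgen (Kinv i) * fgen (F j)))
       = pi (pm_scale (inverse (qmat chi i j)) (pm_scale (qmat chi i j) (fgen (F j) * fgen (Kinv i))))"
      by (intro pi_scale_cong pi_Kinv_F)
    then show "pi (fgen (F j) * fgen (Kinv i)) = pi (pm_scale (inverse (chi (alpha i) (alpha j))) (fgen (Kinv i) * fgen (F j)))"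
      by (simp add: qmat_def)
    have "pi (fgen (K i) * fgen (Kinv i) - fgen (Kinv i) * fgen (Kinv i)) = pi (1 - kk (minus_twice i))"
    proof (intro pi_diff_cong pi_K_Kinv)
      show "pi (fgen (Kinv i) * fgen (Kinv i)) = pi (kk (minus_twice i))"
        using pi_kk[of "[Kinv i, Kinv i]" "minus_twice i"]
        by (simp add: kgens_def minus_twice_def fgen_bv bv_mult)
    qed
    then show "pi (?d * fgen (Kinv i)) = pi (if i = j then 1 - kk (minus_twice j) else 0)"
      by (auto simp: algebra_simps)
  qed
  finally show ?thesis by (simp add: pm_scale_mult_right xgen_def mult.assoc)
qed

definition ell :: "('i pbw \<Rightarrow>\<^sub>0 'k) \<Rightarrow> ('i generator, 'k) free_alg" where
  "ell = lext (\<lambda>(w, l, v). xword w * (kk l * bv (map_fmon F v)))"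

lemma plin_ell [simp, intro]: "plin ell"
  by (simp add: ell_def)

lemmas plin_ell_comp [simp, intro] = plin_comp[OF plin_ell]
  and ell_linear [simp] = plin_add[OF plin_ell] plin_scale[OF plin_ell] plin_0[OF plin_ell] plin_diff[OF plin_ell]

lemma ell_bv: "ell (bv (w, l, v)) = xword w * (kk l * bv (map_fmon F v))"
  by (simp add: ell_def)

lemma ell_XX: "ell (XX i a) = xgen i * ell a"
  by (rule plin_eqI[where a = a and f = "\<lambda>a. ell (XX i a)"]) (auto simp: ell_bv mult.assoc)

lemma pi_kk_ell: "pi (kk m * ell a) = pi (ell (KK m a))"
proof (rule pi_plin_eqI[where a = a and f = "\<lambda>a. kk m * ell a"], goal_cases)
  case (3 x)
  obtain w l v where x: "x = (w, l, v)" by (cases x)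
  have "pi (kk m * ell (bv x)) = pi ((kk m * xword w) * (kk l * bv (map_fmon F v)))"
    by (simp add: x ell_bv mult.assoc)
  also have "\<dots> = pi (pm_scale (chi m (word_deg w)) (xword w * kk m) * (kk l * bv (map_fmon F v)))"
    by (intro pi_mult_cong pi_kk_xword refl)
  also have "\<dots> = pi (pm_scale (chi m (word_deg w)) (xword w * ((kk m * kk l) * bv (map_fmon F v))))"
    by (simp add: pm_scale_mult_left mult.assoc)
  also have "\<dots> = pi (pm_scale (chi m (word_deg w)) (xword w * (kk (m + l) * bv (map_fmon F v))))"
    by (intro pi_scale_cong pi_mult_cong pi_kk_add refl)
  finally show ?case by (simp add: x ell_bv add.commute)
qed auto

text \<open>\<open>pi_F_xgen\<close> and \<open>FF_XX\<close> are one commutation rule, for elements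
  of the algebra and for operators, so both sides satisfy the same recursion in
  \<open>w\<close>.\<close>

lemma pi_F_ell: "pi (fgen (F j) * ell a) = pi (ell (FF 1 j a))"
proof (rule pi_plin_eqI[where a = a and f = "\<lambda>a. fgen (F j) * ell a"], goal_cases)
  case (3 x)
  have "pi (fgen (F j) * ell (bv (w, l, v))) = pi (ell (FF 1 j (bv (w, l, v))))" for w l v
  proof (induction w rule: fmon_induct)
    case 0
    have "pi (pm_scale (chi l (alpha j)) (kk l * fgen (F j)))
        = pi (pm_scale (chi l (alpha j)) (pm_scale (inverse (chi l (alpha j))) (fgen (F j) * kk l)))"
      by (intro pi_scale_cong pi_kk_F)
    then have "pi ((fgen (F j) * kk l) * bv (map_fmon F v)) = pi (pm_scale (chi l (alpha j)) (kk l * fgen (F j)) * bv (map_fmon F v))"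
      by (intro pi_mult_cong) simp_all
    then show ?case
      by (simp add: ell_bv FF_bv mult.assoc pm_scale_mult_left fgen_bv bv_mult)
  next
    case (Cons i w)
    let ?b = "bv (w, l, v)"
    let ?q = "inverse (chi (alpha i) (alpha j))"
    have "pi (fgen (F j) * ell (bv (FMon [i] + w, l, v))) = pi ((fgen (F j) * xgen i) * ell ?b)"
      by (simp add: ell_bv mult.assoc)
    also have "\<dots> = pi ((pm_scale ?q (xgen i * fgen (F j)) - (if i = j then 1 - kk (minus_twice j) else 0)) * ell ?b)"
      by (intro pi_mult_cong pi_F_xgen refl)
    also have "\<dots> = pi (pm_scale ?q (xgen i * (fgen (F j) * ell ?b))
        - (if i = j then ell ?b - kk (minus_twice j) * ell ?b else 0))"
      by (simp add: algebra_simps pm_scale_mult_left)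
    also have "\<dots> = pi (pm_scale ?q (xgen i * ell (FF 1 j ?b))
        - (if i = j then ell ?b - ell (KK (minus_twice j) ?b) else 0))"
    proof (intro pi_diff_cong pi_scale_cong pi_mult_cong Cons refl)
      show "pi (if i = j then ell ?b - kk (minus_twice j) * ell ?b else 0)
          = pi (if i = j then ell ?b - ell (KK (minus_twice j) ?b) else 0)"
        using pi_diff_cong[OF refl pi_kk_ell] by simp
    qed
    also have "\<dots> = pi (ell (FF 1 j (XX i ?b)))"
      unfolding FF_XX by (simp add: ell_XX)
    finally show ?case by simp
  qed
  then show ?case by (cases x) simp
qed auto

lemma pi_E_ell: "pi (fgen (E i) * ell a) = pi (ell (EE i a))"
proof -
  have "pi (fgen (E i)) = pi (xgen i * kk (alpha i))"
  proof -
    have "pi (xgen i * kk (alpha i)) = pi (fgen (E i) * (fgen (Kinv i) * kk (alpha i)))"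
      by (simp add: xgen_def mult.assoc)
    also have "\<dots> = pi (fgen (E i) * (fgen (Kinv i) * fgen (K i)))"
      by (intro pi_mult_cong pi_kk_K refl)
    also have "\<dots> = pi (fgen (E i) * 1)"
      by (intro pi_mult_cong pi_Kinv_K refl)
    finally show ?thesis by simp
  qed
  then have "pi (fgen (E i) * ell a) = pi ((xgen i * kk (alpha i)) * ell a)"
    by (intro pi_mult_cong refl)
  also have "\<dots> = pi (xgen i * ell (KK (alpha i) a))"
    unfolding mult.assoc by (intro pi_mult_cong pi_kk_ell refl)
  finally show ?thesis by (simp add: EE_def ell_XX)
qed

lemma pi_EW_ell: "pi (bv (map_fmon E u) * ell a) = pi (ell (EW u a))"
proof (induction u rule: fmon_induct)
  case (Cons i u)
  have "pi (bv (map_fmon E (FMon [i] + u)) * ell a) = pi (fgen (E i) * (bv (map_fmon E u) * ell a))"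
    by (simp add: fgen_bv bv_mult mult.assoc[symmetric])
  also have "\<dots> = pi (fgen (E i) * ell (EW u a))" by (intro pi_mult_cong Cons refl)
  also have "\<dots> = pi (ell (EE i (EW u a)))" by (rule pi_E_ell)
  finally show ?case by simp
qed simp

lemma pi_relabel_E_ell: "pi (relabel E f * ell a) = pi (ell (lext (\<lambda>u. EW u a) f))"
  by (rule pi_plin_eqI[where a = f and f = "\<lambda>f. relabel E f * ell a"]) (auto simp: pi_EW_ell)

text \<open>Relations in the third factor vanish directly. One in the first factor is written in the
  \<open>X_i\<close>, whereas the defining relation is in the \<open>E_i\<close>; on homogeneous
  elements they differ by the invertible scalar \<open>escal d\<close>.\<close>

lemma pi_ell_N:
  assumes "a \<in> N"
  shows "pi (ell a) = pi 0"
proof -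
  have Q: "pm.subspace {a. pi (ell a) = pi 0}" by (rule subspace_pi_zero) simp
  have "a \<in> {a. pi (ell a) = pi 0}"
  proof (rule N_closed[OF plin_ident Q assms], unfold mem_Collect_eq)
    fix l v f assume f: "f \<in> \<I>"
    have "wpart l v f \<in> {a. pi (ell a) = pi 0}"
    proof (rule homogeneous_I[OF plin_wpart Q f])
      fix f d assume f: "f \<in> \<I>" and d: "\<And>w. w \<in> Poly_Mapping.keys f \<Longrightarrow> word_deg w = d"
      show "wpart l v f \<in> {a. pi (ell a) = pi 0}"
      \<comment> \<open>For \<open>f = 0\<close> the degree \<open>d\<close> is arbitrary, and
        \<open>escal d\<close> may be an unspecified value.\<close>
      proof (cases "f = 0")
        case False
        then obtain w where "w \<in> Poly_Mapping.keys f" using keys_eq_empty by blast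
        then have nz: "escal d \<noteq> 0" using d escal_nz by blast
        \<comment> \<open>The shift by \<open>d\<close> is undone by the factor \<open>K_d\<close>
          contained in words of degree \<open>d\<close> in the \<open>E_i\<close>.\<close>
        let ?b = "bv (0, l - d, v)"
        have "lext (\<lambda>u. EW u ?b) f = pm_scale (escal d) (wpart l v f)"
          by (rule plin_eqI[where a = f and f = "lext (\<lambda>u. EW u ?b)"]) (simp_all add: EW_bv d)
        then have "pi (pm_scale (escal d) (ell (wpart l v f))) = pi (relabel E f * ell ?b)"
          by (simp add: pi_relabel_E_ell)
        also have "\<dots> = pi (0 * ell ?b)" by (intro pi_mult_cong pi_I f refl)
        finally have "pi (pm_scale (escal d) (ell (wpart l v f))) = pi 0" by simp
        from pi_scale_cong[OF this, of "inverse (escal d)"] nz show ?thesis by simp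
      qed simp
    qed
    then show "pi (ell (wpart l v f)) = pi 0" by simp
  next
    fix w l g assume g: "g \<in> \<I>"
    have "ell (vpart w l g) = xword w * (kk l * relabel F g)"
      by (rule plin_eqI[where a = g and f = "\<lambda>g. ell (vpart w l g)"]) (simp_all add: ell_bv)
    moreover have "pi (xword w * (kk l * relabel F g)) = pi (xword w * (kk l * 0))"
      by (intro pi_mult_cong pi_I g refl)
    ultimately show "pi (ell (vpart w l g)) = pi 0" by simp
  qed
  then show ?thesis by simp
qed

lemma wact_kmon: "set u \<subseteq> kgens \<Longrightarrow> wact (FMon u) a = KK (kdegs u) a"
proof (induction u)
  case (Cons x u)
  then show ?case using wact_add[of "FMon [x]" "FMon u" a] by (auto simp: KK_KK kgens_def)
qed simp

lemma rho_kk: "rho (kk l) a = KK l a"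
  using wact_kmon klist by (simp add: kk_def)

lemma rho_xgen: "rho (xgen i) a = XX i a"
  by (simp add: xgen_def EE_def KK_KK)

lemma rho_ell: "rho (ell a) (bv (0, 0, 0)) = a"
proof (rule plin_eqI[where a = a and f = "\<lambda>a. rho (ell a) (bv (0, 0, 0))"], goal_cases)
  case (3 x)
  have "rho (xword w) (bv (0, l, v)) = bv (w, l, v)" for w l v
    by (induction w rule: fmon_induct) (simp_all add: rho_xgen)
  then show ?case by (cases x) (simp add: ell_bv rho_kk wact_F FW_highest)
qed (simp_all add: plin_comp[OF plin_rho1])

lemma pi_ell_eq_iff: "pi (ell a) = pi (ell b) \<longleftrightarrow> a - b \<in> N"
proof
  assume "pi (ell a) = pi (ell b)"
  from rho_pi[OF this, of "bv (0, 0, 0)"] show "a - b \<in> N" by (simp add: rho_ell)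
next
  assume "a - b \<in> N"
  from pi_add_cong[OF pi_ell_N[OF this] refl, of "ell b"] show "pi (ell a) = pi (ell b)" by simp
qed

end

section \<open>The Heisenberg double\<close>

definition supp_space :: "('b \<Rightarrow> bool) \<Rightarrow> ('b \<Rightarrow>\<^sub>0 'k::field) set" where
  "supp_space Q = {a. \<forall>x\<in>Poly_Mapping.keys a. Q x}"

lemma subspace_supp_space [simp]: "pm.subspace (supp_space Q)"
  by (auto simp: pm.subspace_def supp_space_def in_keys_iff lookup_add)

lemmas supp_space_add = pm.subspace_add[OF subspace_supp_space]
  and supp_space_diff = pm.subspace_diff[OF subspace_supp_space]
  and supp_space_scale = pm.subspace_scale[OF subspace_supp_space]
  and supp_space_0 [simp] = pm.subspace_0[OF subspace_supp_space]

lemma bv_supp_space [simp]: "bv x \<in> supp_space Q \<longleftrightarrow> Q x"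
  by (simp add: supp_space_def)

lemma supp_space_mono: "a \<in> supp_space Q \<Longrightarrow> (\<And>x. Q x \<Longrightarrow> R x) \<Longrightarrow> a \<in> supp_space R"
  by (auto simp: supp_space_def)

lemma supp_spaceD: "a \<in> supp_space Q \<Longrightarrow> x \<in> Poly_Mapping.keys a \<Longrightarrow> Q x"
  by (auto simp: supp_space_def)

lemma plin_in_subspace:
  assumes "plin \<Phi>" "pm.subspace S" "a \<in> supp_space Q" "\<And>x. Q x \<Longrightarrow> \<Phi> (bv x) \<in> S"
  shows "\<Phi> a \<in> S"
  by (subst plin_eq_lext[OF assms(1)],
      rule lext_in_subspace) (use assms in \<open>auto dest: supp_spaceD\<close>)

lemma wpart_supp_space: "(\<And>w. w \<in> Poly_Mapping.keys f \<Longrightarrow> Q (w, l, v)) \<Longrightarrow> wpart l v f \<in> supp_space Q"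
  unfolding wpart_def by (rule lext_in_subspace) auto

definition height :: "int ^ 'i::finite \<Rightarrow> int" where
  "height l = (\<Sum>i\<in>UNIV. l $ i)"

lemma height_simps [simp]: "height (a + b) = height a + height b" "height (a - b) = height a - height b"
  "height (- a) = - height a" "height 0 = 0" "height (alpha i) = 1"
  by (simp_all add: height_def sum.distrib sum_subtractf sum_negf axis_def)

definition lrestrict :: "(int ^ 'i \<Rightarrow> bool) \<Rightarrow> ('i::finite pbw \<Rightarrow>\<^sub>0 'k::field) \<Rightarrow> ('i pbw \<Rightarrow>\<^sub>0 'k)" where
  "lrestrict Q = lext (\<lambda>(w, l, v). if Q l then bv (w, l, v) else 0)"

lemma plin_lrestrict [simp, intro]: "plin (lrestrict Q)"
  by (simp add: lrestrict_def)

lemmas plin_lrestrict_comp [simp, intro] = plin_comp[OF plin_lrestrict]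

lemma lrestrict_bv: "lrestrict Q (bv (w, l, v)) = (if Q l then bv (w, l, v) else 0)"
  by (simp add: lrestrict_def)

lemma lrestrict_ident: "a \<in> supp_space (\<lambda>(w, l, v). Q l) \<Longrightarrow> lrestrict Q a = a"
  by (rule plin_eqI[where a = a and f = "lrestrict Q"]) (auto dest!: supp_spaceD simp: lrestrict_bv)

lemma lrestrict_zero: "a \<in> supp_space (\<lambda>(w, l, v). \<not> Q l) \<Longrightarrow> lrestrict Q a = 0"
proof -
  assume a: "a \<in> supp_space (\<lambda>(w, l, v). \<not> Q l)"
  have "lrestrict Q (bv x) = 0" if "x \<in> Poly_Mapping.keys a" for x
    using supp_spaceD[OF a that] by (cases x) (simp add: lrestrict_bv)
  then show ?thesis by (rule plin_eqI[OF plin_lrestrict plin_zero_fun])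
qed

lemma lrestrict_wpart: "lrestrict Q (wpart l v f) = (if Q l then wpart l v f else 0)"
  by (rule plin_eqI[where a = f and f = "\<lambda>f. lrestrict Q (wpart l v f)"]) (auto simp: lrestrict_bv)

lemma lrestrict_vpart: "lrestrict Q (vpart w l f) = (if Q l then vpart w l f else 0)"
  by (rule plin_eqI[where a = f and f = "\<lambda>f. lrestrict Q (vpart w l f)"]) (auto simp: lrestrict_bv)

definition SL :: "int \<Rightarrow> ('i::finite pbw \<Rightarrow>\<^sub>0 'k::field) set" where
  "SL m = supp_space (\<lambda>(w, l, v). height l \<le> m)"

lemma SL_subspace [simp]: "pm.subspace (SL m)"
  by (simp add: SL_def)

lemmas SL_add = pm.subspace_add[OF SL_subspace] and SL_diff = pm.subspace_diff[OF SL_subspace]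
  and SL_scale = pm.subspace_scale[OF SL_subspace]

context pre_nichols
begin

lemma lrestrict_N: "a \<in> N \<Longrightarrow> lrestrict Q a \<in> N"
  by (erule N_closed[OF plin_lrestrict subspace_N])
    (auto simp: lrestrict_wpart lrestrict_vpart wpart_N vpart_N)

lemma height_minus_twice: "height (minus_twice j) = - 2"
  unfolding minus_twice_def height_simps by simp

lemma XX_SL: "a \<in> SL m \<Longrightarrow> XX i a \<in> SL m"
  unfolding SL_def by (erule plin_in_subspace[rotated 2]) (auto simp: SL_def)

lemma KK_SL: "a \<in> SL m \<Longrightarrow> m + height n \<le> m' \<Longrightarrow> KK n a \<in> SL m'"
  unfolding SL_def by (erule plin_in_subspace[rotated 2]) (auto simp: SL_def intro!: supp_space_scale)

lemma FF_SL: "a \<in> SL m \<Longrightarrow> FF t j a \<in> SL m"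
proof -
  assume a: "a \<in> SL m"
  have "FF t j (bv (w, l, v)) \<in> SL m" if "height l \<le> m" for w l v
  proof -
    have "wpart l v f \<in> SL m" "bv (w, l, v') \<in> SL m" for f v'
      using that by (auto simp: SL_def intro!: wpart_supp_space)
    then show ?thesis
      unfolding FF_bv by (intro SL_add SL_diff SL_scale KK_SL[where m = m]) (simp_all add: height_minus_twice)
  qed
  with a show ?thesis unfolding SL_def by (auto elim!: plin_in_subspace[rotated 2])
qed

definition DD :: "'i \<Rightarrow> ('i pbw \<Rightarrow>\<^sub>0 'k) \<Rightarrow> ('i pbw \<Rightarrow>\<^sub>0 'k)" where
  "DD j = lext (\<lambda>(w, l, v). wpart l v (deriv j w))"

lemma plin_DD [simp, intro]: "plin (DD j)"
  by (simp add: DD_def)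

lemma DD_bv: "DD j (bv (w, l, v)) = wpart l v (deriv j w)"
  by (simp add: DD_def)

lemma FF_1_conv: "FF 1 j a = FF 0 j a + KK (minus_twice j) (DD j a)"
  by (rule plin_eqI[where a = a and f = "FF 1 j"]) (auto simp: FF_bv DD_bv)

end

locale nichols_involution = pre_nichols chi \<I>
  for chi :: "int ^ 'i::finite \<Rightarrow> int ^ 'i \<Rightarrow> 'k::field" and \<I> +
  fixes \<tau> :: "'i \<Rightarrow> 'i" and c :: "'i \<Rightarrow> 'k"
  assumes tau_tau [simp]: "\<tau> (\<tau> i) = i"
    and qmat_tau: "qmat chi (\<tau> i) (\<tau> j) = qmat chi i j"
    and relabel_tau_I: "relabel \<tau> ` \<I> = \<I>"
begin

section \<open>The exponents of \<open>H\<^sub>\<theta>\<close> and coordinates of the Heisenberg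
  double\<close>

text \<open>Steps of one sign suffice for a subgroup, since the step for \<open>\<tau> i\<close> is
  the negative of the step for \<open>i\<close>.\<close>

inductive_set Lth :: "(int ^ 'i) set" where
  zero [simp, intro]: "0 \<in> Lth"
| step: "l \<in> Lth \<Longrightarrow> l + (alpha i - alpha (\<tau> i)) \<in> Lth"

lemma Lth_gen: "alpha i - alpha (\<tau> i) \<in> Lth"
  using Lth.step[OF Lth.zero, of i] by simp

lemma Lth_add [simp, intro]:
  assumes "l \<in> Lth" "m \<in> Lth"
  shows "l + m \<in> Lth"
  using assms(2)
proof (induction m rule: Lth.induct)
  case (step m i)
  then show ?case using Lth.step[of "l + m" i] by (simp add: add.assoc)
qed (use assms in simp)

lemma height_Lth [simp]: "l \<in> Lth \<Longrightarrow> height l = 0"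
  by (induction l rule: Lth.induct) auto

lemma chi_tau: "chi (alpha (\<tau> i)) (alpha (\<tau> j)) = chi (alpha i) (alpha j)"
  using qmat_tau by (simp add: qmat_def)

text \<open>By \<open>\<tau>\<close>-invariance of \<open>q\<close> the factors cancel in pairs.
  Consequently \<open>F_j\<close> and \<open>E_{\<tau> j} K_j^-1\<close> acquire the same scalar on
  passing \<open>K_l\<close>, so \<open>B_j\<close> is a weight vector for
  \<open>H\<^sub>\<theta>\<close>.\<close>

lemma chi_Lth_tau: "l \<in> Lth \<Longrightarrow> chi l (alpha j) * chi l (alpha (\<tau> j)) = 1"
proof (induction l rule: Lth.induct)
  case (step l i)
  have "chi (alpha (\<tau> i)) (alpha j) = chi (alpha i) (alpha (\<tau> j))"
    using chi_tau[of i "\<tau> j"] by simp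
  then show ?case using step by (simp add: X_add_left X_diff_left chi_tau field_simps)
qed simp

text \<open>Modulo \<open>N\<close> these are the coordinates of the Heisenberg double.\<close>

definition V :: "('i pbw \<Rightarrow>\<^sub>0 'k) set" where
  "V = supp_space (\<lambda>(w, l, v). l \<in> Lth)"

text \<open>Modulo \<open>N\<close> these are the coordinates of
  \<open>H\<^sub>\<theta> \<ltimes> U\<^sup>-\<close> through \<open>ellt\<close> and of the coideal
  subalgebra through \<open>Lp\<close>.\<close>

definition A :: "('i pbw \<Rightarrow>\<^sub>0 'k) set" where
  "A = supp_space (\<lambda>(w, l, v). w = 0 \<and> l \<in> Lth)"

lemma V_subspace [simp]: "pm.subspace V" and A_subspace [simp]: "pm.subspace A"
  by (simp_all add: V_def A_def)

lemmas V_add [simp] = pm.subspace_add[OF V_subspace] and V_diff [simp] = pm.subspace_diff[OF V_subspace]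
  and V_scale [simp] = pm.subspace_scale[OF V_subspace] and V_0 [simp] = pm.subspace_0[OF V_subspace]
lemmas A_add [simp] = pm.subspace_add[OF A_subspace] and A_diff [simp] = pm.subspace_diff[OF A_subspace]
  and A_scale [simp] = pm.subspace_scale[OF A_subspace] and A_0 [simp] = pm.subspace_0[OF A_subspace]

lemma A_V: "a \<in> A \<Longrightarrow> a \<in> V"
  unfolding A_def V_def by (erule supp_space_mono) auto

lemma bv_V [simp]: "bv (w, l, v) \<in> V \<longleftrightarrow> l \<in> Lth" and bv_A [simp]: "bv (w, l, v) \<in> A \<longleftrightarrow> w = 0 \<and> l \<in> Lth"
  by (simp_all add: V_def A_def)

lemma V_induct:
  assumes "plin \<Phi>" "pm.subspace S" "a \<in> V" "\<And>w l v. l \<in> Lth \<Longrightarrow> \<Phi> (bv (w, l, v)) \<in> S"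
  shows "\<Phi> a \<in> S"
  using assms unfolding V_def by (auto elim!: plin_in_subspace[rotated 2])

lemma A_induct:
  assumes "plin \<Phi>" "pm.subspace S" "a \<in> A" "\<And>l v. l \<in> Lth \<Longrightarrow> \<Phi> (bv (0, l, v)) \<in> S"
  shows "\<Phi> a \<in> S"
  using assms unfolding A_def by (auto elim!: plin_in_subspace[rotated 2])

lemma wpart_V: "l \<in> Lth \<Longrightarrow> wpart l v f \<in> V" and vpart_V: "l \<in> Lth \<Longrightarrow> vpart w l f \<in> V"
  and vpart_A: "l \<in> Lth \<Longrightarrow> vpart 0 l f \<in> A"
  unfolding wpart_def vpart_def by (rule lext_in_subspace; simp)+

lemma XX_V: "a \<in> V \<Longrightarrow> XX i a \<in> V"
  by (rule V_induct[where \<Phi> = "XX i"]) auto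

lemma KK_V: "n \<in> Lth \<Longrightarrow> a \<in> V \<Longrightarrow> KK n a \<in> V"
  by (rule V_induct[where \<Phi> = "KK n"]) auto

lemma KK_A: "n \<in> Lth \<Longrightarrow> a \<in> A \<Longrightarrow> KK n a \<in> A"
  by (rule A_induct[where \<Phi> = "KK n"]) auto

lemma FF_V: "a \<in> V \<Longrightarrow> FF 0 j a \<in> V"
  by (rule V_induct[where \<Phi> = "FF 0 j"]) (auto simp: FF_bv wpart_V)

lemma FF_A: "a \<in> A \<Longrightarrow> FF 0 j a \<in> A"
  by (rule A_induct[where \<Phi> = "FF 0 j"]) (auto simp: FF_bv)

lemma DD_V: "a \<in> V \<Longrightarrow> DD j a \<in> V"
  by (rule V_induct[where \<Phi> = "DD j"]) (auto simp: DD_bv wpart_V)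

lemma DD_A: "a \<in> A \<Longrightarrow> DD j a = 0"
  using A_induct[of "DD j" "{0}" a] by (auto simp: DD_bv)

definition hgen :: "'i \<Rightarrow> ('i generator, 'k) free_alg" where
  "hgen i = fgen (K i) * fgen (Kinv (\<tau> i))"

lemma pi_hgen: "pi (hgen i) = pi (kk (alpha i - alpha (\<tau> i)))"
  using pi_kk[of "[K i, Kinv (\<tau> i)]" "alpha i - alpha (\<tau> i)"]
  by (simp add: kgens_def hgen_def fgen_bv bv_mult)

definition PH :: "('i generator, 'k) free_alg set" where
  "PH = subalg (range hgen)"

lemma kk_PH: "l \<in> Lth \<Longrightarrow> \<exists>f\<in>PH. pi f = pi (kk l)"
proof (induction l rule: Lth.induct)
  case zero
  show ?case using pi_kk_0 subalg.one unfolding PH_def by metis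
next
  case (step l i)
  then obtain f where f: "f \<in> PH" "pi f = pi (kk l)" by blast
  have "pi (f * hgen i) = pi (kk l * kk (alpha i - alpha (\<tau> i)))" by (intro pi_mult_cong f pi_hgen)
  also have "\<dots> = pi (kk (l + (alpha i - alpha (\<tau> i))))" by (rule pi_kk_add)
  finally show ?case using f unfolding PH_def by (meson rangeI subalg.gen subalg.mult)
qed

text \<open>
  The representative \<open>kk l\<close> of \<open>K\<^sub>l\<close> need not lie in \<open>PP\<close>, the domain of the presentation of the
  Heisenberg double, so another one is chosen for \<open>l \<in> Lth\<close> (and \<open>kkt l\<close> is junk otherwise).
\<close>

definition kkt :: "int ^ 'i \<Rightarrow> ('i generator, 'k) free_alg" where
  "kkt l = (SOME f. f \<in> PH \<and> pi f = pi (kk l))"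

lemma kkt: "l \<in> Lth \<Longrightarrow> kkt l \<in> PH \<and> pi (kkt l) = pi (kk l)"
  unfolding kkt_def by (rule someI_ex) (use kk_PH in blast)

definition ellt :: "('i pbw \<Rightarrow>\<^sub>0 'k) \<Rightarrow> ('i generator, 'k) free_alg" where
  "ellt = lext (\<lambda>(w, l, v). xword w * (kkt l * bv (map_fmon F v)))"

lemma plin_ellt [simp, intro]: "plin ellt"
  by (simp add: ellt_def)

lemmas plin_ellt_comp [simp, intro] = plin_comp[OF plin_ellt]
  and ellt_linear [simp] = plin_add[OF plin_ellt] plin_scale[OF plin_ellt] plin_0[OF plin_ellt] plin_diff[OF plin_ellt]

lemma ellt_bv: "ellt (bv (w, l, v)) = xword w * (kkt l * bv (map_fmon F v))"
  by (simp add: ellt_def)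

lemma pi_ellt: "a \<in> V \<Longrightarrow> pi (ellt a) = pi (ell a)"
proof (rule pi_plin_eqI[OF plin_ellt plin_ell])
  fix x assume "a \<in> V" "x \<in> Poly_Mapping.keys a"
  then obtain w l v where x: "x = (w, l, v)" "l \<in> Lth" by (cases x) (auto simp: V_def dest: supp_spaceD)
  show "pi (ellt (bv x)) = pi (ell (bv x))"
    unfolding x ellt_bv ell_bv by (intro pi_mult_cong refl conjunct2[OF kkt] x)
qed

lemma ellt_XX: "ellt (XX i a) = xgen i * ellt a"
  by (rule plin_eqI[where a = a and f = "\<lambda>a. ellt (XX i a)"]) (auto simp: ellt_bv mult.assoc)

definition PF :: "('i generator, 'k) free_alg set" where
  "PF = subalg (range (\<lambda>i. fgen (F i)))"

definition PX :: "('i generator, 'k) free_alg set" where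
  "PX = subalg (range xgen)"

definition PP :: "('i generator, 'k) free_alg set" where
  "PP = subalg (range (\<lambda>i. fgen (F i)) \<union> range xgen \<union> range (\<lambda>i. fgen (Kinv i)) \<union> range hgen)"

lemma PP_gen [simp, intro]: "fgen (F i) \<in> PP" "xgen i \<in> PP" "fgen (Kinv i) \<in> PP" "hgen i \<in> PP"
  unfolding PP_def by (auto intro: subalg.gen)

lemma PH_PP: "PH \<subseteq> PP" and PF_PP: "PF \<subseteq> PP" and PX_PP: "PX \<subseteq> PP"
  unfolding PH_def PF_def PX_def PP_def by (rule subalg_mono; auto intro: subalg.gen)+

lemma PP_subspace: "pm.subspace PP"
  by (simp add: PP_def pm_subspace_subalg)

lemma PP_mult [intro]: "f \<in> PP \<Longrightarrow> g \<in> PP \<Longrightarrow> f * g \<in> PP"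
  unfolding PP_def by (rule subalg.mult)

lemma word_subalg: "(\<And>i. fgen (g i) \<in> subalg G) \<Longrightarrow> bv (map_fmon g v) \<in> subalg G"
proof (induction v rule: fmon_induct)
  case (Cons i v)
  then show ?case using subalg.mult[of "fgen (g i)" G "bv (map_fmon g v)"] by (simp add: fgen_bv bv_mult)
qed (simp add: subalg.one)

lemma Fword_PF: "bv (map_fmon F v) \<in> PF"
  unfolding PF_def by (rule word_subalg) (auto intro: subalg.gen)

lemma xword_PX: "xword w \<in> PX"
  unfolding PX_def by (induction w rule: fmon_induct) (auto intro: subalg.intros)

lemma ellt_PP: "a \<in> V \<Longrightarrow> ellt a \<in> PP"
  by (rule V_induct[OF plin_ellt PP_subspace])
    (use kkt Fword_PF xword_PX PH_PP PF_PP PX_PP in \<open>auto simp: ellt_bv intro!: PP_mult\<close>)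

lemma U_mult: "x \<otimes>\<^bsub>U_alg chi \<I>\<^esub> y = pi (f * g)" if "x = pi f" "y = pi g"
  using that by (simp add: U.p_mult)

lemma EKinv_eq: "EKinv chi \<I> i = pi (xgen i)"
  unfolding EKinv_def xgen_def by (rule U_mult) (rule U_gen_eq)+

lemma Ktheta_eq: "Ktheta chi \<I> \<tau> i = pi (hgen i)"
  unfolding Ktheta_def hgen_def by (rule U_mult) (rule U_gen_eq)+

lemma Upoly_gens: "range (\<lambda>i. U_gen chi \<I> (F i)) \<union> range (EKinv chi \<I>) \<union>
    range (\<lambda>i. U_gen chi \<I> (Kinv i)) \<union> range (Ktheta chi \<I> \<tau>)
  = pi ` (range (\<lambda>i. fgen (F i)) \<union> range xgen \<union> range (\<lambda>i. fgen (Kinv i)) \<union> range hgen)"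
  by (auto simp: U_gen_eq EKinv_eq Ktheta_eq)

sublocale Up: presented_algebra "Upoly chi \<I> \<tau>" PP pi
  unfolding Upoly_def Upoly_gens PP_def U.gen_subalg_image[OF subset_UNIV]
  by (rule U.presented_restrict) simp

definition Pi :: "('i generator, 'k) free_alg \<Rightarrow> ('i, 'k) U_elt set" where
  "Pi f = Heis_ideal chi \<I> \<tau> +>\<^bsub>Upoly chi \<I> \<tau>\<^esub> pi f"

lemma Heis_ideal_eq: "Heis_ideal chi \<I> \<tau> = Idl\<^bsub>Upoly chi \<I> \<tau>\<^esub> (pi ` range (\<lambda>i. fgen (Kinv i)))"
  by (simp add: Heis_ideal_def image_image U_gen_eq)

lemma ideal_Heis_ideal: "ideal (Heis_ideal chi \<I> \<tau>) (Upoly chi \<I> \<tau>)"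
  unfolding Heis_ideal_eq by (rule Up.genideal_ideal) auto

lemma kappa_pi: "kappa chi \<I> \<tau> (pi f) = Pi f"
  by (simp add: kappa_def Pi_def)

abbreviation "\<H> \<equiv> Heis chi \<I> \<tau>"

sublocale He: presented_algebra "\<H>" PP Pi
  unfolding Heis_def Pi_def[abs_def] by (rule Up.presented_quot[OF ideal_Heis_ideal])

lemma Pi_cong: "pi f = pi g \<Longrightarrow> Pi f = Pi g"
  by (simp add: Pi_def)

lemma Pi_Kinv: "Pi (fgen (Kinv i)) = Pi 0"
proof -
  have "pi ` range (\<lambda>i. fgen (Kinv i)) \<subseteq> Heis_ideal chi \<I> \<tau>"
    unfolding Heis_ideal_eq by (rule Up.genideal_self) auto
  then show ?thesis
    using Up.quot_eq_iff[OF ideal_Heis_ideal, of "fgen (Kinv i)" 0] by (auto simp: Pi_def)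
qed

lemma rho_PP_SL: "f \<in> PP \<Longrightarrow> a \<in> SL m \<Longrightarrow> rho f a \<in> SL m"
  unfolding PP_def
proof (induction arbitrary: a rule: subalg.induct)
  case (gen g)
  have "KK n a \<in> SL m" if "height n \<le> 0" for n
    using KK_SL[OF gen(2), of n m] that by simp
  with gen show ?case
    by (auto simp: hgen_def rho_xgen KK_KK intro!: FF_SL XX_SL)
qed (auto intro: SL_add SL_scale)

text \<open>The generators \<open>K_i^-1\<close> of the ideal lower the height. The property
  survives multiplication on both sides because all of \<open>PP\<close> preserves
  \<open>SL 0\<close>, \<open>SL (- 1)\<close> and \<open>N\<close>.\<close>

lemma Pi_zero_imp:
  assumes "f \<in> PP" "Pi f = Pi 0" "a \<in> SL 0"
  shows "\<exists>b\<in>SL (- 1). rho f a - b \<in> N"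
proof -
  let ?Q = "\<lambda>f. \<forall>a\<in>SL 0. \<exists>b\<in>SL (- 1). rho f a - b \<in> N"
  have "?Q f"
  proof (rule Up.Idl_induct[of f "pi ` range (\<lambda>i. fgen (Kinv i))"])
    show "pi f \<in> Idl\<^bsub>Upoly chi \<I> \<tau>\<^esub> (pi ` range (\<lambda>i. fgen (Kinv i)))"
      using assms Up.quot_eq_iff[OF ideal_Heis_ideal, of f 0] by (simp add: Pi_def Heis_ideal_eq)
  next
    fix f g assume fg: "pi f = pi g" and f: "?Q f"
    show "?Q g"
    proof
      fix a :: "'i pbw \<Rightarrow>\<^sub>0 'k" assume "a \<in> SL 0"
      with f obtain b where b: "b \<in> SL (- 1)" "rho f a - b \<in> N" by blast
      from N_diff[OF b(2) rho_pi[OF fg, of a]] have "rho g a - b \<in> N" by simp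
      with b show "\<exists>b\<in>SL (- 1). rho g a - b \<in> N" by blast
    qed
  next
    show "?Q 0" by (auto intro!: bexI[of _ 0] pm.subspace_0)
  next
    fix f g assume f: "?Q f" and g: "?Q g"
    show "?Q (f + g)"
    proof
      fix a :: "'i pbw \<Rightarrow>\<^sub>0 'k" assume "a \<in> SL 0"
      with f g obtain b b' where b: "b \<in> SL (- 1)" "rho f a - b \<in> N" "b' \<in> SL (- 1)" "rho g a - b' \<in> N"
        by meson
      from N_add[OF b(2,4)] have "rho (f + g) a - (b + b') \<in> N" by (simp add: algebra_simps)
      with b SL_add show "\<exists>b\<in>SL (- 1). rho (f + g) a - b \<in> N" by blast
    qed
  next
    fix f g assume g: "g \<in> PP" and f: "?Q f"
    show "?Q (g * f)"
    proof
      fix a :: "'i pbw \<Rightarrow>\<^sub>0 'k" assume "a \<in> SL 0"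
      with f obtain b where b: "b \<in> SL (- 1)" "rho f a - b \<in> N" by blast
      from rho_N[OF b(2), of g] have "rho (g * f) a - rho g b \<in> N" by simp
      with rho_PP_SL[OF g b(1)] show "\<exists>b\<in>SL (- 1). rho (g * f) a - b \<in> N" by blast
    qed
    show "?Q (f * g)" using f rho_PP_SL[OF g] by simp
  next
    fix s assume "s \<in> pi ` range (\<lambda>i. fgen (Kinv i))"
    then obtain i where s: "s = pi (fgen (Kinv i))" by auto
    have "KK (- alpha i) a \<in> SL (- 1)" if "a \<in> SL 0" for a :: "'i pbw \<Rightarrow>\<^sub>0 'k"
      by (rule KK_SL[OF that]) simp
    then have "?Q (fgen (Kinv i))" by (auto intro!: bexI[of _ "KK (- alpha i) _"])
    then show "\<exists>f\<in>PP. pi f = s \<and> ?Q f" using s by blast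
  qed (use assms in auto)
  with assms show ?thesis by blast
qed

lemma Pi_ellt_zero: "a \<in> N \<Longrightarrow> a \<in> V \<Longrightarrow> Pi (ellt a) = Pi 0"
  by (intro Pi_cong) (simp add: pi_ellt pi_ell_N)

lemma Pi_ellt_zero_imp:
  assumes a: "a \<in> V" and "Pi (ellt a) = Pi 0"
  shows "a \<in> N"
proof -
  have "bv (0, 0, 0) \<in> SL 0" by (simp add: SL_def)
  from Pi_zero_imp[OF ellt_PP[OF a] assms(2) this]
  obtain b where b: "b \<in> SL (- 1)" "rho (ellt a) (bv (0, 0, 0)) - b \<in> N" by blast
  from rho_pi[OF pi_ellt[OF a], of "bv (0, 0, 0)"] have "rho (ellt a) (bv (0, 0, 0)) - a \<in> N"
    by (simp add: rho_ell)
  from N_diff[OF b(2) this] have "a - b \<in> N" by simp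
  \<comment> \<open>Elements of \<open>V\<close> live in height 0 and \<open>b\<close> in negative
    height, so projecting to height 0 keeps \<open>a\<close> and removes \<open>b\<close>.\<close>
  from lrestrict_N[OF this, of "\<lambda>l. height l = 0"]
  have "lrestrict (\<lambda>l. height l = 0) a - lrestrict (\<lambda>l. height l = 0) b \<in> N"
    by (simp add: plin_diff[OF plin_lrestrict])
  moreover have "lrestrict (\<lambda>l. height l = 0) a = a"
    using a unfolding V_def by (intro lrestrict_ident) (auto elim!: supp_space_mono)
  moreover have "lrestrict (\<lambda>l. height l = 0) b = 0"
    using b(1) unfolding SL_def by (intro lrestrict_zero) (auto elim!: supp_space_mono)
  ultimately show ?thesis by simp
qed

lemma Pi_ellt_eq_iff: "a \<in> V \<Longrightarrow> b \<in> V \<Longrightarrow> Pi (ellt a) = Pi (ellt b) \<longleftrightarrow> a - b \<in> N"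
  using He.p_eq_iff[of "ellt a" "ellt b"] Pi_ellt_zero_imp[of "a - b"] Pi_ellt_zero[of "a - b"]
  by (auto simp: ellt_PP He.p_zero)

lemma pi_ellt_eq_iff: "a \<in> V \<Longrightarrow> b \<in> V \<Longrightarrow> pi (ellt a) = pi (ellt b) \<longleftrightarrow> a - b \<in> N"
  by (simp add: pi_ellt pi_ell_eq_iff)

lemma pi_kkt_ellt:
  assumes "n \<in> Lth" "a \<in> V"
  shows "pi (kkt n * ellt a) = pi (ellt (KK n a))"
proof -
  have "pi (kkt n * ellt a) = pi (kk n * ell a)"
    using assms kkt pi_ellt by (intro pi_mult_cong) auto
  then show ?thesis using assms by (simp add: pi_kk_ell pi_ellt KK_V)
qed

lemma pi_hgen_ellt: "a \<in> V \<Longrightarrow> pi (hgen i * ellt a) = pi (ellt (KK (alpha i - alpha (\<tau> i)) a))"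
  using pi_mult_cong[OF pi_hgen pi_ellt, of a i] by (simp add: pi_kk_ell pi_ellt KK_V Lth_gen)

text \<open>The term with \<open>K_j^-2\<close> is written as a product of generators
  \<open>K_j^-1\<close> with an element of \<open>PP\<close>, so that it visibly lies in the ideal
  defining the Heisenberg double.\<close>

lemma pi_F_ellt_aux: "a \<in> V \<Longrightarrow> pi (fgen (F j) * ellt a)
    = pi (ellt (FF 0 j a) + fgen (Kinv j) * (fgen (Kinv j) * ellt (DD j a)))"
proof -
  assume a: "a \<in> V"
  have "pi (kk (minus_twice j)) = pi (fgen (Kinv j) * fgen (Kinv j))"
    using pi_kk[of "[Kinv j, Kinv j]" "minus_twice j"] by (simp add: kgens_def minus_twice_def fgen_bv bv_mult)
  then have "pi (kk (minus_twice j) * ell (DD j a)) = pi ((fgen (Kinv j) * fgen (Kinv j)) * ellt (DD j a))"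
    using a by (intro pi_mult_cong) (simp_all add: pi_ellt DD_V)
  then have k: "pi (ell (KK (minus_twice j) (DD j a))) = pi (fgen (Kinv j) * (fgen (Kinv j) * ellt (DD j a)))"
    by (simp add: pi_kk_ell mult.assoc)
  have "pi (fgen (F j) * ellt a) = pi (fgen (F j) * ell a)"
    by (intro pi_mult_cong pi_ellt a refl)
  also have "\<dots> = pi (ell (FF 0 j a) + ell (KK (minus_twice j) (DD j a)))"
    by (simp add: pi_F_ell FF_1_conv)
  also have "\<dots> = pi (ellt (FF 0 j a) + fgen (Kinv j) * (fgen (Kinv j) * ellt (DD j a)))"
    using a by (intro pi_add_cong k) (simp add: pi_ellt FF_V)
  finally show ?thesis .
qed

lemma pi_F_ellt: "a \<in> A \<Longrightarrow> pi (fgen (F j) * ellt a) = pi (ellt (FF 0 j a))"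
  using pi_F_ellt_aux[of a j] by (simp add: A_V DD_A)

lemma Pi_Kinv_mult: "f \<in> PP \<Longrightarrow> Pi (fgen (Kinv i) * f) = Pi 0"
  using He.p_mult_cong[of "fgen (Kinv i)" f 0 f] Pi_Kinv by auto

lemma Pi_F_ellt: "a \<in> V \<Longrightarrow> Pi (fgen (F j) * ellt a) = Pi (ellt (FF 0 j a))"
proof -
  assume a: "a \<in> V"
  have "Pi (fgen (F j) * ellt a) = Pi (ellt (FF 0 j a) + fgen (Kinv j) * (fgen (Kinv j) * ellt (DD j a)))"
    by (rule Pi_cong[OF pi_F_ellt_aux[OF a]])
  also have "\<dots> = Pi (ellt (FF 0 j a) + 0)"
    using a by (intro He.p_add_cong Pi_Kinv_mult refl) (auto simp: ellt_PP FF_V DD_V)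
  finally show ?thesis by simp
qed

text \<open>Gives the spanning half of the decomposition: the image of \<open>V\<close> contains the
  unit and is stable under left multiplication by generators.\<close>

lemma Pi_PP_ellt: "f \<in> PP \<Longrightarrow> a \<in> V \<Longrightarrow> \<exists>b\<in>V. Pi (f * ellt a) = Pi (ellt b)"
  unfolding PP_def
proof (induction arbitrary: a rule: subalg.induct)
  case (gen g)
  then consider i where "g = fgen (F i)" | i where "g = xgen i" | i where "g = fgen (Kinv i)" | i where "g = hgen i"
    by blast
  then show ?case
  proof cases
    case 1 then show ?thesis using Pi_F_ellt gen FF_V by blast
  next
    case 2 then show ?thesis using ellt_XX gen XX_V by metis
  next
    case 3 then show ?thesis using Pi_Kinv_mult[OF ellt_PP] gen by (intro bexI[of _ 0]) auto
  next
    case 4 then show ?thesis using Pi_cong[OF pi_hgen_ellt] gen KK_V Lth_gen by blast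
  qed
next
  case (add f g)
  then obtain b b' where "b \<in> V" "Pi (f * ellt a) = Pi (ellt b)" "b' \<in> V" "Pi (g * ellt a) = Pi (ellt b')" by meson
  with add.hyps add.prems have "Pi ((f + g) * ellt a) = Pi (ellt (b + b'))"
    unfolding distrib_right ellt_linear
    by (intro He.p_add_cong) (auto simp: PP_def[symmetric] ellt_PP intro: PP_mult)
  then show ?case using \<open>b \<in> V\<close> \<open>b' \<in> V\<close> by (intro bexI[of _ "b + b'"]) auto
next
  case (mult f g)
  then obtain b where b: "b \<in> V" "Pi (g * ellt a) = Pi (ellt b)" by meson
  with mult obtain b' where b': "b' \<in> V" "Pi (f * ellt b) = Pi (ellt b')" by meson
  have "Pi (f * (g * ellt a)) = Pi (f * ellt b)"
    using mult.hyps mult.prems b by (intro He.p_mult_cong) (auto simp: PP_def[symmetric] ellt_PP intro: PP_mult)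
  with b' show ?case by (auto simp: mult.assoc)
next
  case (scale f d)
  then obtain b where b: "b \<in> V" "Pi (f * ellt a) = Pi (ellt b)" by meson
  then have "Pi (pm_scale d f * ellt a) = Pi (ellt (pm_scale d b))"
    unfolding pm_scale_mult_left ellt_linear using scale
    by (intro He.p_scale_cong) (auto simp: PP_def[symmetric] ellt_PP intro: PP_mult)
  with b show ?case by (intro bexI[of _ "pm_scale d b"]) auto
qed auto

lemma pi_ellt_unit: "pi (ellt (bv (0, 0, 0))) = pi 1"
  using kkt[of 0] pi_kk_0 by (simp add: ellt_bv)

lemma Heis_carrier: "carrier (\<H>) = (\<lambda>a. Pi (ellt a)) ` V"
proof -
  have "\<exists>b\<in>V. Pi f = Pi (ellt b)" if "f \<in> PP" for f
  proof -
    have "Pi f = Pi (f * ellt (bv (0, 0, 0)))"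
      using Pi_cong[OF pi_mult_cong[OF refl pi_ellt_unit, of f]] by simp
    then show ?thesis using Pi_PP_ellt[OF that, of "bv (0, 0, 0)"] by auto
  qed
  then show ?thesis unfolding He.carrier_eq using ellt_PP by fastforce
qed

end

section \<open>The unitriangular map \<open>Theta\<close>\<close>

definition XW :: "'i fmon \<Rightarrow> ('i::finite pbw \<Rightarrow>\<^sub>0 'k::field) \<Rightarrow> ('i pbw \<Rightarrow>\<^sub>0 'k)" where
  "XW u a = foldr XX (letters u) a"

lemma XW_0 [simp]: "XW 0 a = a" and XW_Cons [simp]: "XW (FMon [j] + u) a = XX j (XW u a)"
  by (simp_all add: XW_def)

lemma plin_XW [simp, intro]: "plin (XW u)"
  by (induction u rule: fmon_induct) (simp_all add: XW_def[abs_def])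

lemmas plin_XW_comp [simp, intro] = plin_comp[OF plin_XW]
  and XW_linear [simp] = plin_add[OF plin_XW] plin_scale[OF plin_XW] plin_0[OF plin_XW] plin_diff[OF plin_XW]

lemma XW_bv [simp]: "XW u (bv (w, l, v)) = bv (u + w, l, v)"
  by (induction u rule: fmon_induct) (simp_all add: add.assoc)

section \<open>Filtration by the length of the third factor\<close>

text \<open>The strict inequality makes \<open>VL 0\<close> the zero space, so inductions start
  there and \<open>VL (Suc n)\<close> is the part of filtration degree \<open>n\<close>.\<close>

definition VL :: "nat \<Rightarrow> ('i::finite pbw \<Rightarrow>\<^sub>0 'k::field) set" where
  "VL n = supp_space (\<lambda>(w, l, v). length (letters v) < n)"

lemma VL_subspace [simp]: "pm.subspace (VL n)"
  by (simp add: VL_def)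

lemmas VL_add = pm.subspace_add[OF VL_subspace] and VL_diff = pm.subspace_diff[OF VL_subspace]
  and VL_scale = pm.subspace_scale[OF VL_subspace] and VL_zero [simp] = pm.subspace_0[OF VL_subspace]

lemma bv_VL [simp]: "bv (w, l, v) \<in> VL n \<longleftrightarrow> length (letters v) < n"
  by (simp add: VL_def)

lemma VL_mono: "a \<in> VL m \<Longrightarrow> m \<le> n \<Longrightarrow> a \<in> VL n"
  unfolding VL_def by (erule supp_space_mono) auto

lemma VL_0_iff [simp]: "a \<in> VL 0 \<longleftrightarrow> a = 0"
  unfolding keys_eq_empty[symmetric] by (auto simp: VL_def supp_space_def simp del: keys_eq_empty)

lemma VL_exists: "\<exists>n. a \<in> VL n"
proof -
  let ?L = "(\<lambda>(w, l, v). length (letters v)) ` Poly_Mapping.keys a"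
  have "(\<lambda>(w, l, v). length (letters v)) x \<le> Max ?L" if "x \<in> Poly_Mapping.keys a" for x
    by (intro Max_ge imageI that) auto
  then have "a \<in> VL (Suc (Max ?L))" by (force simp: VL_def supp_space_def less_Suc_eq_le)
  then show ?thesis by blast
qed

lemma VL_induct:
  assumes "plin \<Phi>" "pm.subspace S" "a \<in> VL n" "\<And>w l v. length (letters v) < n \<Longrightarrow> \<Phi> (bv (w, l, v)) \<in> S"
  shows "\<Phi> a \<in> S"
  using assms unfolding VL_def by (auto elim!: plin_in_subspace[rotated 2])

definition vtop :: "nat \<Rightarrow> ('i::finite pbw \<Rightarrow>\<^sub>0 'k::field) \<Rightarrow> ('i pbw \<Rightarrow>\<^sub>0 'k)" where
  "vtop n = lext (\<lambda>(w, l, v). if length (letters v) = n then bv (w, l, v) else 0)"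

lemma plin_vtop [simp, intro]: "plin (vtop n)"
  by (simp add: vtop_def)

lemmas plin_vtop_comp [simp, intro] = plin_comp[OF plin_vtop]
  and vtop_linear [simp] = plin_add[OF plin_vtop] plin_scale[OF plin_vtop] plin_0[OF plin_vtop] plin_diff[OF plin_vtop]

lemma vtop_bv: "vtop n (bv (w, l, v)) = (if length (letters v) = n then bv (w, l, v) else 0)"
  by (simp add: vtop_def)

lemma vtop_VL_zero: "a \<in> VL n \<Longrightarrow> vtop n a = 0"
  using VL_induct[of "vtop n" "{0}" a n] by (auto simp: vtop_bv)

lemma diff_vtop_VL: "a \<in> VL (Suc n) \<Longrightarrow> a - vtop n a \<in> VL n"
  by (rule VL_induct[where \<Phi> = "\<lambda>a. a - vtop n a" and n = "Suc n"]) (auto simp: vtop_bv)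

lemma vtop_vtop: "vtop n (vtop m a) = (if m = n then vtop m a else 0)"
  by (rule plin_eqI[where a = a and f = "\<lambda>a. vtop n (vtop m a)"]) (auto simp: vtop_bv)

lemma vtop_wpart: "vtop n (wpart l v f) = (if length (letters v) = n then wpart l v f else 0)"
  by (rule plin_eqI[where a = f and f = "\<lambda>f. vtop n (wpart l v f)"]) (auto simp: vtop_bv)

text \<open>The length of a word is the coordinate sum of its degree; hence taking the top length
  preserves the graded ideal, and with it \<open>N\<close>.\<close>

lemma vtop_vpart: "vtop n (vpart w l f) = vpart w l (degscale (\<lambda>d. if (\<Sum>i\<in>UNIV. d $ i) = int n then 1 else 0) f)"
proof (rule plin_eqI[where a = f and f = "\<lambda>f. vtop n (vpart w l f)"], goal_cases)
  case (3 x)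
  show ?case using length_word_deg[of x] by (simp add: degscale_def vtop_bv)
qed (simp_all add: degscale_def)

lemma sum_list_mset_cong: "mset u = mset v \<Longrightarrow> sum_list (map g u) = sum_list (map g v)"
  for g :: "'a \<Rightarrow> 'b::comm_monoid_add"
  by (metis mset_map sum_mset_sum_list)

text \<open>Full length on the right is reached only if every letter goes there, and then the
  scalars are 1 because the left factor is 1.\<close>

lemma (in bichar) cop_leading:
  "cop w - bv (0, w) \<in> supp_space (\<lambda>(u, u'). length (letters u') < length (letters w))"
proof (induction w rule: fmon_induct)
  case (Cons i w)
  let ?S = "supp_space (\<lambda>(u, u'). length (letters u') < length (letters (FMon [i] + w)))"
  have "primitive_mult i (cop w - bv (0, w)) \<in> ?S"
    by (rule plin_in_subspace[OF _ _ Cons])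
      (auto intro!: supp_space_add supp_space_scale)
  then have "primitive_mult i (cop w - bv (0, w)) + bv (FMon [i], w) \<in> ?S"
    by (rule supp_space_add) simp
  moreover have "primitive_mult i (cop w - bv (0, w)) + bv (FMon [i], w) = cop (FMon [i] + w) - bv (0, FMon [i] + w)"
    by (simp add: plin_diff[OF plin_primitive_mult])
  ultimately show ?case by simp
qed simp

context pre_nichols
begin

lemma vtop_N: "a \<in> N \<Longrightarrow> vtop n a \<in> N"
  by (erule N_closed[OF plin_vtop subspace_N])
    (auto simp: vtop_wpart vtop_vpart wpart_N vpart_N degscale_I)

lemma XW_N: "a \<in> N \<Longrightarrow> XW u a \<in> N"
  by (induction u rule: fmon_induct) (auto simp: XX_N)

lemma XW_I_N:
  assumes "f \<in> \<I>"
  shows "lext (\<lambda>w. XW w a) f \<in> N"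
proof (induction a rule: pm_induct)
  case zero
  show ?case by (simp add: lext_def)
next
  case (single x)
  obtain w l v where x: "x = (w, l, v)" by (cases x)
  have "lext (\<lambda>u. XW u (bv x)) f = wpart l v (f * bv w)"
    by (rule plin_eqI[where a = f and f = "lext (\<lambda>u. XW u (bv x))"]) (simp_all add: x bv_mult)
  then show ?case by (simp add: wpart_N I_mult_right assms)
qed (simp_all add: lext_fun_add lext_fun_scale N_add N_scale)

end

context nichols_involution
begin

section \<open>The elements \<open>Y_i\<close>, the map \<open>Psi\<close> and the map
  \<open>Theta\<close>\<close>

definition kap :: "'i \<Rightarrow> int ^ 'i" where
  "kap i = alpha (\<tau> i) - alpha i"

lemma kap_Lth [simp]: "kap i \<in> Lth"
  using Lth_gen[of "\<tau> i"] by (simp add: kap_def)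

text \<open>The summand \<open>c_i E_{\<tau> i} K_i^-1\<close> of \<open>B_i\<close>, rewritten with
  \<open>E_{\<tau> i} = X_{\<tau> i} K_{\<tau> i}\<close>.\<close>

definition yop :: "'i \<Rightarrow> ('i pbw \<Rightarrow>\<^sub>0 'k) \<Rightarrow> ('i pbw \<Rightarrow>\<^sub>0 'k)" where
  "yop i a = pm_scale (c i) (XX (\<tau> i) (KK (kap i) a))"

lemma plin_yop [simp, intro]: "plin (yop i)"
  by (simp add: yop_def[abs_def])

lemmas plin_yop_comp [simp, intro] = plin_comp[OF plin_yop]
  and yop_linear [simp] = plin_add[OF plin_yop] plin_scale[OF plin_yop] plin_0[OF plin_yop] plin_diff[OF plin_yop]

lemma yop_N: "a \<in> N \<Longrightarrow> yop i a \<in> N"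
  by (simp add: yop_def N_scale XX_N KK_N)

lemma yop_V: "a \<in> V \<Longrightarrow> yop i a \<in> V"
  by (simp add: yop_def XX_V KK_V)

lemma KK_commute: "KK m (KK n a) = KK n (KK m a)"
  by (simp add: KK_KK add.commute)

lemma yop_KK: "yop i (KK n a) = pm_scale (inverse (chi n (alpha (\<tau> i)))) (KK n (yop i a))"
  by (simp add: yop_def KK_XX KK_commute[of n] mult.commute)

lemma chi_kap: "chi (kap i) (alpha j) = chi (alpha (\<tau> i)) (alpha j) * inverse (chi (alpha i) (alpha j))"
  by (simp add: kap_def X_diff_left)

text \<open>The scalars from \<open>X_{\<tau> i}\<close> and from \<open>K_l\<close> with
  \<open>l = kap i\<close> combine to \<open>q_ij^-1\<close>, so \<open>Y_i\<close> and
  \<open>F_j\<close> braid by the inverse bicharacter.\<close>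

lemma FF_yop: "FF 0 j (yop i a) = pm_scale (inverse (chi (alpha i) (alpha j))) (yop i (FF 0 j a))
    - (if i = \<tau> j then pm_scale (c i) (KK (kap i) a) else 0)"
  by (auto simp: yop_def FF_XX FF_KK chi_kap mult_ac pm.scale_right_diff_distrib)

definition YW :: "'i fmon \<Rightarrow> ('i pbw \<Rightarrow>\<^sub>0 'k) \<Rightarrow> ('i pbw \<Rightarrow>\<^sub>0 'k)" where
  "YW u a = foldr yop (letters u) a"

lemma YW_0 [simp]: "YW 0 a = a" and YW_Cons [simp]: "YW (FMon [j] + u) a = yop j (YW u a)"
  by (simp_all add: YW_def)

lemma plin_YW [simp, intro]: "plin (YW u)"
  by (induction u rule: fmon_induct) (simp_all add: YW_def[abs_def])

lemmas plin_YW_comp [simp, intro] = plin_comp[OF plin_YW]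
  and YW_linear [simp] = plin_add[OF plin_YW] plin_scale[OF plin_YW] plin_0[OF plin_YW] plin_diff[OF plin_YW]

lemma YW_N: "a \<in> N \<Longrightarrow> YW u a \<in> N"
  by (induction u rule: fmon_induct) (auto simp: yop_N)

definition Yact :: "('i, 'k) free_alg \<Rightarrow> ('i pbw \<Rightarrow>\<^sub>0 'k) \<Rightarrow> ('i pbw \<Rightarrow>\<^sub>0 'k)" where
  "Yact g a = lext (\<lambda>u. YW u a) g"

lemma Yact_linear [simp]: "Yact (g + h) a = Yact g a + Yact h a" "Yact (pm_scale d g) a = pm_scale d (Yact g a)"
  "Yact 0 a = 0" "Yact (bv u) a = YW u a"
  by (simp_all add: Yact_def)

lemma Yact_fgen: "Yact (fgen j * g) a = yop j (Yact g a)"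
  by (rule plin_eqI[where a = g and f = "\<lambda>g. Yact (fgen j * g) a"]) (simp_all add: Yact_def fgen_bv bv_mult)

text \<open>Pulling the torus factor of the correction term out past \<open>Y_i\<close> changes the
  scalar to the one in the Leibniz rule of \<open>dual.deriv (\<tau> j)\<close>; therefore the index
  of the derivation is \<open>\<tau> j\<close> and not \<open>j\<close>.\<close>

lemma chi_kap_tau: "inverse (chi (alpha i) (alpha j)) * inverse (chi (kap (\<tau> j)) (alpha (\<tau> i)))
    = inverse (chi (alpha i) (alpha (\<tau> j)))"
  using chi_tau[of "\<tau> j" "i"] chi_tau[of j i]
  by (simp add: chi_kap X_alpha_sym[of j] X_alpha_sym[of "\<tau> j"] field_simps)

lemma FF_YW: "FF 0 j (YW u a) = pm_scale (inverse (chi (word_deg u) (alpha j))) (YW u (FF 0 j a))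
    - pm_scale (c (\<tau> j)) (KK (kap (\<tau> j)) (Yact (dual.deriv (\<tau> j) u) a))"
proof (induction u rule: fmon_induct)
  case (Cons i u)
  have "yop i (KK (kap (\<tau> j)) b) = pm_scale (inverse (chi (kap (\<tau> j)) (alpha (\<tau> i)))) (KK (kap (\<tau> j)) (yop i b))" for b
    by (rule yop_KK)
  then have k: "pm_scale (inverse (chi (alpha i) (alpha j))) (yop i (KK (kap (\<tau> j)) b))
      = pm_scale (inverse (chi (alpha i) (alpha (\<tau> j)))) (KK (kap (\<tau> j)) (yop i b))" for b
    by (simp add: chi_kap_tau)
  have k': "pm_scale (d * inverse (chi (alpha i) (alpha j))) (yop i (KK (kap (\<tau> j)) b))
      = pm_scale (d * inverse (chi (alpha i) (alpha (\<tau> j)))) (KK (kap (\<tau> j)) (yop i b))" for b d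
    using arg_cong[OF k[of b], of "pm_scale d"] by simp
  show ?case
    by (auto simp: FF_yop Cons dual.deriv_letter_add Yact_fgen k' X_add_left
        pm.scale_right_diff_distrib pm.scale_right_distrib mult.commute)
qed (simp add: Yact_def)

definition mu :: "('i fmon \<times> 'i fmon \<Rightarrow>\<^sub>0 'k) \<Rightarrow> ('i pbw \<Rightarrow>\<^sub>0 'k)" where
  "mu = lext (\<lambda>(u, u'). YW u (bv (0, 0, u')))"

lemma plin_mu [simp, intro]: "plin mu"
  by (simp add: mu_def)

lemmas plin_mu_comp [simp, intro] = plin_comp[OF plin_mu]
  and mu_linear [simp] = plin_add[OF plin_mu] plin_scale[OF plin_mu] plin_0[OF plin_mu] plin_diff[OF plin_mu]

lemma mu_bv [simp]: "mu (bv (u, u')) = YW u (bv (0, 0, u'))"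
  by (simp add: mu_def)

definition BB :: "'i \<Rightarrow> ('i pbw \<Rightarrow>\<^sub>0 'k) \<Rightarrow> ('i pbw \<Rightarrow>\<^sub>0 'k)" where
  "BB j a = FF 0 j a + yop j a"

lemma plin_BB [simp, intro]: "plin (BB j)"
  by (simp add: BB_def[abs_def])

lemmas plin_BB_comp [simp, intro] = plin_comp[OF plin_BB]
  and BB_linear [simp] = plin_add[OF plin_BB] plin_scale[OF plin_BB] plin_0[OF plin_BB] plin_diff[OF plin_BB]

text \<open>The summand \<open>Y_j\<close> of \<open>B_j\<close> gives the first term of the
  primitive product. Moving \<open>F_j\<close> past \<open>Y_u\<close> gives the second one with the
  right scalar, and the remainder is a derivative of the left factor.\<close>

lemma BB_mu: "BB j (mu P) = mu (dual.primitive_mult j P)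
    - pm_scale (c (\<tau> j)) (KK (kap (\<tau> j)) (mu (dual.deriv_left (\<tau> j) P)))"
proof (rule plin_eqI[where a = P and f = "\<lambda>P. BB j (mu P)"], goal_cases)
  case (3 x)
  obtain u u' where x: "x = (u, u')" by (cases x)
  show ?case
    by (simp add: x BB_def FF_YW FF_bv dual.deriv_left_bv plin_lext_swap[OF plin_mu] X_alpha_word Yact_def)
qed simp_all

definition Psi :: "'i fmon \<Rightarrow> ('i pbw \<Rightarrow>\<^sub>0 'k)" where
  "Psi v = mu (dual.cop v)"

lemma Psi_0 [simp]: "Psi 0 = bv (0, 0, 0)"
  by (simp add: Psi_def)

lemma BB_Psi: "BB j (Psi v) = Psi (FMon [j] + v)
    - pm_scale (c (\<tau> j)) (KK (kap (\<tau> j)) (lext Psi (dual.deriv (\<tau> j) v)))"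
  by (simp add: Psi_def[abs_def] BB_mu dual.deriv_left_cop plin_lext_swap[OF plin_mu])

text \<open>The scalar in \<open>Y_u = yscal(deg u) X_{\<tau> u} K_l\<close> with
  \<open>l = kapw u\<close>. It depends only on the degree by \<open>\<tau>\<close>-invariance of
  \<open>q\<close>; some \<open>c i\<close> may be 0, so it is never inverted.\<close>

definition yscal :: "int ^ 'i \<Rightarrow> 'k" where
  "yscal = word_scalar_deg (\<lambda>i j. chi (kap i) (alpha (\<tau> j))) c"

definition kapw :: "'i fmon \<Rightarrow> int ^ 'i" where
  "kapw u = sum_list (map kap (letters u))"

lemma yscal: "word_scalar (\<lambda>i j. chi (kap i) (alpha (\<tau> j))) c (letters u) = yscal (word_deg u)"
  unfolding yscal_def
proof (rule word_scalar_deg)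
  fix i j
  have "chi (alpha i) (alpha (\<tau> j)) = chi (alpha (\<tau> i)) (alpha j)" using chi_tau[of i "\<tau> j"] by simp
  then show "chi (kap i) (alpha (\<tau> j)) = chi (kap j) (alpha (\<tau> i))"
    by (simp add: chi_kap chi_tau X_alpha_sym[of j])
qed

lemma kapw_Lth [simp]: "kapw u \<in> Lth"
  by (induction u rule: fmon_induct) (auto simp: kapw_def)

lemma chi_kap_word: "chi (kap i) (word_deg (map_fmon \<tau> u)) = prod_list (map (\<lambda>j. chi (kap i) (alpha (\<tau> j))) (letters u))"
  by (induction u rule: fmon_induct) (simp_all add: X_add_right)

lemma YW_highest: "YW u (bv (0, 0, v)) = pm_scale (yscal (word_deg u)) (bv (map_fmon \<tau> u, kapw u, v))"
proof (induction u rule: fmon_induct)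
  case 0
  show ?case using yscal[of 0] by (simp add: kapw_def)
next
  case (Cons i u)
  then show ?case
    unfolding yscal[symmetric] by (simp add: yop_def chi_kap_word kapw_def add.commute mult_ac)
qed

lemma kapw_cong: "word_deg u = word_deg v \<Longrightarrow> kapw u = kapw v"
  unfolding kapw_def by (intro sum_list_mset_cong word_deg_eq_imp_mset)

lemma relabel_tau_mem: "f \<in> \<I> \<Longrightarrow> relabel \<tau> f \<in> \<I>"
  using relabel_tau_I by blast

text \<open>The coproduct of a relation lies in the coideal. A homogeneous relation in the left
  factor becomes a multiple of its \<open>\<tau>\<close>-image in the \<open>X_i\<close>, again in
  \<open>\<I>\<close>; one in the right factor gives an element of \<open>N\<close>, which the
  operators \<open>Y_i\<close> preserve.\<close>

lemma Psi_I_N: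
  assumes "f \<in> \<I>"
  shows "lext Psi f \<in> N"
proof -
  have "coideal \<I> \<subseteq> {P. mu P \<in> N}"
  proof (rule coideal_subset)
    show "pm.subspace {P. mu P \<in> N}" using pm_subspace_vimage[OF plin_mu subspace_N] .
    fix f u' assume f: "f \<in> \<I>"
    have "lext (\<lambda>u. YW u (bv (0, 0, u'))) f \<in> N"
    proof (rule homogeneous_I[OF plin_lext subspace_N f])
      fix f d assume f: "f \<in> \<I>" and d: "\<And>u. u \<in> Poly_Mapping.keys f \<Longrightarrow> word_deg u = d"
      show "lext (\<lambda>u. YW u (bv (0, 0, u'))) f \<in> N"
      proof (cases "f = 0")
        case False
        then obtain u0 where u0: "u0 \<in> Poly_Mapping.keys f" using keys_eq_empty by blast
        have "lext (\<lambda>u. YW u (bv (0, 0, u'))) f = pm_scale (yscal d) (wpart (kapw u0) u' (relabel \<tau> f))"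
        proof (rule plin_eqI[where a = f and f = "lext (\<lambda>u. YW u (bv (0, 0, u')))"], goal_cases)
          case (3 u)
          then show ?case using d u0 kapw_cong[of u u0] by (simp add: YW_highest)
        qed simp_all
        then show ?thesis by (simp add: N_scale wpart_N relabel_tau_mem f)
      qed simp
    qed
    then show "lext (\<lambda>u. bv (u, u')) f \<in> {P. mu P \<in> N}" by (simp add: plin_lext_swap[OF plin_mu])
  next
    fix g and u :: "'i fmon" assume g: "g \<in> \<I>"
    have "lext (\<lambda>v. YW u (bv (0, 0, v))) g = YW u (vpart 0 0 g)"
      by (simp add: vpart_def plin_lext_swap[OF plin_YW])
    then show "lext (\<lambda>v. bv (u, v)) g \<in> {P. mu P \<in> N}"
      by (simp add: plin_lext_swap[OF plin_mu] YW_N vpart_N g)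
  qed
  with dual_cop_I[OF assms] have "mu (lext dual.cop f) \<in> N" by blast
  then show ?thesis by (simp add: plin_lext_swap[OF plin_mu] Psi_def[abs_def])
qed

lemma Psi_V: "Psi v \<in> V" and Psi_leading: "Psi v - bv (0, 0, v) \<in> VL (length (letters v))"
proof -
  have "mu P \<in> V" for P
    unfolding mu_def by (rule lext_in_subspace) (auto simp: YW_highest)
  then show "Psi v \<in> V" by (simp add: Psi_def)
  have "mu (dual.cop v - bv (0, v)) \<in> VL (length (letters v))"
    by (rule plin_in_subspace[OF plin_mu VL_subspace dual.cop_leading]) (auto simp: YW_highest intro!: VL_scale)
  then show "Psi v - bv (0, 0, v) \<in> VL (length (letters v))" by (simp add: Psi_def)
qed

definition Theta :: "('i pbw \<Rightarrow>\<^sub>0 'k) \<Rightarrow> ('i pbw \<Rightarrow>\<^sub>0 'k)" where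
  "Theta = lext (\<lambda>(w, l, v). XW w (KK l (Psi v)))"

lemma plin_Theta [simp, intro]: "plin Theta"
  by (simp add: Theta_def)

lemmas plin_Theta_comp [simp, intro] = plin_comp[OF plin_Theta]
  and Theta_linear [simp] = plin_add[OF plin_Theta] plin_scale[OF plin_Theta] plin_0[OF plin_Theta] plin_diff[OF plin_Theta]

lemma Theta_bv: "Theta (bv (w, l, v)) = XW w (KK l (Psi v))"
  by (simp add: Theta_def)

lemma XW_V: "a \<in> V \<Longrightarrow> XW w a \<in> V"
  by (induction w rule: fmon_induct) (auto simp: XX_V)

lemma Theta_V: "a \<in> V \<Longrightarrow> Theta a \<in> V"
  by (rule V_induct[OF plin_Theta V_subspace]) (auto simp: Theta_bv XW_V KK_V Psi_V)

lemma Theta_XX: "Theta (XX i a) = XX i (Theta a)"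
  by (rule plin_eqI[where a = a and f = "\<lambda>a. Theta (XX i a)"]) (auto simp: Theta_bv)

lemma Theta_vpart: "Theta (vpart w l g) = XW w (KK l (lext Psi g))"
  by (rule plin_eqI[where a = g and f = "\<lambda>g. Theta (vpart w l g)"]) (auto simp: Theta_bv)

lemma Theta_N: "a \<in> N \<Longrightarrow> Theta a \<in> N"
proof (erule N_closed[OF plin_Theta subspace_N])
  fix l v f assume f: "f \<in> \<I>"
  have "Theta (wpart l v f) = lext (\<lambda>w. XW w (KK l (Psi v))) f"
    by (rule plin_eqI[where a = f and f = "\<lambda>f. Theta (wpart l v f)"]) (auto simp: Theta_bv)
  then show "Theta (wpart l v f) \<in> N" by (simp add: XW_I_N f)
next
  fix w l g assume "g \<in> \<I>"
  then show "Theta (vpart w l g) \<in> N" by (simp add: Theta_vpart XW_N KK_N Psi_I_N)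
qed

lemma KK_VL: "a \<in> VL n \<Longrightarrow> KK l a \<in> VL n" and XW_VL: "a \<in> VL n \<Longrightarrow> XW w a \<in> VL n"
  by (rule VL_induct[where \<Phi> = "KK l" and n = n], auto intro!: VL_scale,
      rule VL_induct[where \<Phi> = "XW w" and n = n], auto)

lemma Theta_leading: "a \<in> VL (Suc n) \<Longrightarrow> Theta a - a \<in> VL n"
proof (rule VL_induct[where \<Phi> = "\<lambda>a. Theta a - a" and n = "Suc n"])
  fix w v :: "'i fmon" and l assume v: "length (letters v) < Suc n"
  have "Theta (bv (w, l, v)) - bv (w, l, v) = XW w (KK l (Psi v - bv (0, 0, v)))"
    by (simp add: Theta_bv)
  also have "\<dots> \<in> VL (length (letters v))" by (intro XW_VL KK_VL Psi_leading)
  finally show "Theta (bv (w, l, v)) - bv (w, l, v) \<in> VL n" using v by (auto elim: VL_mono)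
qed auto

text \<open>\<open>Theta\<close> leaves the component of top length unchanged and \<open>N\<close>
  contains the length components of its elements. So the top of \<open>a\<close> is in
  \<open>N\<close> and may be subtracted, which lowers the length.\<close>

lemma Theta_N_imp: "Theta a \<in> N \<Longrightarrow> a \<in> N"
proof -
  have "a \<in> N" if "a \<in> VL n" "Theta a \<in> N" for a n
    using that
  proof (induction n arbitrary: a)
    case (Suc n)
    have "vtop n (Theta a) = vtop n a"
      using vtop_VL_zero[OF Theta_leading[OF Suc.prems(1)]] by simp
    with vtop_N[OF Suc.prems(2), of n] have top: "vtop n a \<in> N" by simp
    have "Theta (a - vtop n a) \<in> N" using Suc.prems(2) Theta_N[OF top] by (simp add: N_diff)
    with Suc.IH diff_vtop_VL[OF Suc.prems(1)] have "a - vtop n a \<in> N" by blast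
    from N_add[OF this top] show ?case by simp
  qed simp
  moreover assume "Theta a \<in> N"
  ultimately show ?thesis using VL_exists by blast
qed

lemma Theta_N_iff: "Theta a \<in> N \<longleftrightarrow> a \<in> N"
  using Theta_N Theta_N_imp by blast

text \<open>The defect \<open>b - Theta b\<close> involves shorter words only, so correcting
  \<open>b\<close> repeatedly terminates.\<close>

lemma Theta_surj:
  assumes "b \<in> V"
  shows "\<exists>a\<in>V. Theta a = b"
proof -
  have "\<exists>a\<in>V. Theta a = b" if "b \<in> VL n" "b \<in> V" for b n
    using that
  proof (induction n arbitrary: b)
    case 0
    then show ?case by (auto intro!: bexI[of _ 0])
  next
    case (Suc n)
    have "b - Theta b \<in> VL n" using VL_scale[OF Theta_leading[OF Suc.prems(1)], of "- 1"] by simp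
    then obtain a where "a \<in> V" "Theta a = b - Theta b"
      using Suc.IH[of "b - Theta b"] Suc.prems(2) by (auto simp: Theta_V)
    then show ?case using Suc.prems(2) by (intro bexI[of _ "a + b"]) auto
  qed
  with assms VL_exists show ?thesis by blast
qed

text \<open>The lower-order part of left multiplication by \<open>B_j\<close> in the coordinates
  given by \<open>Theta\<close>. It discards \<open>w\<close> and is meant for \<open>A\<close>,
  where \<open>w = 0\<close>.\<close>

definition RR :: "'i \<Rightarrow> ('i pbw \<Rightarrow>\<^sub>0 'k) \<Rightarrow> ('i pbw \<Rightarrow>\<^sub>0 'k)" where
  "RR j = lext (\<lambda>(w, l, v). pm_scale (- chi l (alpha j) * c (\<tau> j)) (vpart 0 (l + kap (\<tau> j)) (dual.deriv (\<tau> j) v)))"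

lemma plin_RR [simp, intro]: "plin (RR j)"
  by (simp add: RR_def)

lemma RR_bv: "RR j (bv (w, l, v)) = pm_scale (- chi l (alpha j) * c (\<tau> j)) (vpart 0 (l + kap (\<tau> j)) (dual.deriv (\<tau> j) v))"
  by (simp add: RR_def)

lemma RR_A: "a \<in> A \<Longrightarrow> RR j a \<in> A"
  by (rule A_induct[OF plin_RR A_subspace]) (auto simp: RR_bv vpart_A simp del: pm.scale_minus_left)

lemma vpart_VL: "(\<And>v. v \<in> Poly_Mapping.keys f \<Longrightarrow> length (letters v) < n) \<Longrightarrow> vpart w l f \<in> VL n"
  unfolding vpart_def by (rule lext_in_subspace) auto

lemma RR_VL: "a \<in> VL (Suc n) \<Longrightarrow> RR j a \<in> VL n"
  by (erule VL_induct[OF plin_RR VL_subspace])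
    (auto simp: RR_bv simp del: pm.scale_minus_left intro!: VL_scale vpart_VL dest!: dual.deriv_keys)

text \<open>By \<open>chi_Lth_tau\<close> both summands of \<open>B_j\<close> pass
  \<open>K_l\<close> with the scalar \<open>chi l (alpha j)\<close>; what remains is
  \<open>BB_Psi\<close>.\<close>

lemma BB_Theta: "a \<in> A \<Longrightarrow> BB j (Theta a) = Theta (FF 0 j a + RR j a)"
proof -
  assume a: "a \<in> A"
  have basis: "BB j (Theta (bv (0, l, v))) = Theta (FF 0 j (bv (0, l, v)) + RR j (bv (0, l, v)))" if l: "l \<in> Lth" for l v
  proof -
    have "inverse (chi l (alpha (\<tau> j))) = chi l (alpha j)"
      using chi_Lth_tau[OF l, of j] by (metis inverse_unique mult.commute)
    then have "BB j (KK l b) = pm_scale (chi l (alpha j)) (KK l (BB j b))" for b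
      by (simp add: BB_def FF_KK yop_KK pm.scale_right_distrib)
    then show ?thesis
      by (simp add: Theta_bv BB_Psi FF_bv RR_bv Theta_vpart KK_KK pm.scale_right_diff_distrib add.commute)
  qed
  show ?thesis
    by (rule plin_eqI[where a = a and f = "\<lambda>a. BB j (Theta a)"])
      (use a basis in \<open>auto simp: A_def plin_comp[OF plin_Theta] dest!: supp_spaceD\<close>)
qed

end

section \<open>The filtration of \<open>B\<close>\<close>

context nichols_involution
begin

text \<open>\<open>E_{\<tau> j} K_j^-1\<close> is written as \<open>X_{\<tau> j}\<close> times
  \<open>K_{\<tau> j} K_j^-1\<close>, so that the representative lies in \<open>PP\<close>.\<close>

definition bgen :: "'i \<Rightarrow> ('i generator, 'k) free_alg" where
  "bgen j = fgen (F j) + pm_scale (c j) (xgen (\<tau> j) * hgen (\<tau> j))"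

lemma bgen_PP [simp, intro]: "bgen j \<in> PP"
  unfolding bgen_def by (intro He.P_add He.P_scale He.P_mult) auto

lemma pi_E_Kinv_tau: "pi (fgen (E (\<tau> j)) * fgen (Kinv j)) = pi (xgen (\<tau> j) * hgen (\<tau> j))"
proof -
  have "pi (fgen (Kinv (\<tau> j)) * hgen (\<tau> j)) = pi ((fgen (Kinv (\<tau> j)) * fgen (K (\<tau> j))) * fgen (Kinv j))"
    by (simp add: hgen_def mult.assoc)
  also have "\<dots> = pi (1 * fgen (Kinv j))" by (intro pi_mult_cong pi_Kinv_K refl)
  finally have "pi (fgen (E (\<tau> j)) * (fgen (Kinv (\<tau> j)) * hgen (\<tau> j))) = pi (fgen (E (\<tau> j)) * fgen (Kinv j))"
    by (intro pi_mult_cong refl) simp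
  then show ?thesis by (simp add: xgen_def mult.assoc)
qed

lemma B_gen_eq: "B_gen chi \<I> \<tau> c j = pi (bgen j)"
proof -
  have "B_gen chi \<I> \<tau> c j = pi (fgen (F j) + pm_scale (c j) (fgen (E (\<tau> j)) * fgen (Kinv j)))"
    by (simp add: B_gen_def U_gen_eq U.p_add U.p_mult U.p_scale)
  also have "\<dots> = pi (bgen j)"
    unfolding bgen_def by (intro pi_add_cong pi_scale_cong pi_E_Kinv_tau refl)
  finally show ?thesis .
qed

lemma Htheta_eq: "Htheta chi \<I> \<tau> = pi ` PH"
proof -
  have "range (Ktheta chi \<I> \<tau>) = pi ` range hgen" by (auto simp: Ktheta_eq)
  then show ?thesis by (simp add: Htheta_def PH_def U.gen_subalg_image)
qed

lemma Uminus_eq: "Uminus chi \<I> = pi ` PF"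
proof -
  have "range (\<lambda>i. U_gen chi \<I> (F i)) = pi ` range (\<lambda>i. fgen (F i))" by (auto simp: U_gen_eq)
  then show ?thesis by (simp add: Uminus_def PF_def U.gen_subalg_image)
qed

definition PB :: "('i generator, 'k) free_alg set" where
  "PB = subalg (PH \<union> range bgen)"

definition PHU :: "('i generator, 'k) free_alg set" where
  "PHU = subalg (PH \<union> PF)"

lemma B_gens_PP: "PH \<union> range bgen \<subseteq> PP"
  using PH_PP by auto

lemma B_alg_eq: "B_alg chi \<I> \<tau> c = pi ` PB"
proof -
  have "Htheta chi \<I> \<tau> \<union> range (B_gen chi \<I> \<tau> c) = pi ` (PH \<union> range bgen)"
    by (auto simp: Htheta_eq B_gen_eq)
  then show ?thesis by (simp add: B_alg_def PB_def U.gen_subalg_image)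
qed

lemma B_bar_eq: "B_bar chi \<I> \<tau> c = Pi ` PB"
  by (simp add: B_bar_def B_alg_eq image_image kappa_pi)

lemma PB_PP: "PB \<subseteq> PP"
  unfolding PB_def by (rule He.subalg_P[OF B_gens_PP])

abbreviation Bbar_alg where "Bbar_alg \<equiv> restrict_carrier (\<H>) (B_bar chi \<I> \<tau> c)"

sublocale Bb: presented_algebra Bbar_alg PB Pi
  unfolding B_bar_eq PB_def by (rule He.presented_restrict[OF B_gens_PP])

sublocale HU: presented_algebra "HU chi \<I> \<tau>" PHU pi
  unfolding HU_def Htheta_eq Uminus_eq image_Un[symmetric] PHU_def U.gen_subalg_image[OF subset_UNIV]
  by (rule U.presented_restrict) simp

lemma Bbar_alg_simps: "add Bbar_alg = add (\<H>)" "monoid.mult Bbar_alg = monoid.mult (\<H>)"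
  "one Bbar_alg = one (\<H>)" "zero Bbar_alg = zero (\<H>)"
  "smult Bbar_alg = smult (\<H>)"
  by (simp_all add: restrict_carrier_def)

lemma HU_simps: "add (HU chi \<I> \<tau>) = add (U_alg chi \<I>)" "monoid.mult (HU chi \<I> \<tau>) = monoid.mult (U_alg chi \<I>)"
  "one (HU chi \<I> \<tau>) = one (U_alg chi \<I>)" "zero (HU chi \<I> \<tau>) = zero (U_alg chi \<I>)"
  "smult (HU chi \<I> \<tau>) = smult (U_alg chi \<I>)"
  by (simp_all add: HU_def restrict_carrier_def)

lemma Pi_bgen_ellt:
  assumes a: "a \<in> V"
  shows "Pi (bgen j * ellt a) = Pi (ellt (BB j a))"
proof -
  have "pi (xgen (\<tau> j) * (hgen (\<tau> j) * ellt a)) = pi (xgen (\<tau> j) * ellt (KK (kap j) a))"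
    using pi_hgen_ellt[OF a, of "\<tau> j"] by (intro pi_mult_cong refl) (simp add: kap_def)
  then have y: "Pi (pm_scale (c j) (xgen (\<tau> j) * (hgen (\<tau> j) * ellt a))) = Pi (ellt (yop j a))"
    by (intro Pi_cong) (simp add: yop_def ellt_XX U.p_scale)
  have "Pi (bgen j * ellt a) = Pi (fgen (F j) * ellt a + pm_scale (c j) (xgen (\<tau> j) * (hgen (\<tau> j) * ellt a)))"
    by (simp add: bgen_def distrib_right pm_scale_mult_left mult.assoc)
  also have "\<dots> = Pi (ellt (FF 0 j a) + ellt (yop j a))"
    using a by (intro He.p_add_cong Pi_F_ellt y)
      (auto intro!: He.P_scale He.P_mult simp: ellt_PP FF_V yop_V)
  finally show ?thesis by (simp add: BB_def)
qed

text \<open>Second coordinates on the Heisenberg double, adapted to the decomposition: the triple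
  \<open>(w, l, v)\<close> with \<open>l \<in> Lth\<close> now stands for
  \<open>X_w K_l Psi(v)\<close>.\<close>

definition Lp :: "('i pbw \<Rightarrow>\<^sub>0 'k) \<Rightarrow> ('i, 'k) U_elt set" where
  "Lp a = Pi (ellt (Theta a))"

lemma ellt_Theta_PP [simp]: "a \<in> V \<Longrightarrow> ellt (Theta a) \<in> PP"
  by (simp add: ellt_PP Theta_V)

lemma Lp_eq_iff: "a \<in> V \<Longrightarrow> b \<in> V \<Longrightarrow> Lp a = Lp b \<longleftrightarrow> a - b \<in> N"
  using Theta_N_iff[of "a - b"] by (simp add: Lp_def Pi_ellt_eq_iff Theta_V)

lemma Lp_add: "a \<in> V \<Longrightarrow> b \<in> V \<Longrightarrow> Lp (a + b) = Lp a \<oplus>\<^bsub>\<H>\<^esub> Lp b"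
  and Lp_scale: "a \<in> V \<Longrightarrow> Lp (pm_scale d a) = d \<odot>\<^bsub>\<H>\<^esub> Lp a"
  and Lp_zero: "Lp 0 = \<zero>\<^bsub>\<H>\<^esub>"
  by (simp_all add: Lp_def He.p_add He.p_scale He.p_zero)

abbreviation vac :: "'i pbw \<Rightarrow>\<^sub>0 'k" where "vac \<equiv> bv (0, 0, 0)"

lemma Theta_vac [simp]: "Theta vac = vac"
  by (simp add: Theta_bv)

lemma Lp_vac: "Lp vac = \<one>\<^bsub>\<H>\<^esub>"
  using Pi_cong[OF pi_ellt_unit] by (simp add: Lp_def He.p_one)

lemma Lp_closed [simp, intro]: "a \<in> V \<Longrightarrow> Lp a \<in> carrier (\<H>)"
  by (simp add: Lp_def)

lemma Pi_mult_Lp: "f \<in> PP \<Longrightarrow> a \<in> V \<Longrightarrow> Pi f \<otimes>\<^bsub>\<H>\<^esub> Lp a = Pi (f * ellt (Theta a))"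
  by (simp add: Lp_def He.p_mult)

lemma bgen_Lp: "a \<in> A \<Longrightarrow> Pi (bgen j) \<otimes>\<^bsub>\<H>\<^esub> Lp a = Lp (FF 0 j a + RR j a)"
  by (simp add: Pi_mult_Lp A_V Pi_bgen_ellt Theta_V BB_Theta) (simp add: Lp_def)

text \<open>Elements of \<open>H\<^sub>\<theta>\<close> only shift and scale along \<open>l\<close>,
  so they respect lengths and commute with \<open>Theta\<close> on \<open>A\<close>.\<close>

lemma rho_PH:
  assumes "f \<in> PH"
  shows "a \<in> V \<Longrightarrow> rho f a \<in> V" and "a \<in> A \<Longrightarrow> rho f a \<in> A" and "a \<in> VL n \<Longrightarrow> rho f a \<in> VL n"
    and "a \<in> A \<Longrightarrow> Theta (rho f a) = rho f (Theta a)" and "vtop n (rho f a) = rho f (vtop n a)"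
    and "a \<in> V \<Longrightarrow> pi (f * ellt a) = pi (ellt (rho f a))"
proof -
  have h: "rho (hgen i) a = KK (alpha i - alpha (\<tau> i)) a" for i a
    by (simp add: hgen_def KK_KK)
  show V: "rho f a \<in> V" if "a \<in> V" for a
    using assms that unfolding PH_def
    by (induction arbitrary: a rule: subalg.induct) (auto simp: h KK_V Lth_gen)
  show A: "rho f a \<in> A" if "a \<in> A" for a
    using assms that unfolding PH_def
    by (induction arbitrary: a rule: subalg.induct) (auto simp: h KK_A Lth_gen)
  show "rho f a \<in> VL n" if "a \<in> VL n" for a
    using assms that unfolding PH_def
    by (induction arbitrary: a rule: subalg.induct) (auto simp: h KK_VL VL_add VL_scale)
  have t: "vtop n (KK m a) = KK m (vtop n a)" for m a
    by (rule plin_eqI[where a = a and f = "\<lambda>a. vtop n (KK m a)"]) (auto simp: vtop_bv)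
  show "vtop n (rho f a) = rho f (vtop n a)"
    using assms unfolding PH_def
    by (induction arbitrary: a rule: subalg.induct) (auto simp: h t)
  have th: "Theta (KK m a) = KK m (Theta a)" if "a \<in> A" for m a
    by (rule plin_eqI[where a = a and f = "\<lambda>a. Theta (KK m a)"])
      (use that in \<open>auto simp: Theta_bv KK_KK add.commute A_def dest!: supp_spaceD\<close>)
  have "Theta (rho f a) = rho f (Theta a) \<and> rho f a \<in> A" if "a \<in> A" for a
    using assms that unfolding PH_def
    by (induction arbitrary: a rule: subalg.induct) (auto simp: h th KK_A Lth_gen)
  then show "a \<in> A \<Longrightarrow> Theta (rho f a) = rho f (Theta a)" by blast
  have "pi (f * ellt a) = pi (ellt (rho f a)) \<and> rho f a \<in> V" if "a \<in> V" for a
    using assms that unfolding PH_def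
  proof (induction arbitrary: a rule: subalg.induct)
    case (gen g)
    then show ?case using pi_hgen_ellt[OF gen(2)] by (auto simp only: h KK_V Lth_gen rangeE)
  next
    case (add f g)
    then have "pi (f * ellt a + g * ellt a) = pi (ellt (rho f a) + ellt (rho g a))"
      by (intro pi_add_cong) auto
    with add show ?case by (simp add: distrib_right)
  next
    case (mult f g)
    then have "pi (f * (g * ellt a)) = pi (f * ellt (rho g a))" by (intro pi_mult_cong) auto
    with mult show ?case by (simp add: mult.assoc)
  next
    case (scale f d)
    then have "pi (pm_scale d (f * ellt a)) = pi (pm_scale d (ellt (rho f a)))"
      by (intro pi_scale_cong) auto
    with scale show ?case by (simp add: pm_scale_mult_left)
  qed simp
  then show "a \<in> V \<Longrightarrow> pi (f * ellt a) = pi (ellt (rho f a))" by blast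
qed

lemma PH_Lp:
  assumes "f \<in> PH" "a \<in> A"
  shows "Pi f \<otimes>\<^bsub>\<H>\<^esub> Lp a = Lp (rho f a)"
proof -
  have "f \<in> PP" using assms PH_PP by blast
  then have "Pi f \<otimes>\<^bsub>\<H>\<^esub> Lp a = Pi (f * ellt (Theta a))"
    using assms by (simp add: Pi_mult_Lp A_V)
  also have "\<dots> = Pi (ellt (rho f (Theta a)))"
    using assms by (intro Pi_cong rho_PH(6)) (simp_all add: Theta_V A_V)
  finally show ?thesis using assms by (simp add: Lp_def rho_PH(4))
qed

section \<open>The filtration in the coordinates \<open>Lp\<close>\<close>

definition AL :: "nat \<Rightarrow> ('i pbw \<Rightarrow>\<^sub>0 'k) set" where
  "AL n = A \<inter> VL n"

lemma AL_V: "a \<in> AL n \<Longrightarrow> a \<in> V" and AL_A: "a \<in> AL n \<Longrightarrow> a \<in> A"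
  by (auto simp: AL_def A_V)

lemma AL_subspace [simp]: "pm.subspace (AL n)"
  unfolding AL_def by (intro pm.subspace_inter) simp_all

lemmas AL_add = pm.subspace_add[OF AL_subspace] and AL_diff = pm.subspace_diff[OF AL_subspace]
  and AL_scale = pm.subspace_scale[OF AL_subspace] and AL_zero [simp] = pm.subspace_0[OF AL_subspace]

lemma AL_0_iff [simp]: "a \<in> AL 0 \<longleftrightarrow> a = 0"
  by (auto simp: AL_def)

lemma AL_mono: "a \<in> AL m \<Longrightarrow> m \<le> n \<Longrightarrow> a \<in> AL n"
  by (auto simp: AL_def elim: VL_mono)

lemma AL_exists: "a \<in> A \<Longrightarrow> \<exists>n. a \<in> AL n"
  using VL_exists[of a] by (auto simp: AL_def)

lemma vtop_A: "a \<in> A \<Longrightarrow> vtop n a \<in> A"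
  by (rule A_induct[where \<Phi> = "vtop n"]) (auto simp: vtop_bv)

lemma vtop_VL: "vtop n a \<in> VL (Suc n)"
  unfolding vtop_def by (rule lext_in_subspace) auto

lemma vtop_AL: "a \<in> A \<Longrightarrow> vtop n a \<in> AL (Suc n)"
  by (simp add: AL_def vtop_A vtop_VL)

lemma vtop_AL_zero: "a \<in> AL n \<Longrightarrow> vtop n a = 0"
  by (simp add: AL_def vtop_VL_zero)

lemma diff_vtop_AL: "a \<in> AL (Suc n) \<Longrightarrow> a - vtop n a \<in> AL n"
  by (simp add: AL_def diff_vtop_VL vtop_A)

lemma vtop_FF: "a \<in> A \<Longrightarrow> vtop (Suc n) (FF 0 j a) = FF 0 j (vtop n a)"
  by (rule plin_eqI[where a = a and f = "\<lambda>a. vtop (Suc n) (FF 0 j a)"])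
    (auto simp: FF_bv vtop_bv A_def dest!: supp_spaceD)

lemma FF_AL: "a \<in> AL n \<Longrightarrow> FF 0 j a \<in> AL (Suc n)"
proof -
  assume a: "a \<in> AL n"
  have "FF 0 j a \<in> VL (Suc n)"
  proof (rule plin_in_subspace[OF plin_FF VL_subspace])
    show "a \<in> supp_space (\<lambda>(w, l, v). w = 0 \<and> length (letters v) < n)"
      using a by (auto simp: AL_def A_def VL_def supp_space_def)
  qed (auto simp: FF_bv intro!: VL_scale)
  then show ?thesis using a by (simp add: AL_def FF_A)
qed

lemma RR_AL: "a \<in> AL (Suc n) \<Longrightarrow> RR j a \<in> AL n"
  by (simp add: AL_def RR_A RR_VL)

definition top_part :: "nat \<Rightarrow> ('i pbw \<Rightarrow>\<^sub>0 'k) \<Rightarrow> ('i generator, 'k) free_alg" where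
  "top_part n a = ellt (vtop n a)"

abbreviation Fil where "Fil \<equiv> B_bar_filtration chi \<I> \<tau> c"

abbreviation in_fil where
  "in_fil \<equiv> in_filtration (\<H>) (Pi ` PH) (range (\<lambda>i. Pi (bgen i)))"

lemma Fil_iff: "x \<in> Fil m \<longleftrightarrow> in_fil m x"
  by (simp add: B_bar_filtration_def filtration_def Htheta_eq B_gen_eq kappa_pi image_image)

lemma in_fil_mono: "in_fil m x \<Longrightarrow> m \<le> n \<Longrightarrow> in_fil n x"
  by (rotate_tac, induction n rule: dec_induct) (auto intro: in_filtration.mono)

text \<open>\<open>Lp\<close> is not multiplicative and only left multiplication by generators is
  known, so the induction carries the effect of \<open>x\<close> on every \<open>Lp b\<close>;
  products then follow from associativity. Top parts are compared in \<open>U(chi)\<close>, where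
  they multiply as in \<open>H\<^sub>\<theta> \<ltimes> U\<^sup>-\<close>, because \<open>RR\<close>
  does not reach the top length.\<close>

lemma Lp_mult_top:
  assumes "in_fil l x"
  shows "\<exists>a\<in>AL (Suc l). x = Lp a \<and> (\<forall>m. \<forall>b\<in>AL (Suc m). \<exists>e\<in>AL (Suc (l + m)).
    x \<otimes>\<^bsub>\<H>\<^esub> Lp b = Lp e \<and> pi (top_part (l + m) e) = pi (top_part l a * top_part m b))"
  using assms
proof (induction rule: in_filtration.induct)
  case one
  have "\<one>\<^bsub>\<H>\<^esub> \<otimes>\<^bsub>\<H>\<^esub> Lp b = Lp b \<and> pi (top_part (0 + m) b) = pi (top_part 0 vac * top_part m b)"
    if "b \<in> AL (Suc m)" for b m
    using pi_mult_cong[OF pi_ellt_unit refl, of "top_part m b"] that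
    by (simp add: AL_V top_part_def vtop_bv)
  then show ?case
    by (intro bexI[of _ vac]) (auto simp: Lp_vac AL_def)
next
  case (deg0 x)
  then obtain h where h: "h \<in> PH" "x = Pi h" by blast
  have a: "rho h vac \<in> AL (Suc 0)" using h rho_PH(2,3) by (simp add: AL_def)
  have "Pi h \<otimes>\<^bsub>\<H>\<^esub> Lp vac = Lp (rho h vac)" by (rule PH_Lp) (use h in auto)
  then have x: "x = Lp (rho h vac)" using h PH_PP by (auto simp: Lp_vac)
  have "pi (h * ellt vac) = pi (ellt (rho h vac))" by (rule rho_PH(6)) (use h in auto)
  then have top: "pi (top_part 0 (rho h vac)) = pi h"
    using pi_mult_cong[OF refl pi_ellt_unit, of h] h by (simp add: top_part_def rho_PH(5) vtop_bv)
  have "x \<otimes>\<^bsub>\<H>\<^esub> Lp b = Lp (rho h b) \<and> rho h b \<in> AL (Suc m) \<and>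
      pi (top_part (0 + m) (rho h b)) = pi (top_part 0 (rho h vac) * top_part m b)" if b: "b \<in> AL (Suc m)" for b m
  proof (intro conjI)
    show "x \<otimes>\<^bsub>\<H>\<^esub> Lp b = Lp (rho h b)" using b h PH_Lp AL_A by blast
    show "rho h b \<in> AL (Suc m)" using b h rho_PH(2,3) by (simp add: AL_def)
    have "pi (h * ellt (vtop m b)) = pi (ellt (rho h (vtop m b)))"
      using b h by (intro rho_PH(6)) (auto simp: AL_A A_V vtop_A)
    with pi_mult_cong[OF top refl, of "top_part m b"]
    show "pi (top_part (0 + m) (rho h b)) = pi (top_part 0 (rho h vac) * top_part m b)"
      using h by (simp add: top_part_def rho_PH(5))
  qed
  with a x show ?case by (intro bexI[of _ "rho h vac"]) auto
next
  case (deg1 x)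
  then obtain j where x: "x = Pi (bgen j)" by blast
  let ?a = "bv (0, 0, FMon [j]) :: 'i pbw \<Rightarrow>\<^sub>0 'k"
  have F: "FF 0 j vac = ?a" by (simp add: FF_bv)
  have "Pi (bgen j) \<otimes>\<^bsub>\<H>\<^esub> Lp vac = Lp (FF 0 j vac + RR j vac)" by (rule bgen_Lp) simp
  then have xa: "x = Lp ?a" by (simp add: Lp_vac x F RR_bv)
  have "pi (fgen (F j) * ellt vac) = pi (ellt ?a)" using pi_F_ellt[of vac j] F by simp
  then have top: "pi (top_part 1 ?a) = pi (fgen (F j))"
    using pi_mult_cong[OF refl pi_ellt_unit, of "fgen (F j)"] by (simp add: top_part_def vtop_bv)
  have "x \<otimes>\<^bsub>\<H>\<^esub> Lp b = Lp (FF 0 j b + RR j b) \<and> FF 0 j b + RR j b \<in> AL (Suc (1 + m)) \<and>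
      pi (top_part (1 + m) (FF 0 j b + RR j b)) = pi (top_part 1 ?a * top_part m b)" if b: "b \<in> AL (Suc m)" for b m
  proof (intro conjI)
    show "x \<otimes>\<^bsub>\<H>\<^esub> Lp b = Lp (FF 0 j b + RR j b)" using b x bgen_Lp AL_A by blast
    have R: "RR j b \<in> AL m" by (rule RR_AL[OF b])
    then show "FF 0 j b + RR j b \<in> AL (Suc (1 + m))"
      using FF_AL[OF b] by (intro AL_add) (auto elim: AL_mono)
    have "vtop (Suc m) (RR j b) = 0" using R by (intro vtop_AL_zero) (auto elim: AL_mono)
    then have "vtop (1 + m) (FF 0 j b + RR j b) = FF 0 j (vtop m b)"
      using b by (simp add: vtop_FF AL_A)
    moreover have "pi (fgen (F j) * ellt (vtop m b)) = pi (ellt (FF 0 j (vtop m b)))"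
      using b by (intro pi_F_ellt vtop_A AL_A)
    ultimately show "pi (top_part (1 + m) (FF 0 j b + RR j b)) = pi (top_part 1 ?a * top_part m b)"
      using pi_mult_cong[OF top refl, of "top_part m b"] by (simp add: top_part_def)
  qed
  with xa show ?case by (intro bexI[of _ ?a]) (auto simp: AL_def)
next
  case (mono l x)
  then obtain a where a: "a \<in> AL (Suc l)" "x = Lp a"
    and e: "\<And>m b. b \<in> AL (Suc m) \<Longrightarrow> \<exists>e\<in>AL (Suc (l + m)). x \<otimes>\<^bsub>\<H>\<^esub> Lp b = Lp e"
    by blast
  \<comment> \<open>Regarded in the next higher degree, both top parts are zero.\<close>
  have "\<exists>e\<in>AL (Suc (Suc l + m)). x \<otimes>\<^bsub>\<H>\<^esub> Lp b = Lp e \<and>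
      pi (top_part (Suc l + m) e) = pi (top_part (Suc l) a * top_part m b)" if "b \<in> AL (Suc m)" for b m
  proof -
    from e[OF that] obtain e where "e \<in> AL (Suc (l + m))" "x \<otimes>\<^bsub>\<H>\<^esub> Lp b = Lp e" by blast
    with a show ?thesis
      by (intro bexI[of _ e]) (auto simp: top_part_def vtop_AL_zero elim: AL_mono)
  qed
  with a show ?case by (intro bexI[of _ a]) (auto elim: AL_mono)
next
  case (add l x y)
  then obtain a a' where a: "a \<in> AL (Suc l)" "x = Lp a" "a' \<in> AL (Suc l)" "y = Lp a'"
    and e: "\<And>m b. b \<in> AL (Suc m) \<Longrightarrow> \<exists>e\<in>AL (Suc (l + m)). x \<otimes>\<^bsub>\<H>\<^esub> Lp b = Lp e \<and>
      pi (top_part (l + m) e) = pi (top_part l a * top_part m b)"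
    and e': "\<And>m b. b \<in> AL (Suc m) \<Longrightarrow> \<exists>e\<in>AL (Suc (l + m)). y \<otimes>\<^bsub>\<H>\<^esub> Lp b = Lp e \<and>
      pi (top_part (l + m) e) = pi (top_part l a' * top_part m b)"
    by blast
  have "\<exists>e\<in>AL (Suc (l + m)). (x \<oplus>\<^bsub>\<H>\<^esub> y) \<otimes>\<^bsub>\<H>\<^esub> Lp b = Lp e \<and>
      pi (top_part (l + m) e) = pi (top_part l (a + a') * top_part m b)" if b: "b \<in> AL (Suc m)" for b m
  proof -
    from e[OF b] e'[OF b] obtain e e' where ee: "e \<in> AL (Suc (l + m))" "x \<otimes>\<^bsub>\<H>\<^esub> Lp b = Lp e"
      "pi (top_part (l + m) e) = pi (top_part l a * top_part m b)"
      "e' \<in> AL (Suc (l + m))" "y \<otimes>\<^bsub>\<H>\<^esub> Lp b = Lp e'"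
      "pi (top_part (l + m) e') = pi (top_part l a' * top_part m b)" by blast
    have "(x \<oplus>\<^bsub>\<H>\<^esub> y) \<otimes>\<^bsub>\<H>\<^esub> Lp b = Lp (e + e')"
      using a b ee by (simp add: He.l_distr AL_V Lp_add)
    moreover have "pi (top_part (l + m) (e + e')) = pi (top_part l (a + a') * top_part m b)"
      using pi_add_cong[OF ee(3,6)] by (simp add: top_part_def distrib_right)
    ultimately show ?thesis using ee AL_add by blast
  qed
  with a show ?case by (intro bexI[of _ "a + a'"]) (auto simp: Lp_add AL_V AL_add)
next
  case (smult l x d)
  then obtain a where a: "a \<in> AL (Suc l)" "x = Lp a"
    and e: "\<And>m b. b \<in> AL (Suc m) \<Longrightarrow> \<exists>e\<in>AL (Suc (l + m)). x \<otimes>\<^bsub>\<H>\<^esub> Lp b = Lp e \<and>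
      pi (top_part (l + m) e) = pi (top_part l a * top_part m b)"
    by blast
  have "\<exists>e\<in>AL (Suc (l + m)). (d \<odot>\<^bsub>\<H>\<^esub> x) \<otimes>\<^bsub>\<H>\<^esub> Lp b = Lp e \<and>
      pi (top_part (l + m) e) = pi (top_part l (pm_scale d a) * top_part m b)" if b: "b \<in> AL (Suc m)" for b m
  proof -
    from e[OF b] obtain e where ee: "e \<in> AL (Suc (l + m))" "x \<otimes>\<^bsub>\<H>\<^esub> Lp b = Lp e"
      "pi (top_part (l + m) e) = pi (top_part l a * top_part m b)" by blast
    have "(d \<odot>\<^bsub>\<H>\<^esub> x) \<otimes>\<^bsub>\<H>\<^esub> Lp b = d \<odot>\<^bsub>\<H>\<^esub> (x \<otimes>\<^bsub>\<H>\<^esub> Lp b)"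
      using a b He.smult_conv_mult[of x d] He.smult_conv_mult[of "x \<otimes>\<^bsub>\<H>\<^esub> Lp b" d]
      by (simp add: AL_V He.m_assoc)
    then have "(d \<odot>\<^bsub>\<H>\<^esub> x) \<otimes>\<^bsub>\<H>\<^esub> Lp b = Lp (pm_scale d e)"
      using ee by (simp add: Lp_scale AL_V)
    moreover have "pi (top_part (l + m) (pm_scale d e)) = pi (top_part l (pm_scale d a) * top_part m b)"
      using pi_scale_cong[OF ee(3), of d] by (simp add: top_part_def pm_scale_mult_left)
    ultimately show ?thesis using ee AL_scale by blast
  qed
  with a show ?case by (intro bexI[of _ "pm_scale d a"]) (auto simp: Lp_scale AL_V AL_scale)
next
  case (mult l x m y)
  then obtain a b where a: "a \<in> AL (Suc l)" "x = Lp a" and b: "b \<in> AL (Suc m)" "y = Lp b"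
    and e: "\<And>m b. b \<in> AL (Suc m) \<Longrightarrow> \<exists>e\<in>AL (Suc (l + m)). x \<otimes>\<^bsub>\<H>\<^esub> Lp b = Lp e \<and>
      pi (top_part (l + m) e) = pi (top_part l a * top_part m b)"
    and e': "\<And>n g. g \<in> AL (Suc n) \<Longrightarrow> \<exists>e\<in>AL (Suc (m + n)). y \<otimes>\<^bsub>\<H>\<^esub> Lp g = Lp e \<and>
      pi (top_part (m + n) e) = pi (top_part m b * top_part n g)"
    by blast
  \<comment> \<open>The coordinates of the product come from letting \<open>x\<close> act on the
    coordinates \<open>b\<close> of \<open>y\<close>.\<close>
  from e[OF b(1)] obtain z where z: "z \<in> AL (Suc (l + m))" "x \<otimes>\<^bsub>\<H>\<^esub> y = Lp z"
      "pi (top_part (l + m) z) = pi (top_part l a * top_part m b)" using b by blast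
  have "\<exists>e\<in>AL (Suc (l + m + n)). (x \<otimes>\<^bsub>\<H>\<^esub> y) \<otimes>\<^bsub>\<H>\<^esub> Lp g = Lp e \<and>
      pi (top_part (l + m + n) e) = pi (top_part (l + m) z * top_part n g)" if g: "g \<in> AL (Suc n)" for g n
  proof -
    from e'[OF g] obtain u where u: "u \<in> AL (Suc (m + n))" "y \<otimes>\<^bsub>\<H>\<^esub> Lp g = Lp u"
      "pi (top_part (m + n) u) = pi (top_part m b * top_part n g)" by blast
    from e[OF u(1)] obtain r where r: "r \<in> AL (Suc (l + (m + n)))" "x \<otimes>\<^bsub>\<H>\<^esub> Lp u = Lp r"
      "pi (top_part (l + (m + n)) r) = pi (top_part l a * top_part (m + n) u)" by blast
    have "(x \<otimes>\<^bsub>\<H>\<^esub> y) \<otimes>\<^bsub>\<H>\<^esub> Lp g = Lp r"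
      using a b g u r by (simp add: He.m_assoc AL_V)
    moreover have "pi (top_part l a * top_part (m + n) u) = pi ((top_part l a * top_part m b) * top_part n g)"
      using pi_mult_cong[OF refl u(3), of "top_part l a"] by (simp add: mult.assoc)
    then have "pi (top_part (l + (m + n)) r) = pi (top_part (l + m) z * top_part n g)"
      using r(3) pi_mult_cong[OF z(3) refl, of "top_part n g"] by simp
    ultimately show ?thesis using r by (intro bexI[of _ r]) (auto simp: add.assoc)
  qed
  with z show ?case by (intro bexI[of _ z]) auto
qed

lemma in_fil_zero: "in_fil m \<zero>\<^bsub>\<H>\<^esub>"
proof -
  have "in_fil 0 (0 \<odot>\<^bsub>\<H>\<^esub> \<one>\<^bsub>\<H>\<^esub>)" by (intro in_filtration.smult in_filtration.one)
  moreover have "0 \<odot>\<^bsub>\<H>\<^esub> \<one>\<^bsub>\<H>\<^esub> = \<zero>\<^bsub>\<H>\<^esub>"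
    using Lp_scale[of vac 0] by (simp add: Lp_vac Lp_zero)
  ultimately show ?thesis using in_fil_mono by auto
qed

lemma Lp_lext_in_fil:
  assumes "\<And>x. x \<in> Poly_Mapping.keys a \<Longrightarrow> bv x \<in> A \<and> in_fil m (Lp (bv x))"
  shows "in_fil m (Lp a)"
proof -
  have "a \<in> V \<and> in_fil m (Lp a)"
  proof (induction a rule: pm_induct)
    case zero then show ?case by (simp add: Lp_zero in_fil_zero)
  next
    case (scale d f) then show ?case by (simp add: Lp_scale in_filtration.smult)
  next
    case (add f g) then show ?case by (simp add: Lp_add in_filtration.add)
  next
    case (single x) then show ?case using assms A_V by blast
  qed
  then show ?thesis by blast
qed

text \<open>The first letter \<open>j\<close> of \<open>v\<close> is split off:
  \<open>Psi(F_j v')\<close> is \<open>B_j Psi(v')\<close> minus the term from \<open>RR\<close>,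
  and both have smaller coordinates to which the induction applies.\<close>

lemma Lp_in_fil: "a \<in> AL (Suc n) \<Longrightarrow> in_fil n (Lp a)"
proof (induction n arbitrary: a rule: less_induct)
  case (less n)
  have basis: "in_fil n (Lp (bv (0, l, v)))" if l: "l \<in> Lth" and v: "length (letters v) \<le> n" for l v
  proof -
    have unit: "in_fil n (Lp (bv (0, 0, v)))"
    proof (cases "letters v")
      case Nil
      then have "v = 0" by (cases v) simp
      then show ?thesis using in_fil_mono[OF in_filtration.one, of n] by (simp add: Lp_vac)
    next
      case (Cons j u)
      define v' where "v' = FMon u"
      have vj: "v = FMon [j] + v'" using Cons by (cases v) (simp add: v'_def)
      obtain n' where n': "n = Suc n'" "length (letters v') \<le> n'" using v vj by (cases n) auto
      let ?b = "bv (0, 0, v') :: 'i pbw \<Rightarrow>\<^sub>0 'k"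
      have b: "?b \<in> AL (Suc n')" using n' by (simp add: AL_def)
      have "in_fil (1 + n') (Pi (bgen j) \<otimes>\<^bsub>\<H>\<^esub> Lp ?b)"
        by (intro in_filtration.mult in_filtration.deg1 less.IH) (use n' b in auto)
      moreover have "in_fil n (Lp (RR j ?b))"
      proof (rule in_fil_mono[OF less.IH[of n']])
        show "RR j ?b \<in> AL (Suc n')" using RR_AL[OF b] by (rule AL_mono) simp
      qed (use n' in auto)
      ultimately have "in_fil n (Lp (FF 0 j ?b + RR j ?b) \<oplus>\<^bsub>\<H>\<^esub> (- 1) \<odot>\<^bsub>\<H>\<^esub> Lp (RR j ?b))"
        using n' by (intro in_filtration.add in_filtration.smult) (simp_all add: bgen_Lp)
      moreover have "Lp (FF 0 j ?b + RR j ?b) \<oplus>\<^bsub>\<H>\<^esub> (- 1) \<odot>\<^bsub>\<H>\<^esub> Lp (RR j ?b)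
          = Lp (FF 0 j ?b + RR j ?b + pm_scale (- 1) (RR j ?b))"
        by (simp only: Lp_add Lp_scale A_V FF_A RR_A bv_A V_add V_scale Lth.zero simp_thms)
      ultimately show ?thesis by (simp add: FF_bv vj)
    qed
    \<comment> \<open>The factor \<open>K_l\<close> has filtration degree 0.\<close>
    have kP: "kkt l \<in> PH" and kpi: "pi (kkt l) = pi (kk l)" using kkt[OF l] by auto
    have "Pi (kkt l) \<otimes>\<^bsub>\<H>\<^esub> Lp (bv (0, 0, v)) = Pi (ellt (KK l (Theta (bv (0, 0, v)))))"
      using kP PH_PP Pi_cong[OF pi_kkt_ellt[OF l Theta_V, of "bv (0, 0, v)"]] by (auto simp: Pi_mult_Lp)
    also have "\<dots> = Lp (bv (0, l, v))" by (simp add: Lp_def Theta_bv KK_KK)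
    finally have "Lp (bv (0, l, v)) = Pi (kkt l) \<otimes>\<^bsub>\<H>\<^esub> Lp (bv (0, 0, v))" ..
    moreover have "in_fil (0 + n) (Pi (kkt l) \<otimes>\<^bsub>\<H>\<^esub> Lp (bv (0, 0, v)))"
      using kP by (intro in_filtration.mult in_filtration.deg0 unit) auto
    ultimately show ?thesis by simp
  qed
  show ?case
  proof (rule Lp_lext_in_fil)
    fix x assume x: "x \<in> Poly_Mapping.keys a"
    obtain w l v where xw: "x = (w, l, v)" by (cases x)
    have "w = 0" "l \<in> Lth" "length (letters v) \<le> n"
      using less.prems x by (auto simp: xw AL_def A_def VL_def dest!: supp_spaceD)
    then show "bv x \<in> A \<and> in_fil n (Lp (bv x))" using basis by (simp add: xw)
  qed
qed

lemma Fil_eq: "Fil m = Lp ` AL (Suc m)"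
  using Lp_mult_top Lp_in_fil by (force simp: Fil_iff)

lemma B_bar_Lp: "B_bar chi \<I> \<tau> c = Lp ` A"
proof
  have "\<exists>m. in_fil m (Pi f)" if "f \<in> PB" for f
    using that unfolding PB_def
  proof (induction rule: subalg.induct)
    case one then show ?case using in_filtration.one by (metis He.p_one)
  next
    case (gen g) then show ?case by (blast intro: in_filtration.deg0 in_filtration.deg1)
  next
    case (add f g)
    then obtain m n where "in_fil m (Pi f)" "in_fil n (Pi g)" by blast
    then have "in_fil (max m n) (Pi f \<oplus>\<^bsub>\<H>\<^esub> Pi g)"
      by (intro in_filtration.add) (auto elim: in_fil_mono)
    moreover have "f \<in> PP" "g \<in> PP" using add.hyps PB_PP by (auto simp: PB_def)
    ultimately show ?case by (metis He.p_add)
  next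
    case (mult f g)
    then obtain m n where "in_fil m (Pi f)" "in_fil n (Pi g)" by blast
    then have "in_fil (m + n) (Pi f \<otimes>\<^bsub>\<H>\<^esub> Pi g)" by (rule in_filtration.mult)
    moreover have "f \<in> PP" "g \<in> PP" using mult.hyps PB_PP by (auto simp: PB_def)
    ultimately show ?case by (metis He.p_mult)
  next
    case (scale f d)
    then obtain m where "in_fil m (Pi f)" by blast
    then have "in_fil m (d \<odot>\<^bsub>\<H>\<^esub> Pi f)" by (rule in_filtration.smult)
    moreover have "f \<in> PP" using scale.hyps PB_PP by (auto simp: PB_def)
    ultimately show ?case by (metis He.p_scale)
  qed
  then show "B_bar chi \<I> \<tau> c \<subseteq> Lp ` A"
    using Lp_mult_top by (force simp: B_bar_eq AL_A)
  have B: "x \<in> Pi ` PB" if "in_fil m x" for m x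
    using that
  proof (induction rule: in_filtration.induct)
    case one then show ?case using Bb.one_closed by (simp add: Bb.carrier_eq Bbar_alg_simps)
  next
    case (deg0 x) then show ?case by (auto simp: PB_def intro: subalg.gen)
  next
    case (deg1 x) then show ?case by (auto simp: PB_def intro: subalg.gen)
  next
    case (add m x y) then show ?case
      using Bb.a_closed by (simp add: Bb.carrier_eq Bbar_alg_simps)
  next
    case (smult m x d) then show ?case
      using Bb.smult_closed by (simp add: Bb.carrier_eq Bbar_alg_simps)
  next
    case (mult l x m y) then show ?case
      using Bb.m_closed by (simp add: Bb.carrier_eq Bbar_alg_simps)
  qed
  then show "Lp ` A \<subseteq> B_bar chi \<I> \<tau> c"
  proof (intro image_subsetI)
    fix a assume "a \<in> A"
    then obtain n where "a \<in> AL n" using AL_exists by blast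
    then have "in_fil n (Lp a)" by (intro Lp_in_fil) (auto elim: AL_mono)
    then show "Lp a \<in> B_bar chi \<I> \<tau> c" unfolding B_bar_eq by (rule B)
  qed
qed

end

section \<open>The associated graded algebra\<close>

context nichols_involution
begin

text \<open>\<open>Lp_mult_top\<close> supplies some coordinates \<open>a'\<close> of the left
  factor; the given \<open>a\<close> differs from them by an element of \<open>N\<close>, so both
  have the same top part in \<open>U(chi)\<close>.\<close>

lemma Lp_mult_top_AL:
  assumes "a \<in> AL (Suc l)" "b \<in> AL (Suc m)"
  shows "\<exists>e\<in>AL (Suc (l + m)). Lp a \<otimes>\<^bsub>\<H>\<^esub> Lp b = Lp e \<and>
    pi (top_part (l + m) e) = pi (top_part l a * top_part m b)"
proof -
  from Lp_mult_top[OF Lp_in_fil[OF assms(1)]] obtain a' where a': "a' \<in> AL (Suc l)" "Lp a = Lp a'"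
    and e: "\<forall>m. \<forall>b\<in>AL (Suc m). \<exists>e\<in>AL (Suc (l + m)). Lp a \<otimes>\<^bsub>\<H>\<^esub> Lp b = Lp e \<and>
      pi (top_part (l + m) e) = pi (top_part l a' * top_part m b)" by blast
  from e assms(2) obtain e where e: "e \<in> AL (Suc (l + m))" "Lp a \<otimes>\<^bsub>\<H>\<^esub> Lp b = Lp e"
      "pi (top_part (l + m) e) = pi (top_part l a' * top_part m b)" by blast
  have "a - a' \<in> N" using a' assms(1) by (simp add: Lp_eq_iff AL_V)
  from vtop_N[OF this, of l] have "vtop l a - vtop l a' \<in> N" by simp
  then have "pi (top_part l a) = pi (top_part l a')"
    using a' assms(1) by (simp add: top_part_def pi_ellt_eq_iff A_V vtop_A AL_A)
  from pi_mult_cong[OF this refl, of "top_part m b"] e show ?thesis by (intro bexI[of _ e]) auto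
qed

section \<open>The graded pieces and their product\<close>

abbreviation below where "below m \<equiv> fil_below Bbar_alg Fil m"

lemma below_eq: "below m = Lp ` AL m"
proof (cases m)
  case 0
  have "AL 0 = {0}" by auto
  then show ?thesis using 0 by (simp add: fil_below_def Lp_zero Bbar_alg_simps)
qed (simp add: fil_below_def Fil_eq)

definition coset :: "nat \<Rightarrow> ('i pbw \<Rightarrow>\<^sub>0 'k) \<Rightarrow> ('i, 'k) U_elt set set" where
  "coset m a = below m +>\<^bsub>Bbar_alg\<^esub> Lp a"

lemma coset_eq: "a \<in> A \<Longrightarrow> coset m a = (\<lambda>b. Lp (b + a)) ` AL m"
  by (auto simp: coset_def below_eq a_r_coset_def' Bbar_alg_simps Lp_add AL_V A_V)

lemma coset_zero: "coset m 0 = below m"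
  by (simp add: coset_eq below_eq)

lemma coset_mono_iff_aux:
  assumes a: "a \<in> AL (Suc m)" "a' \<in> AL (Suc m)" and N: "vtop m (a - a') \<in> N"
  shows "coset m a \<subseteq> coset m a'"
proof
  fix x assume "x \<in> coset m a"
  then obtain b where b: "b \<in> AL m" "x = Lp (b + a)" using a by (auto simp: coset_eq AL_A)
  define b' where "b' = b + ((a - a') - vtop m (a - a'))"
  have d: "a - a' \<in> AL (Suc m)" using a by (rule AL_diff)
  have b': "b' \<in> AL m" unfolding b'_def using b diff_vtop_AL[OF d] by (intro AL_add) auto
  have e: "(b + a) - (b' + a') = vtop m (a - a')" by (simp add: b'_def)
  have "b + a \<in> V" "b' + a' \<in> V" using a b b' by (auto simp: AL_V)
  with N e have "Lp (b + a) = Lp (b' + a')" by (simp only: Lp_eq_iff)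
  then show "x \<in> coset m a'" using a b b' by (auto simp: coset_eq AL_A)
qed

text \<open>Division by the previous filtration step absorbs all coordinates of shorter length; the
  length-\<open>m\<close> component remains, determined modulo \<open>N\<close>.\<close>

lemma coset_eq_iff:
  assumes a: "a \<in> AL (Suc m)" "a' \<in> AL (Suc m)"
  shows "coset m a = coset m a' \<longleftrightarrow> vtop m (a - a') \<in> N"
proof
  assume eq: "coset m a = coset m a'"
  have "Lp (0 + a) \<in> coset m a" unfolding coset_eq[OF AL_A[OF a(1)]] by (rule imageI) simp
  with eq have "Lp (0 + a) \<in> coset m a'" by simp
  then obtain b where b: "b \<in> AL m" "Lp a = Lp (b + a')" using a by (auto simp: coset_eq AL_A)
  then have "a - (b + a') \<in> N" using a by (simp add: Lp_eq_iff AL_V)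
  from vtop_N[OF this, of m] b show "vtop m (a - a') \<in> N" by (simp add: vtop_AL_zero algebra_simps)
next
  assume N: "vtop m (a - a') \<in> N"
  from N_scale[OF this, of "- 1"] have "vtop m (a' - a) \<in> N" by simp
  with N show "coset m a = coset m a'" using coset_mono_iff_aux a by blast
qed

lemma coset_absorb: "a \<in> AL (Suc m) \<Longrightarrow> b \<in> AL m \<Longrightarrow> coset m (b + a) = coset m a"
  by (subst coset_eq_iff) (auto simp: vtop_AL_zero intro!: AL_add AL_mono[of b m])

text \<open>The splitting of coordinates by length identifies \<open>A\<close> modulo
  \<open>N\<close> with the graded algebra; its operations are transported to \<open>A\<close>
  below.\<close>

definition gr_rep :: "('i pbw \<Rightarrow>\<^sub>0 'k) \<Rightarrow> nat \<Rightarrow> ('i, 'k) U_elt set set" where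
  "gr_rep g = (\<lambda>m. coset m (vtop m g))"

lemma all_vtop_N:
  assumes "\<And>m. vtop m d \<in> N"
  shows "d \<in> N"
proof -
  have "d \<in> N" if "d \<in> VL n" "\<And>m. vtop m d \<in> N" for d n
    using that
  proof (induction n arbitrary: d)
    case (Suc n)
    have "vtop m (d - vtop n d) \<in> N" for m
      using Suc.prems(2)[of m] by (cases "n = m") (simp_all add: vtop_vtop)
    then have "d - vtop n d \<in> N" using Suc.IH diff_vtop_VL Suc.prems(1) by blast
    from N_add[OF this Suc.prems(2)[of n]] show ?case by simp
  qed simp
  with assms VL_exists show ?thesis by blast
qed

lemma gr_rep_eq_iff:
  assumes "g \<in> A" "g' \<in> A"
  shows "gr_rep g = gr_rep g' \<longleftrightarrow> g - g' \<in> N"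
proof -
  have "gr_rep g = gr_rep g' \<longleftrightarrow> (\<forall>m. vtop m (g - g') \<in> N)"
    using assms by (simp add: gr_rep_def fun_eq_iff coset_eq_iff vtop_AL vtop_vtop)
  also have "\<dots> \<longleftrightarrow> g - g' \<in> N" using all_vtop_N vtop_N by blast
  finally show ?thesis .
qed

abbreviation Gr where "Gr \<equiv> gr_B_bar chi \<I> \<tau> c"

lemma Gr_carrier: "carrier Gr = gr_rep ` A"
proof
  show "gr_rep ` A \<subseteq> carrier Gr"
  proof (intro image_subsetI)
    fix g assume g: "g \<in> A"
    then obtain n where n: "g \<in> AL n" using AL_exists by blast
    have "{m. gr_rep g m \<noteq> below m} \<subseteq> {..<n}"
    proof clarify
      fix m assume "gr_rep g m \<noteq> below m"
      then have "vtop m g \<noteq> 0" by (auto simp: gr_rep_def coset_zero)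
      then show "m < n" using vtop_AL_zero[OF AL_mono[OF n, of m]] by (cases "m < n") auto
    qed
    then have "finite {m. gr_rep g m \<noteq> below m}" by (rule finite_subset) simp
    moreover have "\<exists>x\<in>Fil m. gr_rep g m = below m +>\<^bsub>Bbar_alg\<^esub> x" for m
      using vtop_AL[OF g] by (auto simp: Fil_eq gr_rep_def coset_def)
    ultimately show "gr_rep g \<in> carrier Gr" by (simp add: gr_B_bar_def gr_alg_def)
  qed
  show "carrier Gr \<subseteq> gr_rep ` A"
  proof
    fix f assume f: "f \<in> carrier Gr"
    then have "\<forall>m. \<exists>a\<in>AL (Suc m). f m = coset m a"
      by (auto simp: gr_B_bar_def gr_alg_def Fil_eq coset_def)
    then obtain a where a: "\<And>m. a m \<in> AL (Suc m)" "\<And>m. f m = coset m (a m)" by metis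
    let ?S = "{m. f m \<noteq> below m}"
    have S: "finite ?S" using f by (simp add: gr_B_bar_def gr_alg_def)
    \<comment> \<open>The top components of the chosen representatives are glued together, which the
      finite support permits.\<close>
    define g where "g = (\<Sum>m\<in>?S. vtop m (a m))"
    have gA: "g \<in> A" unfolding g_def using a by (intro pm.subspace_sum A_subspace vtop_A AL_A)
    have top: "vtop m g = (if m \<in> ?S then vtop m (a m) else 0)" for m
      unfolding g_def plin_sum[OF plin_vtop] using S by (simp add: vtop_vtop)
    have "f m = gr_rep g m" for m
    proof (cases "m \<in> ?S")
      case True
      then show ?thesis
        unfolding gr_rep_def top using a vtop_AL[OF AL_A[OF a(1)], of m]
        by (simp add: coset_eq_iff vtop_vtop)
    next
      case False
      then show ?thesis unfolding gr_rep_def top by (simp add: coset_zero)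
    qed
    with gA show "f \<in> gr_rep ` A" by blast
  qed
qed

lemma gr_rep_class: "a \<in> AL (Suc m) \<Longrightarrow> gr_B_bar_class chi \<I> \<tau> c m (Lp a) = gr_rep (vtop m a)"
proof
  fix l assume a: "a \<in> AL (Suc m)"
  show "gr_B_bar_class chi \<I> \<tau> c m (Lp a) l = gr_rep (vtop m a) l"
  proof (cases "l = m")
    case True
    then show ?thesis
      using a vtop_AL[OF AL_A[OF a], of m]
      by (simp add: gr_B_bar_class_def gr_class_def gr_rep_def coset_def[symmetric] vtop_vtop coset_eq_iff)
  next
    case False
    have "below l +>\<^bsub>Bbar_alg\<^esub> \<zero>\<^bsub>Bbar_alg\<^esub> = coset l 0"
      by (simp add: coset_def Lp_zero Bbar_alg_simps)
    with False show ?thesis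
      by (simp add: gr_B_bar_class_def gr_class_def gr_rep_def vtop_vtop)
  qed
qed

lemma gr_rep_add:
  assumes "g \<in> A" "g' \<in> A"
  shows "gr_rep g \<oplus>\<^bsub>Gr\<^esub> gr_rep g' = gr_rep (g + g')"
proof
  fix m
  let ?a = "vtop m g" and ?a' = "vtop m g'"
  have a: "?a \<in> A" "?a' \<in> A" using assms vtop_A by auto
  have "coset m ?a <+>\<^bsub>Bbar_alg\<^esub> coset m ?a' = coset m (?a + ?a')"
  proof (intro equalityI subsetI)
    fix x assume "x \<in> coset m ?a <+>\<^bsub>Bbar_alg\<^esub> coset m ?a'"
    then obtain b b' where b: "b \<in> AL m" "b' \<in> AL m" and x: "x = Lp (b + ?a) \<oplus>\<^bsub>\<H>\<^esub> Lp (b' + ?a')"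
      using a by (auto simp: set_add_def' coset_eq Bbar_alg_simps)
    have "x = Lp ((b + b') + (?a + ?a'))"
      using a b unfolding x by (simp add: Lp_add[symmetric] AL_V A_V add_ac)
    then show "x \<in> coset m (?a + ?a')" using a AL_add[OF b] by (auto simp: coset_eq)
  next
    fix x assume "x \<in> coset m (?a + ?a')"
    then obtain b where b: "b \<in> AL m" "x = Lp (b + (?a + ?a'))" using a by (auto simp: coset_eq)
    then have "x = Lp (b + ?a) \<oplus>\<^bsub>\<H>\<^esub> Lp (0 + ?a')"
      using a by (simp add: Lp_add[symmetric] AL_V A_V add_ac)
    moreover have "Lp (b + ?a) \<in> coset m ?a" "Lp (0 + ?a') \<in> coset m ?a'"
      unfolding coset_eq[OF a(1)] coset_eq[OF a(2)] using b(1) AL_zero by blast+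
    ultimately show "x \<in> coset m ?a <+>\<^bsub>Bbar_alg\<^esub> coset m ?a'"
      unfolding set_add_def' Bbar_alg_simps by blast
  qed
  then show "(gr_rep g \<oplus>\<^bsub>Gr\<^esub> gr_rep g') m = gr_rep (g + g') m"
    by (simp add: gr_B_bar_def gr_alg_def gr_rep_def)
qed

lemma gr_rep_smult:
  assumes g: "g \<in> A"
  shows "d \<odot>\<^bsub>Gr\<^esub> gr_rep g = gr_rep (pm_scale d g)"
proof
  fix m
  let ?a = "vtop m g"
  have a: "?a \<in> A" "?a \<in> AL (Suc m)" using g vtop_A vtop_AL by auto
  have "below m +>\<^bsub>Bbar_alg\<^esub> (d \<odot>\<^bsub>\<H>\<^esub> x) = coset m (pm_scale d ?a)" if x: "x \<in> coset m ?a" for x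
  proof -
    from x a obtain b where b: "b \<in> AL m" "x = Lp (b + ?a)" by (auto simp: coset_eq)
    then have "d \<odot>\<^bsub>\<H>\<^esub> x = Lp (pm_scale d b + pm_scale d ?a)"
      using a by (simp add: Lp_scale[symmetric] AL_V A_V pm.scale_right_distrib)
    then show ?thesis
      using a b coset_absorb[OF AL_scale[OF a(2)] AL_scale[OF b(1)], of d d] by (simp add: coset_def)
  qed
  moreover have "AL m \<noteq> {}" using AL_zero by blast
  then have "coset m ?a \<noteq> {}" using a by (simp add: coset_eq)
  ultimately show "(d \<odot>\<^bsub>Gr\<^esub> gr_rep g) m = gr_rep (pm_scale d g) m"
    by (simp add: gr_B_bar_def gr_alg_def gr_rep_def Bbar_alg_simps)
qed

lemma gr_rep_one: "\<one>\<^bsub>Gr\<^esub> = gr_rep vac"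
  using gr_rep_class[of vac 0]
  by (simp add: gr_B_bar_def gr_alg_def gr_B_bar_class_def Lp_vac Bbar_alg_simps AL_def vtop_bv)

text \<open>The product of \<open>H\<^sub>\<theta> \<ltimes> U\<^sup>-\<close>.\<close>

definition sprod :: "('i pbw \<Rightarrow>\<^sub>0 'k) \<Rightarrow> ('i pbw \<Rightarrow>\<^sub>0 'k) \<Rightarrow> ('i pbw \<Rightarrow>\<^sub>0 'k)" where
  "sprod g g' = lext (\<lambda>(w, l, v). lext (\<lambda>(w', l', v'). pm_scale (chi l' (word_deg v)) (bv (0, l + l', v + v'))) g') g"

lemma sprod_bv: "sprod (bv (w, l, v)) (bv (w', l', v')) = pm_scale (chi l' (word_deg v)) (bv (0, l + l', v + v'))"
  by (simp add: sprod_def)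

lemma plin_sprod1: "plin (\<lambda>g. sprod g g')"
  by (simp add: sprod_def)

lemma plin_sprod2: "plin (sprod g)"
  by (simp add: plin_def sprod_def case_prod_unfold lext_fun_add lext_fun_scale)

lemma sprod_A: "g \<in> A \<Longrightarrow> g' \<in> A \<Longrightarrow> sprod g g' \<in> A"
  by (rule A_induct[OF plin_sprod1 A_subspace]; (rule A_induct[OF plin_sprod2 A_subspace])?)
    (auto simp: sprod_bv)

lemma pi_FW_ell: "pi (bv (map_fmon F u) * ell a) = pi (ell (FW u a))"
proof (induction u rule: fmon_induct)
  case (Cons i u)
  have "pi (bv (map_fmon F (FMon [i] + u)) * ell a) = pi (fgen (F i) * (bv (map_fmon F u) * ell a))"
    by (simp add: fgen_bv bv_mult mult.assoc[symmetric])
  also have "\<dots> = pi (fgen (F i) * ell (FW u a))" by (intro pi_mult_cong Cons refl)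
  also have "\<dots> = pi (ell (FF 1 i (FW u a)))" by (rule pi_F_ell)
  finally show ?case by simp
qed simp

lemma pi_ellt_mult:
  assumes g: "g \<in> A" "g' \<in> A"
  shows "pi (ellt g * ellt g') = pi (ellt (sprod g g'))"
proof -
  have basis: "pi (ell (bv (0, l, v)) * ell (bv (0, l', v'))) = pi (ell (sprod (bv (0, l, v)) (bv (0, l', v'))))" for l l' v v'
  proof -
    have "pi (ell (bv (0, l, v)) * ell (bv (0, l', v'))) = pi (kk l * (bv (map_fmon F v) * ell (bv (0, l', v'))))"
      by (simp add: ell_bv mult.assoc)
    also have "\<dots> = pi (kk l * ell (FW v (bv (0, l', v'))))" by (intro pi_mult_cong pi_FW_ell refl)
    also have "\<dots> = pi (ell (KK l (FW v (bv (0, l', v')))))" by (rule pi_kk_ell)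
    finally show ?thesis by (simp add: FW_highest sprod_bv add.commute)
  qed
  have "pi (ell g * ell g') = pi (ell (sprod g g'))"
  proof (rule pi_plin_eqI[where a = g and f = "\<lambda>g. ell g * ell g'"], goal_cases)
    case (3 x)
    obtain w l v where x: "x = (w, l, v)" "w = 0" using supp_spaceD[OF g(1)[unfolded A_def] 3] by (cases x) auto
    show ?case
    proof (rule pi_plin_eqI[where a = g' and f = "\<lambda>g'. ell (bv x) * ell g'"], goal_cases)
      case (3 y)
      obtain w' l' v' where y: "y = (w', l', v')" "w' = 0"
        using supp_spaceD[OF g(2)[unfolded A_def] 3] by (cases y) auto
      show ?case using basis by (simp add: x y)
    qed (auto intro: plin_comp[OF plin_ell plin_sprod2])
  qed (auto intro: plin_comp[OF plin_ell plin_sprod1])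
  moreover have "pi (ellt g * ellt g') = pi (ell g * ell g')"
    using g by (intro pi_mult_cong pi_ellt A_V)
  ultimately show ?thesis using g by (simp add: pi_ellt A_V sprod_A)
qed

lemma vtop_sprod:
  assumes g: "g \<in> A" "g' \<in> A"
  shows "vtop m (sprod g g') = (\<Sum>i\<le>m. sprod (vtop i g) (vtop (m - i) g'))"
proof (rule plin_eqI[where a = g and f = "\<lambda>g. vtop m (sprod g g')"], goal_cases)
  case (3 x)
  obtain w l v where x: "x = (w, l, v)" "w = 0" using supp_spaceD[OF g(1)[unfolded A_def] 3] by (cases x) auto
  show ?case
  proof (rule plin_eqI[where a = g' and f = "\<lambda>g'. vtop m (sprod (bv x) g')"], goal_cases)
    case (3 y)
    obtain w' l' v' where y: "y = (w', l', v')" "w' = 0"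
      using supp_spaceD[OF g(2)[unfolded A_def] 3] by (cases y) auto
    let ?p = "length (letters v)" and ?q = "length (letters v')"
    let ?s = "sprod (bv x) (bv y)"
    have "(\<Sum>i\<le>m. sprod (vtop i (bv x)) (vtop (m - i) (bv y))) = (\<Sum>i\<le>m. if i = ?p then (if m - i = ?q then ?s else 0) else 0)"
      by (rule sum.cong) (auto simp: x y vtop_bv plin_0[OF plin_sprod1] plin_0[OF plin_sprod2])
    also have "\<dots> = (if ?p \<le> m \<and> m - ?p = ?q then ?s else 0)"
      by (simp add: sum.delta)
    also have "\<dots> = vtop m ?s" by (auto simp: x y sprod_bv vtop_bv)
    finally show ?case ..
  qed (auto intro!: plin_comp[OF plin_vtop plin_sprod2] plin_sum_fun plin_comp[OF plin_sprod2 plin_vtop])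
qed (auto intro!: plin_comp[OF plin_vtop plin_sprod1] plin_sum_fun plin_comp[OF plin_sprod1 plin_vtop])

lemma Lp_sum: "finite S \<Longrightarrow> (\<And>i. i \<in> S \<Longrightarrow> e i \<in> A) \<Longrightarrow> finsum Bbar_alg (\<lambda>i. Lp (e i)) S = Lp (sum e S)"
proof -
  assume S: "finite S" and e: "\<And>i. i \<in> S \<Longrightarrow> e i \<in> A"
  have "\<forall>i\<in>S. \<exists>h. h \<in> PB \<and> Lp (e i) = Pi h" using e B_bar_Lp[unfolded B_bar_eq] by blast
  from bchoice[OF this] obtain h where h: "\<And>i. i \<in> S \<Longrightarrow> h i \<in> PB \<and> Lp (e i) = Pi (h i)" by blast
  have "finsum Bbar_alg (\<lambda>i. Lp (e i)) S = finsum Bbar_alg (\<lambda>i. Pi (h i)) S"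
    by (rule Bb.finsum_cong') (use h in auto)
  also have "\<dots> = Pi (sum h S)" using h S by (intro Bb.finsum_p) auto
  also have "\<dots> = Pi (\<Sum>i\<in>S. ellt (Theta (e i)))"
    using h e PB_PP by (intro He.p_sum_cong) (auto simp: Lp_def A_V)
  also have "\<dots> = Lp (sum e S)" by (simp add: Lp_def plin_sum[OF plin_Theta] plin_sum[OF plin_ellt])
  finally show ?thesis .
qed

lemma gr_rep_mult:
  assumes g: "g \<in> A" "g' \<in> A"
  shows "gr_rep g \<otimes>\<^bsub>Gr\<^esub> gr_rep g' = gr_rep (sprod g g')"
proof
  fix m
  let ?X = "{x. \<forall>i. x i \<in> gr_rep g i}" and ?Y = "{y. \<forall>i. y i \<in> gr_rep g' i}"
  have rep: "\<exists>a. a \<in> AL (Suc i) \<and> x = Lp a \<and> vtop i a = vtop i h" if "x \<in> gr_rep h i" "h \<in> A" for x h i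
  proof -
    from that obtain b where b: "b \<in> AL i" "x = Lp (b + vtop i h)" by (auto simp: gr_rep_def coset_eq vtop_A)
    with that vtop_AL[of h i] show ?thesis
      by (intro exI[of _ "b + vtop i h"]) (auto simp: vtop_AL_zero vtop_vtop intro!: AL_add elim: AL_mono)
  qed
  \<comment> \<open>The product in \<open>gr_alg\<close> is a union over all families of
    representatives. Every family gives the same coset, since the length-\<open>m\<close> component
    of the sum depends modulo \<open>N\<close> only on the top components of the factors.\<close>
  have const: "below m +>\<^bsub>Bbar_alg\<^esub> finsum Bbar_alg (\<lambda>i. x i \<otimes>\<^bsub>Bbar_alg\<^esub> y (m - i)) {..m} = gr_rep (sprod g g') m"
    if x: "x \<in> ?X" and y: "y \<in> ?Y" for x y
  proof -
    have "\<forall>i. \<exists>a. a \<in> AL (Suc i) \<and> x i = Lp a \<and> vtop i a = vtop i g" using x g rep by blast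
    then obtain a where a: "\<And>i. a i \<in> AL (Suc i)" "\<And>i. x i = Lp (a i)" "\<And>i. vtop i (a i) = vtop i g" by metis
    have "\<forall>i. \<exists>a. a \<in> AL (Suc i) \<and> y i = Lp a \<and> vtop i a = vtop i g'" using y g rep by blast
    then obtain b where b: "\<And>i. b i \<in> AL (Suc i)" "\<And>i. y i = Lp (b i)" "\<And>i. vtop i (b i) = vtop i g'" by metis
    have "\<forall>i. \<exists>e\<in>AL (Suc (i + (m - i))). x i \<otimes>\<^bsub>\<H>\<^esub> y (m - i) = Lp e \<and>
        pi (top_part (i + (m - i)) e) = pi (top_part i (a i) * top_part (m - i) (b (m - i)))"
      using Lp_mult_top_AL[OF a(1) b(1)] a b by simp
    then obtain e where e: "\<And>i. e i \<in> AL (Suc (i + (m - i)))" "\<And>i. x i \<otimes>\<^bsub>\<H>\<^esub> y (m - i) = Lp (e i)"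
        "\<And>i. pi (top_part (i + (m - i)) (e i)) = pi (top_part i (a i) * top_part (m - i) (b (m - i)))" by metis
    let ?e = "\<Sum>i\<le>m. e i"
    have eA: "e i \<in> AL (Suc m)" if "i \<le> m" for i using e(1)[of i] that by simp
    then have eS: "?e \<in> AL (Suc m)" by (intro pm.subspace_sum AL_subspace) auto
    have fs: "finsum Bbar_alg (\<lambda>i. x i \<otimes>\<^bsub>Bbar_alg\<^esub> y (m - i)) {..m} = Lp ?e"
      unfolding Bbar_alg_simps e(2) by (rule Lp_sum) (auto intro: AL_A[OF eA])
    have "pi (ellt (vtop m ?e)) = pi (\<Sum>i\<le>m. top_part m (e i))"
      by (simp add: top_part_def plin_sum[OF plin_vtop] plin_sum[OF plin_ellt])
    also have "\<dots> = pi (\<Sum>i\<le>m. ellt (sprod (vtop i g) (vtop (m - i) g')))"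
    proof (rule U.p_sum_cong)
      fix i assume "i \<in> {..m}"
      then have "pi (top_part m (e i)) = pi (ellt (vtop i g) * ellt (vtop (m - i) g'))"
        using e(3)[of i] a b by (simp add: top_part_def)
      then show "top_part m (e i) \<in> UNIV \<and> ellt (sprod (vtop i g) (vtop (m - i) g')) \<in> UNIV \<and>
          pi (top_part m (e i)) = pi (ellt (sprod (vtop i g) (vtop (m - i) g')))"
        using g by (simp add: pi_ellt_mult vtop_A)
    qed
    also have "\<dots> = pi (ellt (vtop m (sprod g g')))"
      using g by (simp add: vtop_sprod plin_sum[OF plin_ellt])
    finally have "vtop m ?e - vtop m (sprod g g') \<in> N"
      using AL_A[OF eS] g by (simp add: pi_ellt_eq_iff A_V vtop_A sprod_A)
    then have "coset m ?e = coset m (vtop m (sprod g g'))"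
      using eS vtop_AL[OF sprod_A[OF g], of m] by (simp add: coset_eq_iff vtop_vtop)
    then show ?thesis unfolding fs by (simp add: coset_def gr_rep_def)
  qed
  have mem: "Lp (0 + vtop i h) \<in> gr_rep h i" if "h \<in> A" for h i
    unfolding gr_rep_def coset_eq[OF vtop_A[OF that]] by (rule imageI) simp
  \<comment> \<open>Families of representatives exist, so the union is not over an empty index
    set.\<close>
  have "(\<lambda>i. Lp (0 + vtop i h)) \<in> {x. \<forall>i. x i \<in> gr_rep h i}" if "h \<in> A" for h
    using mem[OF that] by simp
  then have "{x. \<forall>i. x i \<in> gr_rep h i} \<noteq> {}" if "h \<in> A" for h
    using that by (rule_tac notI, drule_tac equals0D[where a = "\<lambda>i. Lp (0 + vtop i h)"]) auto
  then have "?X \<noteq> {}" "?Y \<noteq> {}" using g by auto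
  with const have "(\<Union>x\<in>?X. \<Union>y\<in>?Y. below m +>\<^bsub>Bbar_alg\<^esub> finsum Bbar_alg (\<lambda>i. x i \<otimes>\<^bsub>Bbar_alg\<^esub> y (m - i)) {..m})
      = gr_rep (sprod g g') m" by auto
  then show "(gr_rep g \<otimes>\<^bsub>Gr\<^esub> gr_rep g') m = gr_rep (sprod g g') m"
    by (simp add: gr_B_bar_def gr_alg_def)
qed

lemma ellt_PHU: "a \<in> A \<Longrightarrow> ellt a \<in> PHU"
proof (rule A_induct[OF plin_ellt])
  show "pm.subspace PHU" by (simp add: PHU_def pm_subspace_subalg)
  fix l v assume "l \<in> Lth"
  then have "kkt l \<in> PHU" "bv (map_fmon F v) \<in> PHU"
    using kkt[of l] Fword_PF[of v] by (auto simp: PHU_def intro: subalg.gen)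
  then show "ellt (bv (0, l, v)) \<in> PHU" by (simp add: ellt_bv PHU_def subalg.mult)
qed

lemma subalg_act_A:
  assumes gen: "\<And>g a. g \<in> G \<Longrightarrow> a \<in> A \<Longrightarrow> \<exists>b\<in>A. pi (g * ellt a) = pi (ellt b)"
    and "f \<in> subalg G" "a \<in> A"
  shows "\<exists>b\<in>A. pi (f * ellt a) = pi (ellt b)"
  using assms(2,3)
proof (induction arbitrary: a rule: subalg.induct)
  case (gen g)
  then show ?case using assms(1) by blast
next
  case (add f g)
  then obtain b b' where b: "b \<in> A" "pi (f * ellt a) = pi (ellt b)" "b' \<in> A" "pi (g * ellt a) = pi (ellt b')" by meson
  from pi_add_cong[OF b(2,4)] b show ?case by (intro bexI[of _ "b + b'"]) (auto simp: distrib_right)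
next
  case (mult f g)
  then obtain b where b: "b \<in> A" "pi (g * ellt a) = pi (ellt b)" by meson
  with mult obtain b' where "b' \<in> A" "pi (f * ellt b) = pi (ellt b')" by meson
  then show ?case using pi_mult_cong[OF refl b(2), of f] by (auto simp: mult.assoc)
next
  case (scale f d)
  then obtain b where b: "b \<in> A" "pi (f * ellt a) = pi (ellt b)" by meson
  from pi_scale_cong[OF b(2), of d] b show ?case by (intro bexI[of _ "pm_scale d b"]) (auto simp: pm_scale_mult_left)
qed auto

lemma HU_carrier: "carrier (HU chi \<I> \<tau>) = (\<lambda>a. pi (ellt a)) ` A"
proof -
  have F: "\<exists>b\<in>A. pi (f * ellt a) = pi (ellt b)" if "f \<in> PF" "a \<in> A" for f a
    using that unfolding PF_def
  proof (rule subalg_act_A[rotated])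
    fix g a assume "g \<in> range (\<lambda>i. fgen (F i) :: ('i generator, 'k) free_alg)" "a \<in> A"
    then show "\<exists>b\<in>A. pi (g * ellt a) = pi (ellt b)" using pi_F_ellt FF_A by blast
  qed
  have "\<exists>b\<in>A. pi f = pi (ellt b)" if "f \<in> PHU" for f
  proof -
    have "\<exists>b\<in>A. pi (f * ellt vac) = pi (ellt b)"
      using that unfolding PHU_def
    proof (rule subalg_act_A[rotated])
      fix g a assume "g \<in> PH \<union> PF" "a \<in> A"
      then show "\<exists>b\<in>A. pi (g * ellt a) = pi (ellt b)" using F rho_PH(2,6) A_V by blast
    qed simp
    then show ?thesis using pi_mult_cong[OF refl pi_ellt_unit, of f] by simp
  qed
  then show ?thesis unfolding HU.carrier_eq using ellt_PHU by fastforce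
qed

section \<open>The graded homomorphism: existence, uniqueness, bijectivity\<close>

definition phi0 :: "(nat \<Rightarrow> ('i, 'k) U_elt set set) \<Rightarrow> ('i, 'k) U_elt" where
  "phi0 f = pi (ellt (SOME g. g \<in> A \<and> f = gr_rep g))"

lemma phi0_grep: "g \<in> A \<Longrightarrow> phi0 (gr_rep g) = pi (ellt g)"
proof -
  assume g: "g \<in> A"
  define h where "h = (SOME h. h \<in> A \<and> gr_rep g = gr_rep h)"
  have h: "h \<in> A" "gr_rep h = gr_rep g"
    using someI[of "\<lambda>h. h \<in> A \<and> gr_rep g = gr_rep h" g] g by (auto simp: h_def)
  then have "h - g \<in> N" using g by (simp add: gr_rep_eq_iff)
  then show ?thesis using g h(1) by (simp add: phi0_def h_def[symmetric] pi_ellt_eq_iff A_V)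
qed

lemma kappa_B_gen: "kappa chi \<I> \<tau> (B_gen chi \<I> \<tau> c i) = Lp (bv (0, 0, FMon [i]))"
  using bgen_Lp[of vac i] by (simp add: B_gen_eq kappa_pi Lp_vac FF_bv RR_bv)

lemma kappa_PH: "h \<in> PH \<Longrightarrow> kappa chi \<I> \<tau> (pi h) = Lp (rho h vac)"
  using PH_Lp[of h vac] PH_PP by (auto simp: kappa_pi Lp_vac)

lemma pi_PH: "h \<in> PH \<Longrightarrow> pi h = pi (ellt (rho h vac))"
  using rho_PH(6)[of h vac] pi_mult_cong[OF refl pi_ellt_unit, of h] by simp

lemma class_B_gen: "gr_B_bar_class chi \<I> \<tau> c 1 (kappa chi \<I> \<tau> (B_gen chi \<I> \<tau> c i)) = gr_rep (bv (0, 0, FMon [i]))"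
  unfolding kappa_B_gen by (subst gr_rep_class) (simp_all add: AL_def vtop_bv)

lemma class_PH: "h \<in> PH \<Longrightarrow> gr_B_bar_class chi \<I> \<tau> c 0 (kappa chi \<I> \<tau> (pi h)) = gr_rep (rho h vac)"
  by (subst kappa_PH, assumption, subst gr_rep_class) (simp_all add: AL_def rho_PH vtop_bv)

lemma pi_F: "pi (fgen (F i)) = pi (ellt (bv (0, 0, FMon [i])))"
  using pi_F_ellt[of vac i] pi_mult_cong[OF refl pi_ellt_unit, of "fgen (F i)"] by (simp add: FF_bv)

lemma foldr_F: "foldr (\<lambda>i x. U_gen chi \<I> (F i) \<otimes>\<^bsub>U_alg chi \<I>\<^esub> x) w \<one>\<^bsub>U_alg chi \<I>\<^esub> = pi (bv (map_fmon F (FMon w)))"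
proof (induction w)
  case Nil
  then show ?case by (simp add: U.p_one)
next
  case (Cons i w)
  have "pi (fgen (F i) * bv (map_fmon F (FMon w))) = pi (bv (map_fmon F (FMon (i # w))))"
    by (simp add: fgen_bv bv_mult)
  then show ?case using Cons by (simp add: U_gen_eq U.p_mult)
qed

lemma HU_component_mem:
  assumes "a \<in> AL (Suc m)"
  shows "pi (ellt (vtop m a)) \<in> HU_component chi \<I> \<tau> m"
proof -
  let ?C = "HU_component chi \<I> \<tau> m"
  have sub: "pm.subspace {f. pi f \<in> ?C}"
    unfolding pm.subspace_def HU_component_def
    by (auto simp: U.p_zero U.p_add U.p_scale intro: lin_span.intros)
  have "ellt (vtop m a) \<in> {f. pi f \<in> ?C}"
  proof (rule A_induct[OF _ sub AL_A[OF assms]])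
    fix l v assume l: "l \<in> Lth"
    show "ellt (vtop m (bv (0, l, v))) \<in> {f. pi f \<in> ?C}"
    proof (cases "length (letters v) = m")
      case True
      have "pi (ellt (bv (0, l, v))) = pi (kkt l) \<otimes>\<^bsub>U_alg chi \<I>\<^esub>
          foldr (\<lambda>i x. U_gen chi \<I> (F i) \<otimes>\<^bsub>U_alg chi \<I>\<^esub> x) (letters v) \<one>\<^bsub>U_alg chi \<I>\<^esub>"
        unfolding foldr_F by (simp add: ellt_bv U.p_mult)
      moreover have "pi (kkt l) \<in> Htheta chi \<I> \<tau>" unfolding Htheta_eq using kkt[OF l] by blast
      ultimately show ?thesis
        using True unfolding HU_component_def by (auto simp: vtop_bv intro!: lin_span.base)
    next
      case False
      then show ?thesis using pm.subspace_0[OF sub] by (simp add: vtop_bv)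
    qed
  qed simp
  then show ?thesis by simp
qed

lemma is_phi_bar_phi0: "is_phi_bar chi \<I> \<tau> c phi0"
proof -
  have "phi0 \<in> ring_hom Gr (HU chi \<I> \<tau>)"
  proof (rule ring_hom_memI)
    fix x assume "x \<in> carrier Gr"
    then show "phi0 x \<in> carrier (HU chi \<I> \<tau>)" by (auto simp: Gr_carrier HU_carrier phi0_grep)
  next
    fix x y assume "x \<in> carrier Gr" "y \<in> carrier Gr"
    then obtain g g' where g: "g \<in> A" "g' \<in> A" "x = gr_rep g" "y = gr_rep g'" by (auto simp: Gr_carrier)
    show "phi0 (x \<otimes>\<^bsub>Gr\<^esub> y) = phi0 x \<otimes>\<^bsub>HU chi \<I> \<tau>\<^esub> phi0 y"
      using g by (simp add: gr_rep_mult phi0_grep sprod_A HU_simps U.p_mult[symmetric] pi_ellt_mult)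
    show "phi0 (x \<oplus>\<^bsub>Gr\<^esub> y) = phi0 x \<oplus>\<^bsub>HU chi \<I> \<tau>\<^esub> phi0 y"
      using g by (simp add: gr_rep_add phi0_grep HU_simps U.p_add)
  next
    show "phi0 \<one>\<^bsub>Gr\<^esub> = \<one>\<^bsub>HU chi \<I> \<tau>\<^esub>"
      by (simp add: gr_rep_one phi0_grep pi_ellt_unit HU_simps U.p_one)
  qed
  moreover have "phi0 (d \<odot>\<^bsub>Gr\<^esub> x) = d \<odot>\<^bsub>HU chi \<I> \<tau>\<^esub> phi0 x" if "x \<in> carrier Gr" for d x
    using that by (auto simp: Gr_carrier gr_rep_smult phi0_grep HU_simps U.p_scale)
  ultimately have "phi0 \<in> alg_hom Gr (HU chi \<I> \<tau>)" by (simp add: alg_hom_def)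
  moreover have "phi0 (gr_B_bar_class chi \<I> \<tau> c m x) \<in> HU_component chi \<I> \<tau> m" if "x \<in> Fil m" for m x
    using that HU_component_mem by (auto simp: Fil_eq gr_rep_class phi0_grep vtop_A AL_A)
  moreover have "phi0 (gr_B_bar_class chi \<I> \<tau> c 1 (kappa chi \<I> \<tau> (B_gen chi \<I> \<tau> c i))) = U_gen chi \<I> (F i)" for i
    unfolding class_B_gen by (simp add: phi0_grep U_gen_eq pi_F)
  moreover have "phi0 (gr_B_bar_class chi \<I> \<tau> c 0 (kappa chi \<I> \<tau> h)) = h" if "h \<in> Htheta chi \<I> \<tau>" for h
    using that by (auto simp only: Htheta_eq class_PH phi0_grep rho_PH bv_A Lth.zero pi_PH[symmetric])
  ultimately show ?thesis by (simp add: is_phi_bar_def)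
qed

text \<open>The prescribed values on \<open>H\<^sub>\<theta>\<close> and the \<open>F_j\<close>
  extend along \<open>sprod\<close> to the products \<open>K_l F_v\<close> and then linearly. So
  every such map is the one induced by \<open>ellt\<close>, whose kernel is again
  \<open>N\<close>.\<close>

lemma is_phi_bar_unique:
  assumes phi: "is_phi_bar chi \<I> \<tau> c \<phi>" and g: "g \<in> A"
  shows "\<phi> (gr_rep g) = pi (ellt g)"
proof -
  have hom: "\<phi> \<in> ring_hom Gr (HU chi \<I> \<tau>)"
    and sm: "\<And>d x. x \<in> carrier Gr \<Longrightarrow> \<phi> (d \<odot>\<^bsub>Gr\<^esub> x) = d \<odot>\<^bsub>U_alg chi \<I>\<^esub> \<phi> x"
    using phi by (auto simp: is_phi_bar_def alg_hom_def HU_simps)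
  have gc: "gr_rep a \<in> carrier Gr" if "a \<in> A" for a using that by (auto simp: Gr_carrier)
  have mult: "\<phi> (gr_rep (sprod a b)) = pi (ellt (sprod a b))"
    if "a \<in> A" "b \<in> A" "\<phi> (gr_rep a) = pi (ellt a)" "\<phi> (gr_rep b) = pi (ellt b)" for a b
    using ring_hom_mult[OF hom gc gc, of a b] that
    by (simp add: gr_rep_mult HU_simps U.p_mult[symmetric] pi_ellt_mult)
  have K: "\<phi> (gr_rep (bv (0, l, 0))) = pi (ellt (bv (0, l, 0)))" if l: "l \<in> Lth" for l
  proof -
    have k: "kkt l \<in> PH" "pi (kkt l) = pi (kk l)" using kkt[OF l] by auto
    have "pi (ellt (bv (0, l, 0))) = pi (kkt l)" by (simp add: ellt_bv)
    also have "pi (kkt l) = pi (ellt (rho (kkt l) vac))" by (rule pi_PH[OF k(1)])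
    finally have e: "pi (ellt (bv (0, l, 0))) = pi (ellt (rho (kkt l) vac))" .
    have "rho (kkt l) vac \<in> A" using k(1) by (simp add: rho_PH)
    \<comment> \<open>\<open>kkt l\<close> is only some representative of \<open>K_l\<close>, so its
      action on the unit vector is identified modulo \<open>N\<close>.\<close>
    with e l have "bv (0, l, 0) - rho (kkt l) vac \<in> N" by (simp add: pi_ellt_eq_iff A_V)
    then have "gr_rep (bv (0, l, 0)) = gr_rep (rho (kkt l) vac)"
      using l \<open>rho (kkt l) vac \<in> A\<close> by (simp add: gr_rep_eq_iff)
    moreover have "\<phi> (gr_B_bar_class chi \<I> \<tau> c 0 (kappa chi \<I> \<tau> (pi (kkt l)))) = pi (kkt l)"
      using phi k(1) by (auto simp: is_phi_bar_def Htheta_eq)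
    ultimately show ?thesis using k(1) by (simp add: class_PH ellt_bv)
  qed
  have F: "\<phi> (gr_rep (bv (0, 0, FMon [j]))) = pi (ellt (bv (0, 0, FMon [j])))" for j
  proof -
    have "\<phi> (gr_B_bar_class chi \<I> \<tau> c 1 (kappa chi \<I> \<tau> (B_gen chi \<I> \<tau> c j))) = U_gen chi \<I> (F j)"
      using phi unfolding is_phi_bar_def by blast
    then show ?thesis unfolding class_B_gen U_gen_eq pi_F .
  qed
  have V: "\<phi> (gr_rep (bv (0, 0, v))) = pi (ellt (bv (0, 0, v)))" for v
  proof (induction v rule: fmon_induct)
    case 0 then show ?case using K[of 0] by simp
  next
    case (Cons j v)
    then show ?case using mult[OF _ _ F Cons, of j] by (simp add: sprod_bv)
  qed
  have basis: "\<phi> (gr_rep (bv (0, l, v))) = pi (ellt (bv (0, l, v)))" if "l \<in> Lth" for l v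
    using mult[OF _ _ K[OF that] V, of v] that by (simp add: sprod_bv)
  have "g \<in> A \<and> \<phi> (gr_rep g) = pi (ellt g)"
  proof (induction g rule: pm_induct)
    case zero then show ?case using sm[OF gc[of vac], of 0] V[of 0]
      by (simp add: gr_rep_smult U.p_scale[symmetric])
  next
    case (scale d f) then show ?case using sm[OF gc[of f], of d]
      by (simp add: gr_rep_smult U.p_scale)
  next
    case (add f h) then show ?case using ring_hom_add[OF hom gc gc, of f h]
      by (simp add: gr_rep_add HU_simps U.p_add)
  next
    case (single x)
    then show ?case using supp_spaceD[OF g[unfolded A_def] single] basis by (cases x) auto
  qed
  then show ?thesis by blast
qed

lemma is_phi_bar_bij:
  assumes "is_phi_bar chi \<I> \<tau> c \<phi>"
  shows "bij_betw \<phi> (carrier Gr) (carrier (HU chi \<I> \<tau>))"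
proof (rule bij_betw_imageI)
  show "inj_on \<phi> (carrier Gr)"
    unfolding Gr_carrier
    by (auto simp: inj_on_def is_phi_bar_unique[OF assms] gr_rep_eq_iff pi_ellt_eq_iff A_V)
  show "\<phi> ` carrier Gr = carrier (HU chi \<I> \<tau>)"
    unfolding Gr_carrier HU_carrier image_image using is_phi_bar_unique[OF assms] by auto
qed

end

section \<open>The Iwasawa decomposition\<close>

context nichols_involution
begin

lemma Gplus_bar_eq: "Gplus_bar chi \<I> \<tau> = Pi ` PX"
proof -
  have "range (\<lambda>i. kappa chi \<I> \<tau> (EKinv chi \<I> i)) = Pi ` range xgen" by (auto simp: EKinv_eq kappa_pi)
  then show ?thesis using He.gen_subalg_image[of "range xgen"] by (auto simp: Gplus_bar_def PX_def)
qed

abbreviation Gbar_alg where "Gbar_alg \<equiv> restrict_carrier (\<H>) (Gplus_bar chi \<I> \<tau>)"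

lemma Gbar_carrier: "carrier Gbar_alg = Pi ` PX" and Bbar_carrier: "carrier Bbar_alg = Lp ` A"
  by (simp_all add: restrict_carrier_def Gplus_bar_eq B_bar_Lp)

lemma Gbar_alg_simps: "add Gbar_alg = add (\<H>)" "smult Gbar_alg = smult (\<H>)"
  by (simp_all add: restrict_carrier_def)

lemma PX_subspace: "pm.subspace PX"
  by (simp add: PX_def pm_subspace_subalg)

section \<open>Tensors modulo bilinear relations\<close>

definition pairs :: "(('i, 'k) U_elt set \<times> ('i, 'k) U_elt set) set" where
  "pairs = Pi ` PX \<times> Lp ` A"

definition rels :: "(('i, 'k) U_elt set \<times> ('i, 'k) U_elt set \<Rightarrow>\<^sub>0 'k) set" where
  "rels = pm.span (bilinear_relations Gbar_alg Bbar_alg)"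

lemma rels_subspace [simp]: "pm.subspace rels"
  by (simp add: rels_def)

lemmas rels_add = pm.subspace_add[OF rels_subspace] and rels_diff = pm.subspace_diff[OF rels_subspace]
  and rels_scale = pm.subspace_scale[OF rels_subspace] and rels_zero [simp] = pm.subspace_0[OF rels_subspace]

lemma rels_intros:
  assumes "g \<in> PX" "a \<in> A"
  shows "h \<in> PX \<Longrightarrow> bv (Pi (g + h), Lp a) - bv (Pi g, Lp a) - bv (Pi h, Lp a) \<in> rels"
    and "b \<in> A \<Longrightarrow> bv (Pi g, Lp (a + b)) - bv (Pi g, Lp a) - bv (Pi g, Lp b) \<in> rels"
    and "bv (Pi (pm_scale d g), Lp a) - pm_scale d (bv (Pi g, Lp a)) \<in> rels"
    and "bv (Pi g, Lp (pm_scale d a)) - pm_scale d (bv (Pi g, Lp a)) \<in> rels"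
proof -
  have PP: "f \<in> PP" if "f \<in> PX" for f using that PX_PP by blast
  have c: "Pi f \<in> carrier Gbar_alg" if "f \<in> PX" for f using that by (simp add: Gbar_carrier)
  have c': "Lp b \<in> carrier Bbar_alg" if "b \<in> A" for b using that by (simp add: Bbar_carrier)
  note base = pm.span_base[of _ "bilinear_relations Gbar_alg Bbar_alg", folded rels_def]
  show "bv (Pi (g + h), Lp a) - bv (Pi g, Lp a) - bv (Pi h, Lp a) \<in> rels" if "h \<in> PX"
    unfolding He.p_add[OF PP[OF assms(1)] PP[OF that]]
    by (rule base, unfold bilinear_relations_def Gbar_alg_simps) (use c c' assms that in blast)
  show "bv (Pi g, Lp (a + b)) - bv (Pi g, Lp a) - bv (Pi g, Lp b) \<in> rels" if "b \<in> A"
    unfolding Lp_add[OF A_V[OF assms(2)] A_V[OF that]]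
    by (rule base, unfold bilinear_relations_def Bbar_alg_simps) (use c c' assms that in blast)
  show "bv (Pi (pm_scale d g), Lp a) - pm_scale d (bv (Pi g, Lp a)) \<in> rels"
    unfolding He.p_scale[OF PP[OF assms(1)]] single_conv_bv[symmetric]
    by (rule base, unfold bilinear_relations_def Gbar_alg_simps) (use c c' assms in blast)
  show "bv (Pi g, Lp (pm_scale d a)) - pm_scale d (bv (Pi g, Lp a)) \<in> rels"
    unfolding Lp_scale[OF A_V[OF assms(2)]] single_conv_bv[symmetric]
    by (rule base, unfold bilinear_relations_def Bbar_alg_simps) (use c c' assms in blast)
qed

lemma rels_zero_left: "a \<in> A \<Longrightarrow> bv (Pi 0, Lp a) \<in> rels"
  using rels_intros(3)[of 0 a 0] pm.subspace_0[OF PX_subspace] by simp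

lemma rels_zero_right: "g \<in> PX \<Longrightarrow> bv (Pi g, Lp 0) \<in> rels"
  using rels_intros(4)[of g 0 0] by simp

definition xlin :: "('i, 'k) free_alg \<Rightarrow> ('i generator, 'k) free_alg" where
  "xlin = lext xword"

lemma plin_xlin [simp, intro]: "plin xlin"
  by (simp add: xlin_def)

lemma xlin_simps [simp]: "xlin (u + v) = xlin u + xlin v" "xlin (pm_scale d u) = pm_scale d (xlin u)"
  "xlin 0 = 0" "xlin (bv w) = xword w"
  by (simp_all add: xlin_def)

lemma xlin_PX [simp, intro]: "xlin u \<in> PX"
  unfolding xlin_def by (rule lext_in_subspace[OF PX_subspace]) (rule xword_PX)

lemma xlin_mult: "xlin (u * v) = xlin u * xlin v"
proof (rule plin_eqI[where a = u and f = "\<lambda>u. xlin (u * v)"], goal_cases)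
  case (3 x)
  show ?case
    by (rule plin_eqI[where a = v and f = "\<lambda>v. xlin (bv x * v)"])
      (auto simp: bv_mult xword_add intro: plin_comp[OF plin_xlin])
qed (auto intro: plin_comp[OF plin_xlin])

lemma PX_xlin: "f \<in> PX \<Longrightarrow> \<exists>u. f = xlin u"
  unfolding PX_def
proof (induction rule: subalg.induct)
  case one
  show ?case by (rule exI[of _ "bv 0"]) (simp add: xlin_def del: single_one)
next
  case (gen g)
  then obtain i where "g = xgen i" by blast
  then show ?case using xword_letter_add[of i 0] by (intro exI[of _ "bv (FMon [i])"]) simp
next
  case (add f g) then show ?case by (metis xlin_simps(1))
next
  case (mult f g) then show ?case by (metis xlin_mult)
next
  case (scale f d) then show ?case by (metis xlin_simps(2))
qed

lemma rels_expand_left: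
  assumes a: "a \<in> A"
  shows "bv (Pi (xlin u), Lp a) - lext (\<lambda>w. bv (Pi (xword w), Lp a)) u \<in> rels"
proof (induction u rule: pm_induct)
  case zero then show ?case using rels_zero_left[OF a] by simp
next
  case (scale d u)
  from rels_add[OF rels_intros(3)[OF xlin_PX a, of d u] rels_scale[OF scale, of d]]
  show ?case by (simp add: pm.scale_right_diff_distrib)
next
  case (add u v)
  from rels_add[OF rels_add[OF rels_intros(1)[OF xlin_PX a xlin_PX, of u v] add(1)] add(2)]
  show ?case by (simp add: algebra_simps)
qed simp

lemma rels_expand_right:
  assumes g: "g \<in> PX" and a: "a \<in> A"
  shows "bv (Pi g, Lp a) - lext (\<lambda>x. bv (Pi g, Lp (bv x))) a \<in> rels"
proof -
  have "a \<in> A \<and> bv (Pi g, Lp a) - lext (\<lambda>x. bv (Pi g, Lp (bv x))) a \<in> rels"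
  proof (induction a rule: pm_induct)
    case zero then show ?case using rels_zero_right[OF g] by simp
  next
    case (scale d b)
    with rels_add[OF rels_intros(4)[OF g, of b d] rels_scale[of _ d]]
    show ?case by (force simp: pm.scale_right_diff_distrib)
  next
    case (add b b')
    then have b: "b \<in> A" "b' \<in> A" by auto
    from rels_add[OF rels_add[OF rels_intros(2)[OF g b]]] add
    have "bv (Pi g, Lp (b + b')) - bv (Pi g, Lp b) - bv (Pi g, Lp b')
        + (bv (Pi g, Lp b) - lext (\<lambda>x. bv (Pi g, Lp (bv x))) b)
        + (bv (Pi g, Lp b') - lext (\<lambda>x. bv (Pi g, Lp (bv x))) b') \<in> rels" by blast
    with b show ?case by (simp add: algebra_simps)
  next
    case (single x)
    then show ?case using supp_spaceD[OF a[unfolded A_def] single] by (cases x) auto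
  qed
  then show ?thesis by blast
qed

text \<open>A normal form for tensors and the candidate inverse of multiplication: in the
  coordinates \<open>Lp\<close>, the element \<open>X_w K_l Psi(v)\<close> comes from
  \<open>X_w \<otimes> K_l Psi(v)\<close>.\<close>

definition Phi :: "('i pbw \<Rightarrow>\<^sub>0 'k) \<Rightarrow> (('i, 'k) U_elt set \<times> ('i, 'k) U_elt set \<Rightarrow>\<^sub>0 'k)" where
  "Phi = lext (\<lambda>(w, l, v). bv (Pi (xword w), Lp (bv (0, l, v))))"

lemma plin_Phi [simp, intro]: "plin Phi"
  by (simp add: Phi_def)

lemma Phi_simps [simp]: "Phi (a + b) = Phi a + Phi b" "Phi (pm_scale d a) = pm_scale d (Phi a)" "Phi 0 = 0"
  "Phi (bv (w, l, v)) = bv (Pi (xword w), Lp (bv (0, l, v)))"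
  by (simp_all add: Phi_def)

lemma Phi_XW: "a \<in> A \<Longrightarrow> Phi (XW w a) = lext (\<lambda>x. bv (Pi (xword w), Lp (bv x))) a"
  by (rule plin_eqI[where a = a and f = "\<lambda>a. Phi (XW w a)"])
    (auto simp: A_def dest!: supp_spaceD intro: plin_comp[OF plin_Phi])

definition smash :: "('i, 'k) free_alg \<Rightarrow> ('i pbw \<Rightarrow>\<^sub>0 'k) \<Rightarrow> ('i pbw \<Rightarrow>\<^sub>0 'k)" where
  "smash u a = lext (\<lambda>w. XW w a) u"

lemma smash_V: "a \<in> V \<Longrightarrow> smash u a \<in> V"
  unfolding smash_def by (rule lext_in_subspace) (auto simp: XW_V)

lemma pure_tensor_Phi:
  assumes a: "a \<in> A"
  shows "bv (Pi (xlin u), Lp a) - Phi (smash u a) \<in> rels"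
proof -
  have "lext (\<lambda>w. bv (Pi (xword w), Lp a) - lext (\<lambda>x. bv (Pi (xword w), Lp (bv x))) a) u \<in> rels"
    by (rule lext_in_subspace) (auto intro: rels_expand_right[OF xword_PX a])
  moreover have "lext (\<lambda>w. bv (Pi (xword w), Lp a) - lext (\<lambda>x. bv (Pi (xword w), Lp (bv x))) a) u
      = lext (\<lambda>w. bv (Pi (xword w), Lp a)) u - Phi (smash u a)"
    using a by (simp add: smash_def plin_lext_swap[OF plin_Phi] Phi_XW)
      (simp add: lext_def pm.scale_right_diff_distrib sum_subtractf)
  ultimately show ?thesis using rels_add[OF rels_expand_left[OF a, of u]] by fastforce
qed

lemma ellt_XW: "ellt (XW w a) = xword w * ellt a"
  by (induction w rule: fmon_induct) (simp_all add: ellt_XX mult.assoc)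

lemma Theta_XW: "Theta (XW w a) = XW w (Theta a)"
  by (induction w rule: fmon_induct) (simp_all add: Theta_XX)

lemma ellt_Theta_smash: "ellt (Theta (smash u a)) = xlin u * ellt (Theta a)"
  by (rule plin_eqI[where a = u and f = "\<lambda>u. ellt (Theta (smash u a))"])
    (auto simp: smash_def Theta_XW ellt_XW intro: plin_comp[OF plin_xlin])

lemma Lp_smash: "a \<in> A \<Longrightarrow> Lp (smash u a) = Pi (xlin u) \<otimes>\<^bsub>\<H>\<^esub> Lp a"
  using PX_PP by (subst Pi_mult_Lp) (auto simp: A_V Lp_def ellt_Theta_smash)

text \<open>Chosen representatives of the products turn the finite sum in \<open>evl\<close> into a
  computation in the free algebra.\<close>

definition lift :: "('i, 'k) U_elt set \<times> ('i, 'k) U_elt set \<Rightarrow> ('i generator, 'k) free_alg" where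
  "lift p = (SOME f. f \<in> PP \<and> Pi f = fst p \<otimes>\<^bsub>\<H>\<^esub> snd p)"

lemma lift: 
  assumes "g \<in> PX" "a \<in> A"
  shows "lift (Pi g, Lp a) \<in> PP" "Pi (lift (Pi g, Lp a)) = Pi g \<otimes>\<^bsub>\<H>\<^esub> Lp a"
proof -
  have "g \<in> PP" using assms PX_PP by blast
  then have "Pi g \<otimes>\<^bsub>\<H>\<^esub> Lp a \<in> carrier (\<H>)" using assms by (simp add: A_V)
  then have "\<exists>f. f \<in> PP \<and> Pi f = fst (Pi g, Lp a) \<otimes>\<^bsub>\<H>\<^esub> snd (Pi g, Lp a)"
    by (auto simp: He.carrier_eq)
  from someI_ex[OF this] show "lift (Pi g, Lp a) \<in> PP" "Pi (lift (Pi g, Lp a)) = Pi g \<otimes>\<^bsub>\<H>\<^esub> Lp a"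
    by (simp_all add: lift_def)
qed

abbreviation "FM \<equiv> supp_space (\<lambda>p. p \<in> pairs) :: (('i, 'k) U_elt set \<times> ('i, 'k) U_elt set \<Rightarrow>\<^sub>0 'k) set"

lemma lift_pairs: "p \<in> pairs \<Longrightarrow> lift p \<in> PP \<and> Pi (lift p) = fst p \<otimes>\<^bsub>\<H>\<^esub> snd p"
  using lift by (auto simp: pairs_def)

lemma lext_lift_PP: "f \<in> FM \<Longrightarrow> lext lift f \<in> PP"
  by (rule He.P_lext) (auto dest: supp_spaceD lift_pairs)

definition evl :: "(('i, 'k) U_elt set \<times> ('i, 'k) U_elt set \<Rightarrow>\<^sub>0 'k) \<Rightarrow> ('i, 'k) U_elt set" where
  "evl f = finsum (\<H>) (\<lambda>p. Poly_Mapping.lookup f p \<odot>\<^bsub>\<H>\<^esub> (fst p \<otimes>\<^bsub>\<H>\<^esub> snd p)) (Poly_Mapping.keys f)"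

lemma evl_eq:
  assumes f: "f \<in> FM"
  shows "evl f = Pi (lext lift f)"
proof -
  have p: "lift p \<in> PP \<and> Pi (lift p) = fst p \<otimes>\<^bsub>\<H>\<^esub> snd p" if "p \<in> Poly_Mapping.keys f" for p
    using supp_spaceD[OF f that] lift_pairs by blast
  have "evl f = finsum (\<H>) (\<lambda>p. Pi (pm_scale (Poly_Mapping.lookup f p) (lift p))) (Poly_Mapping.keys f)"
    unfolding evl_def by (rule He.finsum_cong') (use p in \<open>auto simp: He.p_scale\<close>)
  also have "\<dots> = Pi (lext lift f)"
    unfolding lext_def using p by (intro He.finsum_p) auto
  finally show ?thesis .
qed

lemma evl_bilinear_relations: "r \<in> bilinear_relations Gbar_alg Bbar_alg \<Longrightarrow> r \<in> FM \<and> Pi (lext lift r) = Pi 0"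
proof -
  assume r: "r \<in> bilinear_relations Gbar_alg Bbar_alg"
  have PP: "f \<in> PP" if "f \<in> PX" for f using that PX_PP by blast
  have PX: "f + g \<in> PX" "pm_scale d f \<in> PX" if "f \<in> PX" "g \<in> PX" for f g d
    using that PX_subspace by (auto simp: pm.subspace_def)
  have p: "(Pi g, Lp a) \<in> pairs" if "g \<in> PX" "a \<in> A" for g a using that by (auto simp: pairs_def)
  have sum: "r \<in> FM \<and> Pi (lext lift r) = Pi 0"
    if "r = bv x - bv y - bv z" "x \<in> pairs" "y \<in> pairs" "z \<in> pairs"
      "Pi (lift x) = Pi (lift y + lift z)" for x y z
  proof -
    have "lift x \<in> PP" "lift y + lift z \<in> PP" using that lift_pairs by auto
    then have "Pi (lift x - (lift y + lift z)) = Pi 0"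
      using that(5) He.p_eq_iff by (simp add: He.p_zero)
    then show ?thesis using that by (simp add: diff_diff_eq supp_space_diff supp_space_add)
  qed
  have scale: "r \<in> FM \<and> Pi (lext lift r) = Pi 0"
    if "r = bv x - pm_scale d (bv y)" "x \<in> pairs" "y \<in> pairs" "Pi (lift x) = Pi (pm_scale d (lift y))" for d x y
  proof -
    have "lift x \<in> PP" "pm_scale d (lift y) \<in> PP" using that lift_pairs by auto
    then have "Pi (lift x - pm_scale d (lift y)) = Pi 0"
      using that(4) He.p_eq_iff by (simp add: He.p_zero)
    moreover have "r \<in> FM" unfolding that(1) by (intro supp_space_diff supp_space_scale) (simp_all add: that)
    ultimately show ?thesis using that by simp
  qed
  from r consider
      g h a where "g \<in> PX" "h \<in> PX" "a \<in> A" "r = bv (Pi (g + h), Lp a) - bv (Pi g, Lp a) - bv (Pi h, Lp a)"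
    | g a b where "g \<in> PX" "a \<in> A" "b \<in> A" "r = bv (Pi g, Lp (a + b)) - bv (Pi g, Lp a) - bv (Pi g, Lp b)"
    | d g a where "g \<in> PX" "a \<in> A" "r = bv (Pi (pm_scale d g), Lp a) - pm_scale d (bv (Pi g, Lp a))"
    | d g a where "g \<in> PX" "a \<in> A" "r = bv (Pi g, Lp (pm_scale d a)) - pm_scale d (bv (Pi g, Lp a))"
    unfolding bilinear_relations_def Gbar_carrier Bbar_carrier Gbar_alg_simps Bbar_alg_simps
    by (auto simp: He.p_add[symmetric] He.p_scale[symmetric] Lp_add[symmetric] Lp_scale[symmetric] PP A_V
        pm_scale_single)
  then show ?thesis
  proof cases
    case (1 g h a)
    note gh = PX(1)[OF 1(1,2)]
    have "Pi (lift (Pi (g + h), Lp a)) = Pi (g + h) \<otimes>\<^bsub>\<H>\<^esub> Lp a" by (rule lift[OF gh 1(3)])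
    also have "\<dots> = Pi (lift (Pi g, Lp a) + lift (Pi h, Lp a))"
      using 1 by (simp add: He.p_add lift PP He.l_distr A_V)
    finally show ?thesis by (rule sum[OF 1(4) p[OF gh 1(3)] p[OF 1(1,3)] p[OF 1(2,3)]])
  next
    case (2 g a b)
    note ab = A_add[OF 2(2,3)]
    have "Pi (lift (Pi g, Lp (a + b))) = Pi g \<otimes>\<^bsub>\<H>\<^esub> Lp (a + b)" by (rule lift[OF 2(1) ab])
    also have "\<dots> = Pi (lift (Pi g, Lp a) + lift (Pi g, Lp b))"
      using 2 by (simp add: He.p_add lift PP He.r_distr A_V Lp_add)
    finally show ?thesis by (rule sum[OF 2(4) p[OF 2(1) ab] p[OF 2(1,2)] p[OF 2(1,3)]])
  next
    case (3 d g a)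
    note dg = PX(2)[OF 3(1,1)]
    have "Pi (lift (Pi (pm_scale d g), Lp a)) = Pi (pm_scale d g) \<otimes>\<^bsub>\<H>\<^esub> Lp a"
      by (rule lift[OF dg 3(2)])
    also have "\<dots> = Pi (pm_scale d (g * ellt (Theta a)))"
      using 3 PP[OF dg] by (simp add: Pi_mult_Lp A_V pm_scale_mult_left)
    also have "\<dots> = d \<odot>\<^bsub>\<H>\<^esub> (Pi g \<otimes>\<^bsub>\<H>\<^esub> Lp a)"
      using 3 PP[OF 3(1)] by (simp add: Pi_mult_Lp He.p_scale A_V)
    also have "\<dots> = Pi (pm_scale d (lift (Pi g, Lp a)))" using 3 by (simp add: He.p_scale lift)
    finally show ?thesis by (rule scale[OF 3(3) p[OF dg 3(2)] p[OF 3(1,2)]])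
  next
    case (4 d g a)
    note da = A_scale[OF 4(2), of d]
    have "Pi (lift (Pi g, Lp (pm_scale d a))) = Pi g \<otimes>\<^bsub>\<H>\<^esub> Lp (pm_scale d a)"
      by (rule lift[OF 4(1) da])
    also have "\<dots> = Pi (pm_scale d (g * ellt (Theta a)))"
      using 4 PP[OF 4(1)] by (simp add: Pi_mult_Lp A_V pm_scale_mult_right)
    also have "\<dots> = d \<odot>\<^bsub>\<H>\<^esub> (Pi g \<otimes>\<^bsub>\<H>\<^esub> Lp a)"
      using 4 PP[OF 4(1)] by (simp add: Pi_mult_Lp He.p_scale A_V)
    also have "\<dots> = Pi (pm_scale d (lift (Pi g, Lp a)))" using 4 by (simp add: He.p_scale lift)
    finally show ?thesis by (rule scale[OF 4(3) p[OF 4(1) da] p[OF 4(1,2)]])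
  qed
qed

lemma evl_rels:
  assumes "r \<in> rels"
  shows "r \<in> FM" "evl r = \<zero>\<^bsub>\<H>\<^esub>"
proof -
  let ?Q = "{f \<in> FM. Pi (lext lift f) = Pi 0}"
  have sub: "pm.subspace ?Q"
    using He.p_add_cong[of _ _ 0 0] He.p_scale_cong[of _ 0]
    by (auto simp: pm.subspace_def supp_space_add supp_space_scale lext_lift_PP)
  have "rels \<subseteq> ?Q"
    unfolding rels_def by (rule pm.span_minimal[OF _ sub]) (use evl_bilinear_relations in blast)
  with assms show "r \<in> FM" "evl r = \<zero>\<^bsub>\<H>\<^esub>" by (auto simp: evl_eq He.p_zero)
qed

lemma evl_add: "f \<in> FM \<Longrightarrow> g \<in> FM \<Longrightarrow> evl (f + g) = evl f \<oplus>\<^bsub>\<H>\<^esub> evl g"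
  and evl_scale: "f \<in> FM \<Longrightarrow> evl (pm_scale d f) = d \<odot>\<^bsub>\<H>\<^esub> evl f"
  by (simp_all add: evl_eq supp_space_add supp_space_scale lext_lift_PP He.p_add He.p_scale)

lemma evl_closed: "f \<in> FM \<Longrightarrow> evl f \<in> carrier (\<H>)"
  by (simp add: evl_eq lext_lift_PP)

text \<open>On a pure tensor the left factor is a combination of words \<open>X_w\<close>, so
  bilinearity brings it to normal form; the same coordinates describe its product. Sums and
  multiples follow.\<close>

lemma FM_Phi:
  assumes "f \<in> FM"
  shows "\<exists>z\<in>V. f - Phi z \<in> rels \<and> evl f = Lp z"
proof -
  have "f \<in> FM \<and> (\<exists>z\<in>V. f - Phi z \<in> rels \<and> evl f = Lp z)"
  proof (induction f rule: pm_induct)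
    case zero
    have "evl 0 = Lp 0" using evl_rels(2)[OF rels_zero] by (simp only: Lp_zero)
    moreover have "0 - Phi 0 \<in> rels" by simp
    ultimately show ?case using V_0 supp_space_0 by blast
  next
    case (scale d f)
    then obtain z where z: "f \<in> FM" "z \<in> V" "f - Phi z \<in> rels" "evl f = Lp z" by blast
    from rels_scale[OF z(3), of d] have "pm_scale d f - Phi (pm_scale d z) \<in> rels"
      by (simp add: pm.scale_right_diff_distrib)
    moreover have "evl (pm_scale d f) = Lp (pm_scale d z)" using z by (simp add: evl_scale Lp_scale)
    ultimately show ?case using supp_space_scale[OF z(1), of d] V_scale[OF z(2), of d] by blast
  next
    case (add f g)
    then obtain z z' where z: "f \<in> FM" "z \<in> V" "f - Phi z \<in> rels" "evl f = Lp z"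
      "g \<in> FM" "z' \<in> V" "g - Phi z' \<in> rels" "evl g = Lp z'" by blast
    from rels_add[OF z(3,7)] have "f + g - Phi (z + z') \<in> rels" by (simp add: algebra_simps)
    moreover have "evl (f + g) = Lp (z + z')" using z by (simp add: evl_add Lp_add)
    ultimately show ?case using supp_space_add[OF z(1,5)] V_add[OF z(2,6)] by blast
  next
    case (single p)
    then have p: "p \<in> pairs" using supp_spaceD[OF assms] by blast
    then obtain g a where ga: "g \<in> PX" "a \<in> A" "p = (Pi g, Lp a)" by (auto simp: pairs_def)
    then obtain u where u: "g = xlin u" using PX_xlin by blast
    have "evl (bv p) = Lp (smash u a)"
      using p ga u by (simp add: evl_eq lift Lp_smash)
    with p ga u show ?case using pure_tensor_Phi[OF ga(2), of u] smash_V[OF A_V[OF ga(2)]] by auto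
  qed
  then show ?thesis by blast
qed

lemma pi_xlin_I:
  assumes "f \<in> \<I>"
  shows "pi (xlin f) = pi 0"
proof -
  have "ellt (wpart 0 0 f) = xlin f * kkt 0"
    by (rule plin_eqI[where a = f and f = "\<lambda>f. ellt (wpart 0 0 f)"])
      (auto simp: ellt_bv intro: plin_comp[OF plin_xlin])
  moreover have "pi (ellt (wpart 0 0 f)) = pi 0"
    using assms by (simp add: pi_ellt pi_ell_N wpart_N wpart_V)
  moreover have "pi (xlin f * kkt 0) = pi (xlin f * 1)"
    using kkt[of 0] pi_kk_0 by (intro pi_mult_cong refl) simp
  ultimately show ?thesis by simp
qed

lemma Phi_N:
  assumes "z \<in> V" "z \<in> N"
  shows "Phi z \<in> rels"
proof -
  \<comment> \<open>Generators of \<open>N\<close> may involve exponents outside \<open>Lth\<close>,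
    for which \<open>Phi\<close> does not give tensors of the two subalgebras. The projection
    removes them and fixes \<open>z\<close>.\<close>
  let ?r = "lrestrict (\<lambda>l. l \<in> Lth)"
  have "Phi (?r z) \<in> rels"
  proof (rule N_closed[OF plin_comp[OF plin_Phi plin_lrestrict] rels_subspace assms(2)])
    fix l v f assume f: "f \<in> \<I>"
    show "Phi (?r (wpart l v f)) \<in> rels"
    proof (cases "l \<in> Lth")
      case True
      then have a: "bv (0, l, v) \<in> A" by simp
      have "Phi (wpart l v f) = lext (\<lambda>w. bv (Pi (xword w), Lp (bv (0, l, v)))) f"
        by (simp add: wpart_def plin_lext_swap[OF plin_Phi])
      moreover have "bv (Pi (xlin f), Lp (bv (0, l, v))) \<in> rels"
        using rels_zero_left[OF a] Pi_cong[OF pi_xlin_I[OF f]] by simp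
      ultimately have "Phi (wpart l v f) \<in> rels"
        using rels_diff[OF _ rels_expand_left[OF a, of f]] by fastforce
      with True show ?thesis by (simp add: lrestrict_wpart)
    qed (simp add: lrestrict_wpart)
  next
    fix w l g assume g: "g \<in> \<I>"
    show "Phi (?r (vpart w l g)) \<in> rels"
    proof (cases "l \<in> Lth")
      case True
      then have a: "vpart 0 l g \<in> A" by (rule vpart_A)
      have "vpart w l g = XW w (vpart 0 l g)"
        by (simp add: vpart_def plin_lext_swap[OF plin_XW])
      then have "Phi (vpart w l g) = lext (\<lambda>x. bv (Pi (xword w), Lp (bv x))) (vpart 0 l g)"
        using a by (simp add: Phi_XW)
      moreover have "Lp (vpart 0 l g) = Lp 0"
        using a g by (simp add: Lp_eq_iff A_V vpart_N)
      then have "bv (Pi (xword w), Lp (vpart 0 l g)) \<in> rels"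
        using rels_zero_right[OF xword_PX] by simp
      ultimately have "Phi (vpart w l g) \<in> rels"
        using rels_diff[OF _ rels_expand_right[OF xword_PX a, of w]] by fastforce
      with True show ?thesis by (simp add: lrestrict_vpart)
    qed (simp add: lrestrict_vpart)
  qed
  moreover have "?r z = z" using assms(1) by (simp add: lrestrict_ident V_def)
  ultimately show ?thesis by simp
qed

text \<open>The normal form of \<open>f\<close> has coordinates in \<open>N\<close>, and on
  \<open>N\<close> the map \<open>Phi\<close> takes values in the bilinear relations. This is
  injectivity of multiplication.\<close>

lemma evl_zero_imp:
  assumes "f \<in> FM" "evl f = \<zero>\<^bsub>\<H>\<^esub>"
  shows "f \<in> rels"
proof -
  obtain z where z: "z \<in> V" "f - Phi z \<in> rels" "evl f = Lp z" using FM_Phi[OF assms(1)] by blast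
  then have "z \<in> N" using assms(2) Lp_eq_iff[of z 0] by (simp add: Lp_zero)
  from rels_add[OF z(2) Phi_N[OF z(1) this]] show ?thesis by simp
qed

lemma Phi_FM: "a \<in> V \<Longrightarrow> Phi a \<in> FM"
  by (rule V_induct[OF plin_Phi subspace_supp_space]) (auto simp: pairs_def xword_PX)

lemma evl_Phi:
  assumes a: "a \<in> V"
  shows "evl (Phi a) = Lp a"
proof -
  have "evl (Phi a) = Pi (lext lift (Phi a))" using Phi_FM[OF a] by (rule evl_eq)
  also have "\<dots> = Pi (ellt (Theta a))"
  proof (rule He.p_plin_eqI[where a = a and f = "\<lambda>a. lext lift (Phi a)"])
    fix x assume "x \<in> Poly_Mapping.keys a"
    then obtain w l v where x: "x = (w, l, v)" "l \<in> Lth"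
      using supp_spaceD[OF a[unfolded V_def], of x] by (cases x) auto
    then have b: "bv (0, l, v) \<in> A" by simp
    have w: "xword w \<in> PP" using xword_PX PX_PP by blast
    have "Theta (bv x) = XW w (Theta (bv (0, l, v)))" by (simp add: x Theta_bv)
    then have "Pi (ellt (Theta (bv x))) = Pi (xword w) \<otimes>\<^bsub>\<H>\<^esub> Lp (bv (0, l, v))"
      using w b by (simp add: ellt_XW Pi_mult_Lp A_V)
    then show "lext lift (Phi (bv x)) \<in> PP \<and> ellt (Theta (bv x)) \<in> PP \<and> Pi (lext lift (Phi (bv x))) = Pi (ellt (Theta (bv x)))"
      using lift[OF xword_PX b, of w] x by simp
  qed auto
  finally show ?thesis by (simp add: Lp_def)
qed

abbreviation "TM \<equiv> free_module (carrier Gbar_alg \<times> carrier Bbar_alg) :: ('k, (('i, 'k) U_elt set \<times> ('i, 'k) U_elt set) \<Rightarrow>\<^sub>0 'k) module"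
abbreviation "TP \<equiv> tensor Gbar_alg Bbar_alg"

definition tcl :: "(('i, 'k) U_elt set \<times> ('i, 'k) U_elt set \<Rightarrow>\<^sub>0 'k) \<Rightarrow> (('i, 'k) U_elt set \<times> ('i, 'k) U_elt set \<Rightarrow>\<^sub>0 'k) set" where
  "tcl f = (\<lambda>r. r + f) ` rels"

lemma TM_coset: "rels +>\<^bsub>TM\<^esub> f = tcl f"
  by (auto simp: tcl_def a_r_coset_def' free_module_def)

lemma TP_eq: "TP = quot_alg TM rels"
  by (simp add: tensor_def Let_def lin_span_free_module rels_def)

lemma TM_carrier: "carrier TM = FM"
  by (auto simp: free_module_def supp_space_def pairs_def Gbar_carrier Bbar_carrier)

lemma TP_carrier: "carrier TP = tcl ` FM"
proof -
  have "carrier TP = (\<lambda>f. rels +>\<^bsub>TM\<^esub> f) ` carrier TM"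
    unfolding TP_eq quot_alg_def by (auto simp: FactRing_simps)
  then show ?thesis by (simp only: TM_coset TM_carrier)
qed

lemma tcl_eq: "tcl f = tcl g \<longleftrightarrow> f - g \<in> rels"
proof
  assume "tcl f = tcl g"
  moreover have "0 + f \<in> tcl f" unfolding tcl_def by (rule imageI) simp
  ultimately show "f - g \<in> rels" by (auto simp: tcl_def)
next
  assume fg: "f - g \<in> rels"
  have sub: "tcl f \<subseteq> tcl g" if "f - g \<in> rels" for f g
    unfolding tcl_def
  proof (intro image_subsetI)
    fix r assume "r \<in> rels"
    then show "r + f \<in> (\<lambda>r. r + g) ` rels"
      using rels_add[OF _ that, of r] by (intro image_eqI[of _ _ "r + (f - g)"]) simp_all
  qed
  have "g - f \<in> rels" using rels_scale[OF fg, of "- 1"] by simp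
  with fg sub show "tcl f = tcl g" by blast
qed

lemma TP_add: "tcl f \<oplus>\<^bsub>TP\<^esub> tcl g = tcl (f + g)"
proof -
  have "tcl f \<oplus>\<^bsub>TP\<^esub> tcl g = {x + y | x y. x \<in> tcl f \<and> y \<in> tcl g}"
    by (auto simp: TP_eq quot_alg_def FactRing_def set_add_def' free_module_def)
  also have "\<dots> = tcl (f + g)"
  proof (intro equalityI subsetI)
    fix x assume "x \<in> {x + y | x y. x \<in> tcl f \<and> y \<in> tcl g}"
    then obtain r s where "r \<in> rels" "s \<in> rels" "x = (r + s) + (f + g)" by (auto simp: tcl_def algebra_simps)
    then show "x \<in> tcl (f + g)" by (auto simp: tcl_def rels_add)
  next
    fix x assume "x \<in> tcl (f + g)"
    then obtain r where "r \<in> rels" "x = (r + f) + (0 + g)" by (auto simp: tcl_def algebra_simps)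
    then show "x \<in> {x + y | x y. x \<in> tcl f \<and> y \<in> tcl g}" unfolding tcl_def using rels_zero by blast
  qed
  finally show ?thesis .
qed

lemma TP_smult: "d \<odot>\<^bsub>TP\<^esub> tcl f = tcl (pm_scale d f)"
proof -
  have "d \<odot>\<^bsub>TP\<^esub> tcl f = (\<Union>x\<in>tcl f. tcl (pm_scale d x))"
    unfolding TP_eq quot_alg_def by (simp add: TM_coset) (simp add: free_module_def)
  moreover have "tcl (pm_scale d x) = tcl (pm_scale d f)" if "x \<in> tcl f" for x
  proof -
    from that obtain r where "r \<in> rels" "x = r + f" by (auto simp: tcl_def)
    then show ?thesis unfolding tcl_eq by (simp add: pm.scale_right_distrib rels_scale)
  qed
  moreover have "rels \<noteq> {}" using rels_zero by blast
  then have "tcl f \<noteq> {}" by (simp add: tcl_def)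
  ultimately show ?thesis by auto
qed

lemma tensor_mult_tcl: "f \<in> FM \<Longrightarrow> tensor_mult (\<H>) (tcl f) = evl f"
proof -
  assume f: "f \<in> FM"
  have "evl (r + f) = evl f" if "r \<in> rels" for r
    using evl_rels[OF that] f by (simp add: evl_add evl_closed)
  then have "evl ` tcl f = {evl f}" using rels_zero unfolding tcl_def by force
  then show ?thesis by (simp add: tensor_mult_def evl_def)
qed

lemma iwasawa: "iwasawa_decomposition chi \<I> \<tau> c"
  unfolding iwasawa_decomposition_def linear_iso_def
proof (intro conjI ballI allI)
  show "bij_betw (tensor_mult (\<H>)) (carrier TP) (carrier (\<H>))"
  proof (rule bij_betw_imageI)
    show "inj_on (tensor_mult (\<H>)) (carrier TP)"
      unfolding TP_carrier
    proof (rule inj_onI, clarify)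
      fix f g assume f: "f \<in> FM" and g: "g \<in> FM"
        and "tensor_mult (\<H>) (tcl f) = tensor_mult (\<H>) (tcl g)"
      then have "Pi (lext lift f) = Pi (lext lift g)" by (simp add: tensor_mult_tcl evl_eq)
      then have "Pi (lext lift (f - g)) = \<zero>\<^bsub>\<H>\<^esub>"
        using f g by (simp add: lext_lift_PP He.p_eq_iff)
      then have "f - g \<in> rels"
        using f g by (intro evl_zero_imp) (simp_all add: evl_eq supp_space_diff)
      then show "tcl f = tcl g" by (simp add: tcl_eq)
    qed
    have "Lp ` V \<subseteq> tensor_mult (\<H>) ` tcl ` FM"
    proof (intro image_subsetI)
      fix a assume a: "a \<in> V"
      then have "Lp a = tensor_mult (\<H>) (tcl (Phi a))"
        by (simp add: tensor_mult_tcl Phi_FM evl_Phi)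
      with Phi_FM[OF a] show "Lp a \<in> tensor_mult (\<H>) ` tcl ` FM" by blast
    qed
    \<comment> \<open>Surjectivity of multiplication is surjectivity of \<open>Theta\<close> on
      \<open>V\<close>.\<close>
    moreover have "carrier (\<H>) \<subseteq> Lp ` V"
      unfolding Heis_carrier Lp_def using Theta_surj by blast
    ultimately show "tensor_mult (\<H>) ` carrier TP = carrier (\<H>)"
      unfolding TP_carrier using evl_closed tensor_mult_tcl by fastforce
  qed
next
  fix x y assume "x \<in> carrier TP" "y \<in> carrier TP"
  then show "tensor_mult (\<H>) (x \<oplus>\<^bsub>TP\<^esub> y)
      = tensor_mult (\<H>) x \<oplus>\<^bsub>\<H>\<^esub> tensor_mult (\<H>) y"
    by (auto simp: TP_carrier TP_add tensor_mult_tcl supp_space_add evl_add)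
next
  fix d x assume "x \<in> carrier TP"
  then show "tensor_mult (\<H>) (d \<odot>\<^bsub>TP\<^esub> x) = d \<odot>\<^bsub>\<H>\<^esub> tensor_mult (\<H>) x"
    by (auto simp: TP_carrier TP_smult tensor_mult_tcl supp_space_scale evl_scale)
qed

end

theorem theoremB:
  fixes chi :: "int ^ 'i \<Rightarrow> int ^ 'i \<Rightarrow> 'k::field"
    and \<I> :: "('i::finite, 'k) free_alg set"
    and \<tau> :: "'i \<Rightarrow> 'i"
    and c :: "'i \<Rightarrow> 'k"
  assumes "bicharacter chi"
    and "\<And>i j. qmat chi i j = qmat chi j i"
    and "biideal chi \<I>"
    and "graded_subspace \<I>"
    and "\<I> \<subseteq> tensor_degree_ge 2"
    and "\<And>i. \<tau> (\<tau> i) = i"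
    and "\<And>i j. qmat chi (\<tau> i) (\<tau> j) = qmat chi i j"
    and "relabel \<tau> ` \<I> = \<I>"
  shows "(\<exists>\<phi>. is_phi_bar chi \<I> \<tau> c \<phi>) \<and>
         (\<forall>\<phi>. is_phi_bar chi \<I> \<tau> c \<phi> \<longrightarrow>
            bij_betw \<phi> (carrier (gr_B_bar chi \<I> \<tau> c)) (carrier (HU chi \<I> \<tau>))) \<and>
         iwasawa_decomposition chi \<I> \<tau> c"
proof -
  interpret nichols_involution chi \<I> \<tau> c
    by unfold_locales (fact assms)+
  show ?thesis using is_phi_bar_phi0 is_phi_bar_bij iwasawa by blast
qed

end
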